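(* (First part.) Let $X=(X_1,\ldots,X_n)$ be a vector of independent random variables whose laws belong to $\mathcal{L}(c_1,c_2)$ for some finite $c_1,c_2$. Let $g\in C^2(\mathbb{R}^n)$ be real valued, with gradient $\nabla g$ and Hessian $\nabla^2 g$. Let $$\kappa_0=\biggl(\mathbb{E}\sum_{i=1}^n\biggl|\frac{\partial g}{\partial x_i}(X)\biggr|^4\biggr)^{1/2},\qquad \kappa_1=(\mathbb{E}\|\nabla g(X)\|^4)^{1/4},\qquad \kappa_2=(\mathbb{E}\|\nabla^2g(X)\|^4)^{1/4}.$$ Suppose $W=g(X)$ has a finite fourth moment and let $\sigma^2=\mathrm{Var}(W)$. Let $Z$ be a normal random variable having the same mean and variance as $W$. Then $$d_{TV}(W,Z)\le\frac{2\sqrt5\,(c_1c_2\kappa_0+c_1^3\kappa_1\kappa_2)}{\sigma^2}.$$ (Second part.) If instead $X$ is a gaussian random vector in $\mathbb{R}^n$ with mean $0$ and covariance matrix $\Sigma$, and $g,\kappa_1,\kappa_2,W,\sigma^2,Z$ are as in the first part (with this $X$, and again $W=g(X)$ having finite fourth moment), then $$d_{TV}(W,Z)\le\frac{2\sqrt5\,\|\Sigma\|^{3/2}\kappa_1\kappa_2}{\sigma^2}.$$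
   Context: For $c_1,c_2>0$, $\mathcal{L}(c_1,c_2)$ is the class of probability measures on $\mathbb{R}$ that are laws of random variables of the form $u(Z_0)$, where $Z_0$ is standard gaussian and $u:\mathbb{R}\to\mathbb{R}$ is twice continuously differentiable with $|u'(x)|\le c_1$ and $|u''(x)|\le c_2$ for all $x\in\mathbb{R}$. The total variation distance is $d_{TV}(W,Z)=\sup_B|\mathbb{P}(W\in B)-\mathbb{P}(Z\in B)|$ over Borel sets $B$. For vectors $\|\cdot\|$ is the Euclidean norm; for matrices it is the operator norm (induced by the Euclidean norm). The expectations defining $\kappa_0,\kappa_1,\kappa_2$ take values in $[0,\infty]$; if one of those appearing in a bound is infinite that bound is void. *)

theory Defs
  imports "HOL-Probability.Probability"
begin

(* Continuity of the second derivative subsumes continuity of the lower ones. *)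
definition C2_real :: "(real \<Rightarrow> real) \<Rightarrow> bool" where
  "C2_real u \<longleftrightarrow>
     (\<forall>x. u differentiable (at x)) \<and>
     (\<forall>x. deriv u differentiable (at x)) \<and>
     continuous_on UNIV (deriv (deriv u))"

definition lip_gauss_laws :: "real \<Rightarrow> real \<Rightarrow> real measure set" where
  "lip_gauss_laws c1 c2 =
     {distr (density lborel (\<lambda>x. ennreal (std_normal_density x))) borel u | u.
        C2_real u \<and> (\<forall>x. \<bar>deriv u x\<bar> \<le> c1) \<and> (\<forall>x. \<bar>deriv (deriv u) x\<bar> \<le> c2)}"

(* The i-th component is the partial derivative of g in direction i. *)
definition gradient :: "(real ^ 'n \<Rightarrow> real) \<Rightarrow> real ^ 'n \<Rightarrow> real ^ 'n" where
  "gradient g x = (\<chi> i. frechet_derivative g (at x) (axis i 1))"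

definition hessian :: "(real ^ 'n \<Rightarrow> real) \<Rightarrow> real ^ 'n \<Rightarrow> real ^ 'n ^ 'n" where
  "hessian g x = jacobian (gradient g) (at x)"

definition C2 :: "(real ^ 'n \<Rightarrow> real) \<Rightarrow> bool" where
  "C2 g \<longleftrightarrow>
     (\<forall>x. g differentiable (at x)) \<and>
     (\<forall>x. gradient g differentiable (at x)) \<and>
     continuous_on UNIV (hessian g)"

definition mat_norm :: "real ^ 'n ^ 'm \<Rightarrow> real" where
  "mat_norm A = onorm (\<lambda>v. A *v v)"

definition ennreal_root :: "nat \<Rightarrow> ennreal \<Rightarrow> ennreal" where
  "ennreal_root k x = (if x = \<top> then \<top> else ennreal (root k (enn2real x)))"

definition kappa0 :: "'a measure \<Rightarrow> ('a \<Rightarrow> real ^ 'n) \<Rightarrow> (real ^ 'n \<Rightarrow> real) \<Rightarrow> ennreal" where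
  "kappa0 M X g =
     ennreal_root 2 (\<integral>\<^sup>+ \<omega>. ennreal (\<Sum>i\<in>UNIV. \<bar>gradient g (X \<omega>) $ i\<bar> ^ 4) \<partial>M)"

definition kappa1 :: "'a measure \<Rightarrow> ('a \<Rightarrow> real ^ 'n) \<Rightarrow> (real ^ 'n \<Rightarrow> real) \<Rightarrow> ennreal" where
  "kappa1 M X g = ennreal_root 4 (\<integral>\<^sup>+ \<omega>. ennreal (norm (gradient g (X \<omega>)) ^ 4) \<partial>M)"

definition kappa2 :: "'a measure \<Rightarrow> ('a \<Rightarrow> real ^ 'n) \<Rightarrow> (real ^ 'n \<Rightarrow> real) \<Rightarrow> ennreal" where
  "kappa2 M X g = ennreal_root 4 (\<integral>\<^sup>+ \<omega>. ennreal (mat_norm (hessian g (X \<omega>)) ^ 4) \<partial>M)"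

(* s is the standard deviation; s = 0 gives the degenerate normal law, a point mass. *)
definition normal_law :: "real \<Rightarrow> real \<Rightarrow> real measure" where
  "normal_law m s =
     (if s = 0 then return borel m
      else density lborel (\<lambda>x. ennreal (normal_density m s x)))"

definition normal_rv :: "'a measure \<Rightarrow> ('a \<Rightarrow> real) \<Rightarrow> bool" where
  "normal_rv M X \<longleftrightarrow>
     X \<in> borel_measurable M \<and> (\<exists>m s. 0 \<le> s \<and> distr M borel X = normal_law m s)"

abbreviation mean :: "'a measure \<Rightarrow> ('a \<Rightarrow> real) \<Rightarrow> real" where
  "mean M X \<equiv> prob_space.expectation M X"

abbreviation var :: "'a measure \<Rightarrow> ('a \<Rightarrow> real) \<Rightarrow> real" where
  "var M X \<equiv> prob_space.variance M X"

(* Gaussian vectors are those all of whose linear functionals are (possibly degenerate)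
   normal, so S may be singular. *)
definition gaussian_vector ::
    "'a measure \<Rightarrow> ('a \<Rightarrow> real ^ 'n) \<Rightarrow> real ^ 'n \<Rightarrow> real ^ 'n ^ 'n \<Rightarrow> bool" where
  "gaussian_vector M X m S \<longleftrightarrow>
     X \<in> borel_measurable M \<and>
     (\<forall>t. normal_rv M (\<lambda>\<omega>. t \<bullet> X \<omega>)) \<and>
     (\<forall>i. mean M (\<lambda>\<omega>. X \<omega> $ i) = m $ i) \<and>
     (\<forall>i j. mean M (\<lambda>\<omega>. (X \<omega> $ i - m $ i) * (X \<omega> $ j - m $ j)) = S $ i $ j)"

definition tv_dist :: "'a measure \<Rightarrow> ('a \<Rightarrow> real) \<Rightarrow> 'b measure \<Rightarrow> ('b \<Rightarrow> real) \<Rightarrow> real" where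
  "tv_dist M W N Z =
     (SUP B\<in>sets borel. \<bar>measure M {\<omega> \<in> space M. W \<omega> \<in> B} - measure N {\<omega> \<in> space N. Z \<omega> \<in> B}\<bar>)"

end

theory Submission
  imports Defs
begin

text \<open>
  In both parts W has the law of h(\<xi>) with \<xi> standard Gaussian and h twice continuously differentiable:
  h is g after the coordinatewise maps u, respectively after a matrix A with S = A ** transpose A.
  Let \<xi>(t) = cos t \<xi> + sin t \<xi>' with an independent copy \<xi>' of \<xi>. The derivative in t of
  E[F(\<xi>) G(\<xi>(t))] is - sin t E[DF(\<xi>) \<bullet> DG(\<xi>(t))], so a bound for these inner product expectations
  that is uniform in t bounds the covariance of F(\<xi>) and G(\<xi>). For F = G this is the Poincare inequality.
  For G = h, F = f(h) - c h and c = E[f'(h(\<xi>))] the inner product expectation is the covariance of f'(h(\<xi>))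
  and T = Dh(\<xi>) \<bullet> Dh(\<xi>(t)), and the Poincare inequality on the doubled space bounds the standard deviation
  of T by 2 K, where K bounds the root mean square of the adjoint Hessian of h at \<xi> applied to Dh(\<xi>(t)).
  Solutions f of Stein's equation satisfy |f'| \<le> 2, which gives 4 K / Var W, and 4 \<le> 2 sqrt 5.
\<close>

section \<open>The standard Gaussian measure\<close>

text \<open>Centring explains the choice of \<open>F\<close>: subtracting c h from f(h) gives the
  scalar factor f'(h) - c of \<open>DF\<close> mean zero, so the mean of T drops out and only its
  fluctuation has to be paid for. The variance of T is estimated for each fixed t, on the space that
  carries both copies. Integrating over t then costs nothing, since sin integrates to 1 over
  [0, pi/2]. The 4 is 2 times 2: the sup bound of f', and the root of Var T <= 4 K^2, where T
  depends on h through each of its two factors and each contributes K. The obstacle is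
  integrability: only second moments of h and fourth moments of Dh are at hand. The interpolation is
  therefore done for compactly supported functions and carried over by cutoffs with uniformly
  bounded gradients. Stein's equation is solved for continuous test functions, which keeps f'
  continuous; Borel sets are reached afterwards by inner regularity.\<close>

definition gauss_density :: "'a::euclidean_space \<Rightarrow> real" where
  "gauss_density x = (1 / sqrt (2 * pi)) ^ DIM('a) * exp (- (norm x)\<^sup>2 / 2)"

text \<open>Polymorphic in the euclidean space so that \<open>'a \<times> 'a\<close> is included: by
  \<open>std_gauss_prod\<close> a pair of independent copies is again a standard Gaussian point, and
  the results below apply to the doubled space as well.\<close>

definition std_gauss :: "'a::euclidean_space measure" where
  "std_gauss = density lborel (\<lambda>x. ennreal (gauss_density x))"

lemma gauss_density_eq_prod:
  "gauss_density (x::'a::euclidean_space) = (\<Prod>b\<in>Basis. std_normal_density (x \<bullet> b))"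
proof -
  have "(norm x)\<^sup>2 = (\<Sum>b\<in>Basis. (x \<bullet> b)\<^sup>2)"
    by (simp add: norm_eq_sqrt_inner euclidean_inner[of x x] power2_eq_square sum_nonneg)
  then have "exp (- (norm x)\<^sup>2 / 2) = (\<Prod>b\<in>Basis. exp (- (x \<bullet> b)\<^sup>2 / 2))"
    by (simp add: exp_sum[symmetric] sum_divide_distrib[symmetric] sum_negf)
  then show ?thesis
    by (simp add: gauss_density_def std_normal_density_def prod.distrib prod_dividef power_divide)
qed

lemma gauss_density_pos: "0 < gauss_density x"
  by (simp add: gauss_density_def)

lemma gauss_density_nonneg [simp]: "0 \<le> gauss_density x"
  using gauss_density_pos[of x] by simp

lemma continuous_gauss_density: "continuous_on UNIV gauss_density"
  unfolding gauss_density_def by (intro continuous_intros) auto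

lemma borel_measurable_gauss_density [measurable]: "gauss_density \<in> borel_measurable borel"
  using continuous_gauss_density by (rule borel_measurable_continuous_onI)

lemma gauss_density_Pair:
  "gauss_density (x::'a::euclidean_space, y::'b::euclidean_space) = gauss_density x * gauss_density y"
  by (simp add: gauss_density_def norm_prod_def power_add exp_add[symmetric] add_divide_distrib
      minus_add_distrib[symmetric] del: minus_add_distrib)

lemma space_std_gauss [simp]: "space std_gauss = UNIV"
  and sets_std_gauss [simp, measurable_cong]: "sets std_gauss = sets borel"
  by (simp_all add: std_gauss_def)

text \<open>Lebesgue measure is the product over \<open>Basis\<close> and the density factorizes
  with it. Total mass, coordinate marginals and rectangle probabilities are all read off from this
  formula.\<close>

lemma nn_integral_std_gauss_prod:
  fixes f :: "'a::euclidean_space \<Rightarrow> real \<Rightarrow> real"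
  assumes [measurable]: "\<And>b. b \<in> Basis \<Longrightarrow> f b \<in> borel_measurable borel"
    and nn: "\<And>b x. b \<in> Basis \<Longrightarrow> 0 \<le> f b x"
  shows "(\<integral>\<^sup>+x. ennreal (\<Prod>b\<in>Basis. f b (x \<bullet> b)) \<partial>std_gauss) =
    (\<Prod>b\<in>Basis. \<integral>\<^sup>+x. ennreal (f b x * std_normal_density x) \<partial>lborel)"
proof -
  have "(\<integral>\<^sup>+x. ennreal (\<Prod>b\<in>Basis. f b (x \<bullet> b)) \<partial>std_gauss) =
     (\<integral>\<^sup>+x. (\<Prod>b\<in>Basis. ennreal (f b (x \<bullet> b) * std_normal_density (x \<bullet> b))) \<partial>lborel)"
    unfolding std_gauss_def
    by (subst nn_integral_density)
       (auto simp: gauss_density_eq_prod prod.distrib[symmetric] nn prod_nonneg ennreal_mult[symmetric]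
          prod_ennreal mult.commute intro!: nn_integral_cong)
  also have "\<dots> = (\<Prod>b\<in>Basis. \<integral>\<^sup>+x. ennreal (f b x * std_normal_density x) \<partial>lborel)"
    using nn_integral_lborel_prod[of "\<lambda>b x. ennreal (f b x * std_normal_density x)"] by simp
  finally show ?thesis .
qed

lemma prob_space_std_gauss: "prob_space (std_gauss :: 'a::euclidean_space measure)"
proof
  have "(\<integral>\<^sup>+x. ennreal (std_normal_density x) \<partial>lborel) = 1"
    using prob_space.emeasure_space_1[OF prob_space_normal_density[of 1 0]]
    by (simp add: emeasure_density)
  then show "emeasure (std_gauss :: 'a measure) (space std_gauss) = 1"
    using nn_integral_std_gauss_prod[of "\<lambda>(_::'a) _. 1"] by simp
qed

interpretation std_gauss: prob_space "std_gauss :: 'a::euclidean_space measure"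
  by (rule prob_space_std_gauss)

lemma borel_measurable_fst_snd [measurable]:
  "fst \<in> borel_measurable (borel :: ('a::second_countable_topology \<times> 'b::second_countable_topology) measure)"
  "snd \<in> borel_measurable (borel :: ('a::second_countable_topology \<times> 'b::second_countable_topology) measure)"
  by (auto intro!: borel_measurable_continuous_onI continuous_intros)

lemma std_gauss_prod:
  "std_gauss \<Otimes>\<^sub>M std_gauss = (std_gauss :: ('a::euclidean_space \<times> 'b::euclidean_space) measure)"
  unfolding std_gauss_def
  by (subst pair_measure_density)
     (auto simp: lborel_prod gauss_density_Pair ennreal_mult split_beta' lborel.sigma_finite_measure_axioms
        std_gauss.sigma_finite_measure_axioms[unfolded std_gauss_def] intro!: density_cong)

section \<open>Rotation invariance on the doubled space\<close>

lemma nn_integral_lborel_translation: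
  fixes f :: "'a::euclidean_space \<Rightarrow> ennreal"
  assumes [measurable]: "f \<in> borel_measurable borel"
  shows "(\<integral>\<^sup>+x. f (c + x) \<partial>lborel) = (\<integral>\<^sup>+x. f x \<partial>lborel)"
  by (subst (2) lborel_distr_plus[of c, symmetric], subst nn_integral_distr) auto

lemma nn_integral_lborel_shear:
  fixes f :: "'a::euclidean_space \<times> 'a \<Rightarrow> ennreal"
  assumes [measurable]: "f \<in> borel_measurable borel"
  shows "(\<integral>\<^sup>+z. f (fst z + a *\<^sub>R snd z, snd z) \<partial>lborel) = (\<integral>\<^sup>+z. f z \<partial>lborel)"
    and "(\<integral>\<^sup>+z. f (fst z, snd z + a *\<^sub>R fst z) \<partial>lborel) = (\<integral>\<^sup>+z. f z \<partial>lborel)"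
proof -
  have [measurable]: "f \<in> borel_measurable (borel \<Otimes>\<^sub>M borel)"
    by (simp add: borel_prod)
  have snd: "(\<integral>\<^sup>+z. h z \<partial>lborel) = (\<integral>\<^sup>+y. \<integral>\<^sup>+x. h (x, y) \<partial>lborel \<partial>lborel)"
    and fst: "(\<integral>\<^sup>+z. h z \<partial>lborel) = (\<integral>\<^sup>+x. \<integral>\<^sup>+y. h (x, y) \<partial>lborel \<partial>lborel)"
    if [measurable]: "h \<in> borel_measurable (borel \<Otimes>\<^sub>M borel)" for h :: "'a \<times> 'a \<Rightarrow> ennreal"
    unfolding lborel_prod[symmetric]
    by (simp_all add: lborel_pair.nn_integral_snd lborel.nn_integral_fst)
  show "(\<integral>\<^sup>+z. f (fst z + a *\<^sub>R snd z, snd z) \<partial>lborel) = (\<integral>\<^sup>+z. f z \<partial>lborel)"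
    using nn_integral_lborel_translation[of "\<lambda>x. f (x, y)" "a *\<^sub>R y" for y]
    by (simp add: snd add.commute)
  show "(\<integral>\<^sup>+z. f (fst z, snd z + a *\<^sub>R fst z) \<partial>lborel) = (\<integral>\<^sup>+z. f z \<partial>lborel)"
    using nn_integral_lborel_translation[of "\<lambda>y. f (x, y)" "a *\<^sub>R x" for x]
    by (simp add: fst add.commute)
qed

text \<open>On a pair of independent copies, \<open>fst (rot t z)\<close> is the interpolated
  variable of the overview, and \<open>snd (rot t z)\<close> is its derivative in \<open>t\<close>,
  again standard Gaussian and independent of it.\<close>

definition rot :: "real \<Rightarrow> 'a::euclidean_space \<times> 'a \<Rightarrow> 'a \<times> 'a" where
  "rot t z = (cos t *\<^sub>R fst z + sin t *\<^sub>R snd z, cos t *\<^sub>R snd z - sin t *\<^sub>R fst z)"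

lemma continuous_rot: "continuous_on UNIV (rot t)"
  unfolding rot_def by (intro continuous_intros)

lemma measurable_rot [measurable]: "rot t \<in> borel_measurable borel"
  using continuous_rot by (rule borel_measurable_continuous_onI)

lemma norm_rot: "norm (rot t z) = norm (z :: 'a::euclidean_space \<times> 'a)"
proof -
  have c: "cos t * (cos t * w) = w - sin t * (sin t * w)" for w
    by (simp add: mult.assoc[symmetric] power2_eq_square[symmetric] cos_squared_eq left_diff_distrib)
  have "(norm (rot t z))\<^sup>2 = (norm z)\<^sup>2"
    unfolding power2_norm_eq_inner rot_def inner_prod_def
    by (simp add: inner_add inner_diff inner_commute algebra_simps c)
  then show ?thesis by simp
qed

text \<open>For \<^term>\<open>sin t \<noteq> 0\<close> the rotation is a product of three shears, which preserve Lebesgue measure by Fubini.\<close>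

lemma nn_integral_lborel_rot:
  fixes f :: "'a::euclidean_space \<times> 'a \<Rightarrow> ennreal"
  assumes [measurable]: "f \<in> borel_measurable borel" and "sin t \<noteq> 0"
  shows "(\<integral>\<^sup>+z. f (rot t z) \<partial>lborel) = (\<integral>\<^sup>+z. f z \<partial>lborel)"
proof -
  \<comment> \<open>\<open>a\<close> is tan(t/2): a rotation by \<open>t\<close> is the shear by
    tan(t/2), then the shear by - sin t in the other coordinate, then the first shear again.\<close>
  define a where "a = (1 - cos t) / sin t"
  define b where "b = - sin t"
  let ?S = "\<lambda>z::'a\<times>'a. (fst z + a *\<^sub>R snd z, snd z)"
  let ?T = "\<lambda>z::'a\<times>'a. (fst z, snd z + b *\<^sub>R fst z)"
  have m: "?S \<in> borel_measurable borel" "?T \<in> borel_measurable borel"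
    by (auto intro!: borel_measurable_continuous_onI continuous_intros)
  note [measurable] = measurable_compose[OF m(1)] measurable_compose[OF m(2)]
  have e1: "a * sin t = 1 - cos t" using assms by (simp add: a_def)
  have e2: "1 + a * b = cos t" using e1 by (simp add: b_def)
  have e3: "a + a * (1 + a * b) = sin t"
  proof -
    have "sin t * (a * (1 + cos t)) = (1 - cos t) * (1 + cos t)" using e1 by (simp add: mult.commute mult.left_commute)
    also have "\<dots> = sin t * sin t" using sin_cos_squared_add[of t] by (simp add: algebra_simps power2_eq_square)
    finally have "a * (1 + cos t) = sin t" using assms by simp
    then show ?thesis using e2 by (simp add: algebra_simps)
  qed
  have r: "rot t z = ?S (?T (?S z))" for z
  proof -
    have "fst z + a *\<^sub>R snd z + a *\<^sub>R (snd z + b *\<^sub>R (fst z + a *\<^sub>R snd z)) =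
      (1 + a * b) *\<^sub>R fst z + (a + a * (1 + a * b)) *\<^sub>R snd z"
      by (simp add: scaleR_add_left scaleR_add_right distrib_left mult.left_commute mult.commute)
        (metis mult_2_right scaleR_left_distrib)
    moreover have "snd z + b *\<^sub>R (fst z + a *\<^sub>R snd z) = (1 + a * b) *\<^sub>R snd z + b *\<^sub>R fst z"
      by (simp add: scaleR_add_left scaleR_add_right mult.commute)
    ultimately show ?thesis
      unfolding e2 using e3[unfolded e2] by (simp add: rot_def b_def)
  qed
  have "(\<integral>\<^sup>+z. f (rot t z) \<partial>lborel) = (\<integral>\<^sup>+z. f (?S (?T (?S z))) \<partial>lborel)" by (simp only: r)
  also have "\<dots> = (\<integral>\<^sup>+z. f (?S (?T z)) \<partial>lborel)"
    by (rule nn_integral_lborel_shear(1)[of "\<lambda>z. f (?S (?T z))" a]) measurable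
  also have "\<dots> = (\<integral>\<^sup>+z. f (?S z) \<partial>lborel)"
    by (rule nn_integral_lborel_shear(2)[of "\<lambda>z. f (?S z)" b]) measurable
  also have "\<dots> = (\<integral>\<^sup>+z. f z \<partial>lborel)"
    by (rule nn_integral_lborel_shear(1)) measurable
  finally show ?thesis .
qed

text \<open>The density depends on the norm alone, which \<open>rot\<close> preserves, and Lebesgue
  measure is invariant. The condition on \<open>sin t\<close> comes from dividing by it in the shear
  factorization.\<close>

lemma distr_std_gauss_rot:
  assumes "sin t \<noteq> 0"
  shows "distr std_gauss borel (rot t) = (std_gauss :: ('a::euclidean_space \<times> 'a) measure)"
proof (rule measure_eqI)
  fix A :: "('a \<times> 'a) set" assume "A \<in> sets (distr std_gauss borel (rot t))"
  then have [measurable]: "A \<in> sets borel" by simp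
  have g: "gauss_density (rot t z) = gauss_density z" for z :: "'a \<times> 'a"
    by (simp add: gauss_density_def norm_rot)
  have "emeasure (distr std_gauss borel (rot t)) A = (\<integral>\<^sup>+z. indicator A (rot t z) \<partial>std_gauss)"
    by (simp flip: nn_integral_indicator add: nn_integral_distr)
  also have "\<dots> = (\<integral>\<^sup>+z. (\<lambda>z. ennreal (gauss_density z) * indicator A z) (rot t z) \<partial>lborel)"
    by (simp add: std_gauss_def nn_integral_density g)
  also have "\<dots> = (\<integral>\<^sup>+z. ennreal (gauss_density z) * indicator A z \<partial>lborel)"
    using assms by (subst nn_integral_lborel_rot) auto
  also have "\<dots> = emeasure std_gauss A"
    by (simp add: std_gauss_def emeasure_density)
  finally show "emeasure (distr std_gauss borel (rot t)) A = emeasure std_gauss A" .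
qed simp

lemma distr_std_gauss_swap:
  "distr std_gauss borel (\<lambda>z. (snd z, fst z)) = (std_gauss :: ('a::euclidean_space \<times> 'a) measure)"
proof -
  interpret pair_sigma_finite "std_gauss :: 'a measure" "std_gauss :: 'a measure" ..
  have "std_gauss = distr (std_gauss :: ('a \<times> 'a) measure) std_gauss (\<lambda>(x, y). (y, x))"
    using distr_pair_swap by (simp only: std_gauss_prod)
  also have "\<dots> = distr std_gauss borel (\<lambda>z. (snd z, fst z))"
    by (rule distr_cong) (auto simp: split_beta')
  finally show ?thesis ..
qed

lemma distr_std_gauss_fst: "distr std_gauss borel fst = (std_gauss :: 'a::euclidean_space measure)"
  (is "distr (_ :: ('a \<times> 'b::euclidean_space) measure) _ _ = _")
proof (rule measure_eqI)
  fix A :: "'a set" assume "A \<in> sets (distr (std_gauss :: ('a \<times> 'b) measure) borel fst)"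
  then have [measurable]: "A \<in> sets borel" by simp
  have m: "fst \<in> borel_measurable (std_gauss :: ('a \<times> 'b) measure)"
    by measurable
  have "fst -` A = A \<times> (UNIV :: 'b set)" by auto
  then have "emeasure (distr (std_gauss :: ('a \<times> 'b) measure) borel fst) A = emeasure (std_gauss \<Otimes>\<^sub>M std_gauss) (A \<times> (UNIV::'b set))"
    using m by (simp add: emeasure_distr std_gauss_prod)
  also have "\<dots> = emeasure std_gauss A"
    using std_gauss.emeasure_space_1[where 'a='b] by (subst std_gauss.emeasure_pair_measure_Times) simp_all
  finally show "emeasure (distr (std_gauss :: ('a \<times> 'b) measure) borel fst) A = emeasure std_gauss A" .
qed simp

section \<open>Gaussian integration by parts\<close>

lemma Cauchy_Schwarz_integral:
  fixes u v :: "'b \<Rightarrow> real"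
  assumes [measurable]: "u \<in> borel_measurable M" "v \<in> borel_measurable M"
    and iu: "integrable M (\<lambda>x. (u x)\<^sup>2)" and iv: "integrable M (\<lambda>x. (v x)\<^sup>2)"
  shows "integrable M (\<lambda>x. u x * v x)"
    and "\<bar>\<integral>x. u x * v x \<partial>M\<bar> \<le> sqrt (\<integral>x. (u x)\<^sup>2 \<partial>M) * sqrt (\<integral>x. (v x)\<^sup>2 \<partial>M)"
proof -
  have am: "\<bar>a * b\<bar> \<le> a\<^sup>2 + b\<^sup>2" for a b :: real
  proof -
    have "0 \<le> \<bar>a\<bar> * \<bar>b\<bar>" by simp
    with sum_squares_bound[of "\<bar>a\<bar>" "\<bar>b\<bar>"] show ?thesis
      by (simp only: abs_mult power2_abs mult.assoc)
  qed
  show i: "integrable M (\<lambda>x. u x * v x)"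
    by (rule Bochner_Integration.integrable_bound[OF Bochner_Integration.integrable_add[OF iu iv]])
       (use am in \<open>auto intro!: AE_I2\<close>)
  have "(\<integral>\<^sup>+x. ennreal \<bar>u x\<bar> * ennreal \<bar>v x\<bar> \<partial>M) = ennreal (\<integral>x. \<bar>u x * v x\<bar> \<partial>M)"
    using nn_integral_eq_integral[OF integrable_abs[OF i]] by (simp add: abs_mult ennreal_mult)
  then have "ennreal ((\<integral>x. \<bar>u x * v x\<bar> \<partial>M)\<^sup>2) = (\<integral>\<^sup>+x. ennreal \<bar>u x\<bar> * ennreal \<bar>v x\<bar> \<partial>M)\<^sup>2"
    by (simp add: ennreal_power)
  also have "\<dots> \<le> (\<integral>\<^sup>+x. (ennreal \<bar>u x\<bar>)\<^sup>2 \<partial>M) * (\<integral>\<^sup>+x. (ennreal \<bar>v x\<bar>)\<^sup>2 \<partial>M)"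
    by (rule Cauchy_Schwarz_nn_integral) auto
  also have "\<dots> = ennreal ((\<integral>x. (u x)\<^sup>2 \<partial>M) * (\<integral>x. (v x)\<^sup>2 \<partial>M))"
    using iu iv by (simp add: ennreal_power nn_integral_eq_integral ennreal_mult)
  finally have "(\<integral>x. \<bar>u x * v x\<bar> \<partial>M)\<^sup>2 \<le> (\<integral>x. (u x)\<^sup>2 \<partial>M) * (\<integral>x. (v x)\<^sup>2 \<partial>M)"
    by (subst (asm) ennreal_le_iff) auto
  then have "(\<integral>x. \<bar>u x * v x\<bar> \<partial>M) \<le> sqrt ((\<integral>x. (u x)\<^sup>2 \<partial>M) * (\<integral>x. (v x)\<^sup>2 \<partial>M))"
    by (rule real_le_rsqrt)
  moreover have "\<bar>\<integral>x. u x * v x \<partial>M\<bar> \<le> (\<integral>x. \<bar>u x * v x\<bar> \<partial>M)"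
    by (rule integral_abs_bound)
  ultimately show "\<bar>\<integral>x. u x * v x \<partial>M\<bar> \<le> sqrt (\<integral>x. (u x)\<^sup>2 \<partial>M) * sqrt (\<integral>x. (v x)\<^sup>2 \<partial>M)"
    unfolding real_sqrt_mult by (rule order_trans[rotated])
qed

lemma Cauchy_Schwarz_integral_inner:
  fixes u v :: "'b \<Rightarrow> 'a::euclidean_space"
  assumes [measurable]: "u \<in> borel_measurable M" "v \<in> borel_measurable M"
    and iu: "integrable M (\<lambda>x. (norm (u x))\<^sup>2)" and iv: "integrable M (\<lambda>x. (norm (v x))\<^sup>2)"
  shows "integrable M (\<lambda>x. u x \<bullet> v x)"
    and "\<bar>\<integral>x. u x \<bullet> v x \<partial>M\<bar> \<le> sqrt (\<integral>x. (norm (u x))\<^sup>2 \<partial>M) * sqrt (\<integral>x. (norm (v x))\<^sup>2 \<partial>M)"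
proof -
  note CS = Cauchy_Schwarz_integral[of "\<lambda>x. norm (u x)" M "\<lambda>x. norm (v x)"]
  show i: "integrable M (\<lambda>x. u x \<bullet> v x)"
    by (rule Bochner_Integration.integrable_bound[OF CS(1)])
       (use iu iv in \<open>auto intro!: AE_I2 simp: Cauchy_Schwarz_ineq2\<close>)
  have "\<bar>\<integral>x. u x \<bullet> v x \<partial>M\<bar> \<le> (\<integral>x. \<bar>u x \<bullet> v x\<bar> \<partial>M)"
    by (rule integral_abs_bound)
  also have "\<dots> \<le> (\<integral>x. norm (u x) * norm (v x) \<partial>M)"
    using i iu iv CS(1) by (intro integral_mono) (auto simp: Cauchy_Schwarz_ineq2)
  also have "\<dots> \<le> sqrt (\<integral>x. (norm (u x))\<^sup>2 \<partial>M) * sqrt (\<integral>x. (norm (v x))\<^sup>2 \<partial>M)"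
    using CS(2) iu iv by auto
  finally show "\<bar>\<integral>x. u x \<bullet> v x \<partial>M\<bar> \<le> sqrt (\<integral>x. (norm (u x))\<^sup>2 \<partial>M) * sqrt (\<integral>x. (norm (v x))\<^sup>2 \<partial>M)" .
qed

text \<open>Differentiation under the integral sign: the mean value inequality dominates all
  difference quotients by \<open>w\<close>, so dominated convergence applies along every sequence
  tending to \<open>t\<close>.\<close>

lemma has_real_derivative_integral:
  fixes f f' :: "real \<Rightarrow> 'b \<Rightarrow> real"
  assumes deriv: "\<And>t z. ((\<lambda>t. f t z) has_real_derivative f' t z) (at t)"
    and int: "\<And>t. integrable M (f t)"
    and [measurable]: "\<And>t. f' t \<in> borel_measurable M"
    and bound: "\<And>t z. \<bar>f' t z\<bar> \<le> w z" and w: "integrable M w"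
  shows "((\<lambda>t. \<integral>z. f t z \<partial>M) has_real_derivative (\<integral>z. f' t z \<partial>M)) (at t)"
  unfolding has_field_derivative_iff tendsto_at_iff_sequentially
proof (intro allI impI)
  fix X :: "nat \<Rightarrow> real" assume X: "\<forall>i. X i \<in> UNIV - {t}" "X \<longlonglongrightarrow> t"
  have [measurable]: "f t \<in> borel_measurable M" for t
    using int by (rule borel_measurable_integrable)
  have Lip: "\<bar>(f (X k) z - f t z) / (X k - t)\<bar> \<le> w z" for k z
  proof -
    have "norm (f (X k) z - f t z) \<le> w z * norm (X k - t)"
    proof (rule field_differentiable_bound[where S=UNIV])
      show "((\<lambda>t. f t z) has_field_derivative f' x z) (at x within UNIV)" for x
        using deriv[of z x] by simp
      show "norm (f' x z) \<le> w z" for x using bound[of x z] by simp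
    qed auto
    then show ?thesis using X(1) by (simp add: divide_le_eq abs_divide)
  qed
  have "(\<lambda>k. \<integral>z. (f (X k) z - f t z) / (X k - t) \<partial>M) \<longlonglongrightarrow> (\<integral>z. f' t z \<partial>M)"
  proof (rule integral_dominated_convergence)
    show "AE z in M. (\<lambda>k. (f (X k) z - f t z) / (X k - t)) \<longlonglongrightarrow> f' t z"
    proof (rule AE_I2)
      fix z
      show "(\<lambda>k. (f (X k) z - f t z) / (X k - t)) \<longlonglongrightarrow> f' t z"
        using deriv[of z t] X unfolding has_field_derivative_iff tendsto_at_iff_sequentially comp_def by blast
    qed
    show "AE z in M. norm ((f (X k) z - f t z) / (X k - t)) \<le> w z" for k
      using Lip by (auto intro!: AE_I2)
  qed (use w in auto)
  moreover have "(\<integral>z. (f (X k) z - f t z) / (X k - t) \<partial>M) = ((\<integral>z. f (X k) z \<partial>M) - (\<integral>z. f t z \<partial>M)) / (X k - t)" for k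
    by (simp only: integral_divide_zero Bochner_Integration.integral_diff[OF int int])
  ultimately show "((\<lambda>y. ((\<integral>z. f y z \<partial>M) - (\<integral>z. f t z \<partial>M)) / (y - t)) \<circ> X) \<longlonglongrightarrow> (\<integral>z. f' t z \<partial>M)"
    by (simp only: comp_def)
qed

lemma continuous_compact_support_bounded:
  fixes f :: "'a::euclidean_space \<Rightarrow> 'b::real_normed_vector"
  assumes "continuous_on UNIV f" and "\<And>x. R < norm x \<Longrightarrow> f x = 0"
  obtains B where "0 \<le> B" "\<And>x. norm (f x) \<le> B"
proof -
  have "compact (f ` cball 0 R)"
    using assms(1) by (intro compact_continuous_image) (auto intro: continuous_on_subset)
  then obtain B where B: "\<And>x. x \<in> cball 0 R \<Longrightarrow> norm (f x) \<le> B"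
    using compact_imp_bounded bounded_iff by (metis imageI)
  have "norm (f x) \<le> max B 0" for x
    using B[of x] assms(2)[of x] by (cases "R < norm x") auto
  then show ?thesis using that[of "max B 0"] by auto
qed

lemma integrable_continuous_compact_support:
  fixes f :: "'a::euclidean_space \<Rightarrow> real"
  assumes "continuous_on UNIV f" and "\<And>x. R < norm x \<Longrightarrow> f x = 0"
  shows "integrable lborel f"
proof -
  have "integrable lborel (\<lambda>x. indicator (cball 0 R) x *\<^sub>R f x)"
    using assms by (intro borel_integrable_compact) (auto intro: continuous_on_subset)
  moreover have "(\<lambda>x. indicator (cball 0 R) x *\<^sub>R f x) = f"
    using assms(2) by (auto simp: indicator_def fun_eq_iff not_le)
  ultimately show ?thesis by simp
qed

text \<open>By translation invariance every difference quotient of \<open>q\<close> in direction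
  \<open>v\<close> integrates to 0; dominated convergence passes this on to the derivative.\<close>

lemma integral_directional_derivative_eq_0:
  fixes q :: "'a::euclidean_space \<Rightarrow> real"
  assumes d: "\<And>x. (q has_derivative (\<lambda>v. Dq x \<bullet> v)) (at x)"
    and c: "continuous_on UNIV Dq"
    and z: "\<And>x. R < norm x \<Longrightarrow> q x = 0" "\<And>x. R < norm x \<Longrightarrow> Dq x = 0"
  shows "(\<integral>x. Dq x \<bullet> v \<partial>lborel) = 0"
proof -
  have cq: "continuous_on UNIV q"
    using d by (meson continuous_at_imp_continuous_on has_derivative_continuous)
  have [measurable]: "q \<in> borel_measurable borel" "Dq \<in> borel_measurable borel"
    using cq c by (auto intro: borel_measurable_continuous_onI)
  obtain B where B: "0 \<le> B" "\<And>x. norm (Dq x) \<le> B"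
    using continuous_compact_support_bounded[OF c z(2)] by blast
  have iq: "integrable lborel q" 
    by (rule integrable_continuous_compact_support[OF cq z(1)])
  have iq': "integrable lborel (\<lambda>x. q (w + x))" "(\<integral>x. q (w + x) \<partial>lborel) = (\<integral>x. q x \<partial>lborel)" for w
    using iq integrable_distr_eq[of "(+) w" lborel borel q] integral_distr[of "(+) w" lborel borel q]
    by (simp_all add: lborel_distr_plus)
  have zero: "(\<integral>x. (q (t *\<^sub>R v + x) - q x) / t \<partial>lborel) = 0" for t
    using iq iq' by simp
  define \<tau> where "\<tau> k = inverse (real (Suc k))" for k
  have \<tau>: "0 < \<tau> k" "\<tau> k \<le> 1" for k by (auto simp: \<tau>_def field_simps)
  have lim: "(\<lambda>k. \<integral>x. (q (\<tau> k *\<^sub>R v + x) - q x) / \<tau> k \<partial>lborel) \<longlonglongrightarrow> (\<integral>x. Dq x \<bullet> v \<partial>lborel)"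
  proof (rule integral_dominated_convergence)
    \<comment> \<open>For step sizes at most 1 the difference quotients vanish outside the ball of
      radius \<open>R + norm v\<close>; inside it they are bounded by
      \<open>B * norm v\<close>.\<close>
    show "integrable lborel (\<lambda>x. indicator (cball (0::'a) (R + norm v)) x * (B * norm v))"
      using emeasure_lborel_cball_finite[of "0::'a" "R + norm v"] by (intro integrable_mult_left integrable_real_indicator) auto
    have line: "((\<lambda>t. q (t *\<^sub>R v + x)) has_real_derivative Dq (t *\<^sub>R v + x) \<bullet> v) (at t)" for x t
      unfolding has_field_derivative_def
      by (rule has_derivative_eq_rhs, rule has_derivative_compose[OF _ d, where f="\<lambda>t. t *\<^sub>R v + x"])
         (auto intro!: derivative_eq_intros simp: mult.commute)
    have "((\<lambda>k. \<tau> k) \<longlonglongrightarrow> 0)"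
      unfolding \<tau>_def by (rule LIMSEQ_inverse_real_of_nat)
    moreover have "\<forall>k. \<tau> k \<in> UNIV - {0}"
      using \<tau>(1) by (simp add: less_imp_neq[symmetric])
    ultimately have "((\<lambda>t. (q (t *\<^sub>R v + x) - q (0 *\<^sub>R v + x)) / (t - 0)) \<circ> \<tau>) \<longlonglongrightarrow> Dq (0 *\<^sub>R v + x) \<bullet> v" for x
      using line[where t=0, unfolded has_field_derivative_iff tendsto_at_iff_sequentially] by blast
    then have "(\<lambda>k. (q (\<tau> k *\<^sub>R v + x) - q x) / \<tau> k) \<longlonglongrightarrow> Dq x \<bullet> v" for x
      by (simp add: comp_def)
    then show "AE x in lborel. (\<lambda>k. (q (\<tau> k *\<^sub>R v + x) - q x) / \<tau> k) \<longlonglongrightarrow> Dq x \<bullet> v"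
      by simp
    have "norm ((q (\<tau> k *\<^sub>R v + x) - q x) / \<tau> k) \<le> indicator (cball 0 (R + norm v)) x * (B * norm v)" for k x
    proof (cases "norm x \<le> R + norm v")
      case True
      have "norm (q (\<tau> k *\<^sub>R v + x) - q (0 *\<^sub>R v + x)) \<le> (B * norm v) * norm (\<tau> k - 0)"
      proof (rule field_differentiable_bound[where S=UNIV])
        show "((\<lambda>t. q (t *\<^sub>R v + x)) has_field_derivative Dq (t *\<^sub>R v + x) \<bullet> v) (at t within UNIV)" for t
          using line[of x t] by simp
        show "norm (Dq (t *\<^sub>R v + x) \<bullet> v) \<le> B * norm v" for t
          using Cauchy_Schwarz_ineq2[of "Dq (t *\<^sub>R v + x)" v] mult_right_mono[OF B(2)[of "t *\<^sub>R v + x"] norm_ge_zero[of v]] by simp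
      qed auto
      then show ?thesis using True \<tau>[of k] by (simp add: abs_divide divide_le_eq)
    next
      case False
      have "norm (\<tau> k *\<^sub>R v) \<le> norm v" using \<tau>[of k] by (simp add: mult_left_le_one_le)
      then have "R < norm (\<tau> k *\<^sub>R v + x)" using False norm_diff_ineq[of x "\<tau> k *\<^sub>R v"] by (simp add: add.commute)
      moreover have "R < norm x" using False norm_ge_zero[of v] by linarith
      ultimately show ?thesis using z False by simp
    qed
    then show "AE x in lborel. norm ((q (\<tau> k *\<^sub>R v + x) - q x) / \<tau> k) \<le> indicator (cball 0 (R + norm v)) x * (B * norm v)" for k
      by simp
  qed auto
  show ?thesis
    using LIMSEQ_unique[OF lim[unfolded zero] tendsto_const] by simp
qed

lemma integral_std_gauss:
  fixes f :: "'a::euclidean_space \<Rightarrow> real"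
  assumes "f \<in> borel_measurable borel"
  shows "(\<integral>x. f x \<partial>std_gauss) = (\<integral>x. gauss_density x * f x \<partial>lborel)"
    and "integrable std_gauss f \<longleftrightarrow> integrable lborel (\<lambda>x. gauss_density x * f x)"
  using assms by (simp_all add: std_gauss_def integral_density integrable_density)

lemma has_derivative_gauss_density:
  "(gauss_density has_derivative (\<lambda>v. - (gauss_density x * (x \<bullet> v)))) (at x)"
  unfolding gauss_density_def power2_norm_eq_inner
  by (auto intro!: derivative_eq_intros simp: inner_commute)

text \<open>The preceding vanishing integral is applied to the product of \<open>\<psi>\<close> with
  the density; differentiating the density yields the factor - x, which becomes the left-hand
  side.\<close>

lemma std_gauss_integration_by_parts:
  fixes \<psi> :: "'a::euclidean_space \<Rightarrow> real"
  assumes d: "\<And>x. (\<psi> has_derivative (\<lambda>v. D\<psi> x \<bullet> v)) (at x)"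
    and c: "continuous_on UNIV D\<psi>"
    and z: "\<And>x. R < norm x \<Longrightarrow> \<psi> x = 0" "\<And>x. R < norm x \<Longrightarrow> D\<psi> x = 0"
  shows "(\<integral>x. \<psi> x * (v \<bullet> x) \<partial>std_gauss) = (\<integral>x. D\<psi> x \<bullet> v \<partial>std_gauss)"
proof -
  have c\<psi>: "continuous_on UNIV \<psi>"
    using d by (meson continuous_at_imp_continuous_on has_derivative_continuous)
  have [measurable]: "\<psi> \<in> borel_measurable borel" "D\<psi> \<in> borel_measurable borel"
    using c\<psi> c by (auto intro: borel_measurable_continuous_onI)
  have "(\<integral>x. (gauss_density x *\<^sub>R D\<psi> x - (gauss_density x * \<psi> x) *\<^sub>R x) \<bullet> v \<partial>lborel) = 0"
  proof (rule integral_directional_derivative_eq_0)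
    show "((\<lambda>x. gauss_density x * \<psi> x) has_derivative (\<lambda>v. (gauss_density x *\<^sub>R D\<psi> x - (gauss_density x * \<psi> x) *\<^sub>R x) \<bullet> v)) (at x)" for x
      by (rule has_derivative_eq_rhs[OF has_derivative_mult[OF has_derivative_gauss_density d]])
         (auto simp: inner_diff_left algebra_simps)
    show "continuous_on UNIV (\<lambda>x. gauss_density x *\<^sub>R D\<psi> x - (gauss_density x * \<psi> x) *\<^sub>R x)"
      by (intro continuous_intros c c\<psi> continuous_gauss_density)
  qed (use z in auto)
  moreover have "integrable lborel (\<lambda>x. gauss_density x * (D\<psi> x \<bullet> v))"
    by (rule integrable_continuous_compact_support[of _ R]) (auto intro!: continuous_intros c continuous_gauss_density simp: z)
  moreover have "integrable lborel (\<lambda>x. gauss_density x * (\<psi> x * (v \<bullet> x)))"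
    by (rule integrable_continuous_compact_support[of _ R]) (auto intro!: continuous_intros c\<psi> continuous_gauss_density simp: z)
  ultimately show ?thesis
    by (simp add: integral_std_gauss inner_diff_left inner_diff_right inner_commute mult.assoc)
qed

lemma distr_std_gauss_inner_Basis:
  assumes b: "b \<in> (Basis :: 'a::euclidean_space set)"
  shows "distr std_gauss borel (\<lambda>x::'a. x \<bullet> b) = density lborel std_normal_density"
proof (rule measure_eqI)
  fix A assume "A \<in> sets (distr std_gauss borel (\<lambda>x::'a. x \<bullet> b))"
  then have [measurable]: "A \<in> sets borel" by simp
  have one: "(\<integral>\<^sup>+x. ennreal (std_normal_density x) \<partial>lborel) = 1"
    using prob_space.emeasure_space_1[OF prob_space_normal_density[of 1 0]]
    by (simp add: emeasure_density)
  have "emeasure (distr std_gauss borel (\<lambda>x::'a. x \<bullet> b)) A = (\<integral>\<^sup>+x. indicator A (x \<bullet> b) \<partial>(std_gauss :: 'a measure))"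
    by (simp flip: nn_integral_indicator add: nn_integral_distr)
  also have "\<dots> = (\<integral>\<^sup>+x. ennreal (\<Prod>b'\<in>Basis. if b' = b then indicator A (x \<bullet> b') else 1) \<partial>(std_gauss :: 'a measure))"
    using b by (intro nn_integral_cong) (auto simp: prod.delta split: split_indicator)
  also have "\<dots> = (\<Prod>b'\<in>Basis. \<integral>\<^sup>+x. ennreal ((if b' = b then indicator A x else 1) * std_normal_density x) \<partial>lborel)"
    by (subst nn_integral_std_gauss_prod[of "\<lambda>b' x. if b' = b then indicator A x else 1"]) auto
  also have "\<dots> = (\<Prod>b'\<in>Basis. if b' = b then \<integral>\<^sup>+x. ennreal (indicator A x * std_normal_density x) \<partial>lborel else 1)"
    by (intro prod.cong) (auto simp: one)
  also have "\<dots> = emeasure (density lborel std_normal_density) A"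
    using b by (simp add: prod.delta emeasure_density ennreal_mult mult.commute ennreal_indicator)
  finally show "emeasure (distr std_gauss borel (\<lambda>x::'a. x \<bullet> b)) A = emeasure (density lborel std_normal_density) A" .
qed simp

lemma integrable_norm_std_gauss: "integrable (std_gauss :: 'a::euclidean_space measure) norm"
proof (rule Bochner_Integration.integrable_bound)
  have "integrable (std_gauss :: 'a measure) (\<lambda>x. \<bar>x \<bullet> b\<bar>)" if "b \<in> Basis" for b :: 'a
  proof -
    have "integrable (density lborel std_normal_density) (\<lambda>x::real. \<bar>x\<bar>)"
      using integrable_std_normal_moment_abs[of 1] by (simp add: integrable_density)
    then show ?thesis
      by (simp flip: distr_std_gauss_inner_Basis[OF that] add: integrable_distr_eq)
  qed
  then show "integrable (std_gauss :: 'a measure) (\<lambda>x. \<Sum>b\<in>Basis. \<bar>x \<bullet> b\<bar>)" by auto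
  show "AE x in (std_gauss :: 'a measure). norm (norm x) \<le> norm (\<Sum>b\<in>Basis. \<bar>x \<bullet> b\<bar>)"
    by (auto intro!: AE_I2 simp: sum_nonneg norm_le_l1)
qed simp

section \<open>Interpolation between correlated copies\<close>

lemma std_gauss_proj:
  fixes f :: "'a::euclidean_space \<Rightarrow> real"
  assumes [measurable]: "f \<in> borel_measurable borel"
  shows "(\<integral>z. f (fst z) \<partial>(std_gauss :: ('a \<times> 'b::euclidean_space) measure)) = (\<integral>x. f x \<partial>std_gauss)"
    and "integrable (std_gauss :: ('a \<times> 'b::euclidean_space) measure) (\<lambda>z. f (fst z)) \<longleftrightarrow> integrable std_gauss f"
proof -
  have [measurable]: "fst \<in> measurable (std_gauss :: ('a \<times> 'b) measure) borel" by measurable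
  show "(\<integral>z. f (fst z) \<partial>(std_gauss :: ('a \<times> 'b) measure)) = (\<integral>x. f x \<partial>std_gauss)"
    by (subst distr_std_gauss_fst[where 'b='b, symmetric]) (simp add: integral_distr)
  show "integrable (std_gauss :: ('a \<times> 'b) measure) (\<lambda>z. f (fst z)) \<longleftrightarrow> integrable std_gauss f"
    by (subst (2) distr_std_gauss_fst[where 'b='b, symmetric]) (simp add: integrable_distr_eq)
qed

lemma std_gauss_Fubini:
  fixes f :: "'a::euclidean_space \<times> 'b::euclidean_space \<Rightarrow> real"
  assumes "integrable std_gauss f"
  shows "(\<integral>z. f z \<partial>std_gauss) = (\<integral>x. \<integral>y. f (x, y) \<partial>std_gauss \<partial>std_gauss)"
proof -
  interpret pair_sigma_finite "std_gauss :: 'a measure" "std_gauss :: 'b measure" ..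
  show ?thesis
    using integral_fst'[of f] assms by (simp add: std_gauss_prod)
qed

lemma std_gauss_rot:
  fixes f :: "'a::euclidean_space \<times> 'a \<Rightarrow> real"
  assumes [measurable]: "f \<in> borel_measurable borel" and "sin t \<noteq> 0"
  shows "(\<integral>z. f (rot t z) \<partial>std_gauss) = (\<integral>z. f z \<partial>std_gauss)"
    and "integrable std_gauss (\<lambda>z. f (rot t z)) \<longleftrightarrow> integrable std_gauss f"
proof -
  have [measurable]: "rot t \<in> measurable std_gauss (borel :: ('a \<times> 'a) measure)" by measurable
  show "(\<integral>z. f (rot t z) \<partial>std_gauss) = (\<integral>z. f z \<partial>std_gauss)"
    by (subst (2) distr_std_gauss_rot[OF assms(2), symmetric]) (simp add: integral_distr)
  show "integrable std_gauss (\<lambda>z. f (rot t z)) \<longleftrightarrow> integrable std_gauss f"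
    by (subst (2) distr_std_gauss_rot[OF assms(2), symmetric]) (simp add: integrable_distr_eq)
qed

lemma integrable_bounded_std_gauss:
  fixes f :: "'a::euclidean_space \<Rightarrow> real"
  assumes [measurable]: "f \<in> borel_measurable borel" and "\<And>x. \<bar>f x\<bar> \<le> B"
  shows "integrable std_gauss f"
  using assms(2) by (intro std_gauss.integrable_const_bound[of _ B]) auto

text \<open>The first formula is differentiation under the integral. For the second, the rotated
  pair is taken as the new standard Gaussian pair (x, y); the original variable becomes cos t x -
  sin t y, the factor \<open>DG x \<bullet> y\<close> is linear in y, and Gaussian integration by
  parts in y removes it, producing - sin t from the inner derivative of \<open>F\<close>.\<close>

lemma std_gauss_interpolation_derivative:
  fixes F G :: "'a::euclidean_space \<Rightarrow> real"
  assumes dF: "\<And>x. (F has_derivative (\<lambda>v. DF x \<bullet> v)) (at x)" and cF: "continuous_on UNIV DF"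
    and dG: "\<And>x. (G has_derivative (\<lambda>v. DG x \<bullet> v)) (at x)" and cG: "continuous_on UNIV DG"
    and zF: "\<And>x. R < norm x \<Longrightarrow> F x = 0" "\<And>x. R < norm x \<Longrightarrow> DF x = 0"
    and zG: "\<And>x. R < norm x \<Longrightarrow> G x = 0" "\<And>x. R < norm x \<Longrightarrow> DG x = 0"
  defines "\<phi> t \<equiv> \<integral>z. F (fst z) * G (fst (rot t z)) \<partial>std_gauss"
  shows "(\<phi> has_real_derivative (\<integral>z. F (fst z) * (DG (fst (rot t z)) \<bullet> snd (rot t z)) \<partial>std_gauss)) (at t)"
    and "sin t \<noteq> 0 \<Longrightarrow> (\<phi> has_real_derivative (- sin t * (\<integral>z. DF (fst z) \<bullet> DG (fst (rot t z)) \<partial>std_gauss))) (at t)"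
proof -
  have cF0: "continuous_on UNIV F" and cG0: "continuous_on UNIV G"
    using dF dG by (meson continuous_at_imp_continuous_on has_derivative_continuous)+
  have [measurable]: "F \<in> borel_measurable borel" "DF \<in> borel_measurable borel"
    "G \<in> borel_measurable borel" "DG \<in> borel_measurable borel"
    using cF0 cG0 cF cG by (auto intro: borel_measurable_continuous_onI)
  obtain BF where BF: "0 \<le> BF" "\<And>x. norm (F x) \<le> BF"
    using continuous_compact_support_bounded[OF cF0 zF(1)] by blast
  obtain BG where BG: "0 \<le> BG" "\<And>x. norm (G x) \<le> BG"
    using continuous_compact_support_bounded[OF cG0 zG(1)] by blast
  obtain BDG where BDG: "0 \<le> BDG" "\<And>x. norm (DG x) \<le> BDG"
    using continuous_compact_support_bounded[OF cG zG(2)] by blast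
  show der: "(\<phi> has_real_derivative (\<integral>z. F (fst z) * (DG (fst (rot t z)) \<bullet> snd (rot t z)) \<partial>std_gauss)) (at t)" for t
    unfolding \<phi>_def
  proof (rule has_real_derivative_integral)
    show "((\<lambda>t. F (fst z) * G (fst (rot t z))) has_real_derivative F (fst z) * (DG (fst (rot t z)) \<bullet> snd (rot t z))) (at t)" for t z
    proof -
      have "((\<lambda>t. G (fst (rot t z))) has_derivative (\<lambda>h. DG (fst (rot t z)) \<bullet> (h *\<^sub>R snd (rot t z)))) (at t)"
        by (rule has_derivative_compose[OF _ dG, where f="\<lambda>t. fst (rot t z)"])
           (auto simp: rot_def algebra_simps intro!: derivative_eq_intros)
      then have "((\<lambda>t. G (fst (rot t z))) has_real_derivative (DG (fst (rot t z)) \<bullet> snd (rot t z))) (at t)"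
        unfolding has_field_derivative_def by (rule has_derivative_eq_rhs) (auto simp: mult.commute)
      then show ?thesis by (auto intro!: derivative_eq_intros)
    qed
    show "integrable std_gauss (\<lambda>z. F (fst z) * G (fst (rot t z)))" for t
      using BF BG by (intro integrable_bounded_std_gauss[of _ "BF * BG"]) (auto simp: abs_mult intro!: mult_mono)
    show "\<bar>F (fst z) * (DG (fst (rot t z)) \<bullet> snd (rot t z))\<bar> \<le> BF * (BDG * norm z)" for t z
    proof -
      have "\<bar>DG (fst (rot t z)) \<bullet> snd (rot t z)\<bar> \<le> norm (DG (fst (rot t z))) * norm (snd (rot t z))"
        by (rule Cauchy_Schwarz_ineq2)
      also have "\<dots> \<le> BDG * norm (rot t z)"
        using BDG norm_snd_le[of "snd (rot t z)" "fst (rot t z)"] by (intro mult_mono) auto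
      finally have "\<bar>DG (fst (rot t z)) \<bullet> snd (rot t z)\<bar> \<le> BDG * norm z" by (simp only: norm_rot)
      then show ?thesis unfolding abs_mult by (rule mult_mono[rotated]) (use BF in auto)
    qed
    show "integrable std_gauss (\<lambda>z::'a\<times>'a. BF * (BDG * norm z))"
      using integrable_norm_std_gauss by auto
  qed measurable
  assume s: "sin t \<noteq> 0"
  let ?c = "cos t" and ?s = "sin t"
  \<comment> \<open>Inverse rotation: it rewrites the whole integrand as a function of
    \<open>rot t z\<close>, so that rotation invariance can be applied.\<close>
  have inv: "fst z = ?c *\<^sub>R fst (rot t z) - ?s *\<^sub>R snd (rot t z)" for z :: "'a \<times> 'a"
  proof -
    have "?c *\<^sub>R fst (rot t z) - ?s *\<^sub>R snd (rot t z) = fst z"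
      by (simp add: rot_def scaleR_diff_right scaleR_add_right mult.commute)
         (simp flip: scaleR_add_left)
    then show ?thesis ..
  qed
  define \<Phi> where "\<Phi> z = F (?c *\<^sub>R fst z - ?s *\<^sub>R snd z) * (DG (fst z) \<bullet> snd z)" for z
  define \<Psi> where "\<Psi> z = DF (?c *\<^sub>R fst z - ?s *\<^sub>R snd z) \<bullet> DG (fst z)" for z
  have [measurable]: "\<Phi> \<in> borel_measurable borel" "\<Psi> \<in> borel_measurable borel"
    unfolding \<Phi>_def \<Psi>_def by measurable
  obtain BDF where BDF: "0 \<le> BDF" "\<And>x. norm (DF x) \<le> BDF"
    using continuous_compact_support_bounded[OF cF zF(2)] by blast
  have i\<Phi>: "integrable std_gauss \<Phi>"
  proof (rule Bochner_Integration.integrable_bound)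
    show "integrable std_gauss (\<lambda>z::'a\<times>'a. BF * (BDG * norm z))"
      using integrable_norm_std_gauss by auto
    have "\<bar>\<Phi> z\<bar> \<le> BF * (BDG * norm z)" for z
    proof -
      have "\<bar>DG (fst z) \<bullet> snd z\<bar> \<le> norm (DG (fst z)) * norm (snd z)"
        by (rule Cauchy_Schwarz_ineq2)
      also have "\<dots> \<le> BDG * norm z"
        using BDG norm_snd_le[of "snd z" "fst z"] by (intro mult_mono) auto
      finally show ?thesis unfolding abs_mult \<Phi>_def by (rule mult_mono[rotated]) (use BF in auto)
    qed
    then show "AE z in std_gauss. norm (\<Phi> z) \<le> norm (BF * (BDG * norm z))"
      using BF BDG by (intro AE_I2) simp
  qed simp
  have i\<Psi>: "integrable std_gauss \<Psi>"
  proof (rule integrable_bounded_std_gauss)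
    show "\<bar>\<Psi> z\<bar> \<le> BDF * BDG" for z
      unfolding \<Psi>_def using Cauchy_Schwarz_ineq2 BDF BDG
      by (meson mult_mono norm_ge_zero order_trans)
  qed simp
  have "(\<integral>z. F (fst z) * (DG (fst (rot t z)) \<bullet> snd (rot t z)) \<partial>std_gauss) = (\<integral>z. \<Phi> (rot t z) \<partial>std_gauss)"
    unfolding \<Phi>_def inv[symmetric] ..
  also have "\<dots> = (\<integral>z. \<Phi> z \<partial>std_gauss)"
    by (rule std_gauss_rot) (auto simp: s)
  also have "\<dots> = (\<integral>x. \<integral>y. \<Phi> (x, y) \<partial>std_gauss \<partial>std_gauss)"
    by (rule std_gauss_Fubini[OF i\<Phi>])
  also have "\<dots> = (\<integral>x. \<integral>y. - ?s * \<Psi> (x, y) \<partial>std_gauss \<partial>std_gauss)"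
  proof (rule Bochner_Integration.integral_cong[OF refl])
    fix x :: 'a
    \<comment> \<open>For fixed x the map y to F (cos t x - sin t y) has compact support because sin
      t is not 0; its radius is where sin t y outweighs \<open>R + norm x\<close>.\<close>
    have far: "R < norm (?c *\<^sub>R x - ?s *\<^sub>R y)" if "(R + norm x) / \<bar>?s\<bar> < norm y" for y
    proof -
      have "R + norm x < \<bar>?s\<bar> * norm y" using that s by (simp add: divide_less_eq mult.commute)
      moreover have "norm (?c *\<^sub>R x) \<le> norm x" by (simp add: mult_left_le_one_le)
      ultimately show ?thesis using norm_triangle_ineq2[of "?s *\<^sub>R y" "?c *\<^sub>R x"] by (simp add: norm_minus_commute)
    qed
    have "(\<integral>y. F (?c *\<^sub>R x - ?s *\<^sub>R y) * (DG x \<bullet> y) \<partial>std_gauss) =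
      (\<integral>y. (- ?s *\<^sub>R DF (?c *\<^sub>R x - ?s *\<^sub>R y)) \<bullet> DG x \<partial>std_gauss)"
    proof (rule std_gauss_integration_by_parts[where R="(R + norm x) / \<bar>?s\<bar>"])
      show "((\<lambda>y. F (?c *\<^sub>R x - ?s *\<^sub>R y)) has_derivative (\<lambda>v. (- ?s *\<^sub>R DF (?c *\<^sub>R x - ?s *\<^sub>R y)) \<bullet> v)) (at y)" for y
        by (rule has_derivative_eq_rhs, rule has_derivative_compose[OF _ dF, where f="\<lambda>y. ?c *\<^sub>R x - ?s *\<^sub>R y"])
           (auto intro!: derivative_eq_intros)
      show "continuous_on UNIV (\<lambda>y. - ?s *\<^sub>R DF (?c *\<^sub>R x - ?s *\<^sub>R y))"
        by (intro continuous_intros continuous_on_compose2[OF cF]) auto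
    qed (simp_all add: zF(1)[OF far] zF(2)[OF far])
    then show "(\<integral>y. \<Phi> (x, y) \<partial>std_gauss) = (\<integral>y. - ?s * \<Psi> (x, y) \<partial>std_gauss)"
      by (simp add: \<Phi>_def \<Psi>_def)
  qed
  also have "\<dots> = (\<integral>z. - ?s * \<Psi> z \<partial>std_gauss)"
    using i\<Psi> by (intro std_gauss_Fubini[symmetric]) simp
  also have "\<dots> = (\<integral>z. - ?s * \<Psi> (rot t z) \<partial>std_gauss)"
    by (rule std_gauss_rot(1)[symmetric]) (auto simp: s)
  also have "\<dots> = - ?s * (\<integral>z. DF (fst z) \<bullet> DG (fst (rot t z)) \<partial>std_gauss)"
    unfolding \<Psi>_def inv[symmetric] by simp
  finally show "(\<phi> has_real_derivative (- ?s * (\<integral>z. DF (fst z) \<bullet> DG (fst (rot t z)) \<partial>std_gauss))) (at t)"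
    using der[of t] by simp
qed

text \<open>\<open>\<phi>\<close> runs from the mean of F G at t = 0, where the two arguments
  coincide, to the product of the means at t = pi/2, where they are independent.\<close>

lemma std_gauss_covariance_bound_compact:
  fixes F G :: "'a::euclidean_space \<Rightarrow> real"
  assumes dF: "\<And>x. (F has_derivative (\<lambda>v. DF x \<bullet> v)) (at x)" and cF: "continuous_on UNIV DF"
    and dG: "\<And>x. (G has_derivative (\<lambda>v. DG x \<bullet> v)) (at x)" and cG: "continuous_on UNIV DG"
    and zF: "\<And>x. R < norm x \<Longrightarrow> F x = 0" "\<And>x. R < norm x \<Longrightarrow> DF x = 0"
    and zG: "\<And>x. R < norm x \<Longrightarrow> G x = 0" "\<And>x. R < norm x \<Longrightarrow> DG x = 0"
    and C: "\<And>t. 0 < t \<Longrightarrow> t < pi / 2 \<Longrightarrow> \<bar>\<integral>z. DF (fst z) \<bullet> DG (fst (rot t z)) \<partial>std_gauss\<bar> \<le> C"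
  shows "\<bar>(\<integral>x. F x * G x \<partial>std_gauss) - (\<integral>x. F x \<partial>std_gauss) * (\<integral>x. G x \<partial>std_gauss)\<bar> \<le> C"
proof -
  have cF0: "continuous_on UNIV F" and cG0: "continuous_on UNIV G"
    using dF dG by (meson continuous_at_imp_continuous_on has_derivative_continuous)+
  have [measurable]: "F \<in> borel_measurable borel" "G \<in> borel_measurable borel"
    using cF0 cG0 by (auto intro: borel_measurable_continuous_onI)
  obtain BF where BF: "0 \<le> BF" "\<And>x. norm (F x) \<le> BF"
    using continuous_compact_support_bounded[OF cF0 zF(1)] by blast
  obtain BG where BG: "0 \<le> BG" "\<And>x. norm (G x) \<le> BG"
    using continuous_compact_support_bounded[OF cG0 zG(1)] by blast
  define \<phi> where "\<phi> t = (\<integral>z. F (fst z) * G (fst (rot t z)) \<partial>std_gauss)" for t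
  note der = std_gauss_interpolation_derivative[where R=R, OF dF cF dG cG zF zG, folded \<phi>_def]
  have \<phi>0: "\<phi> 0 = (\<integral>x. F x * G x \<partial>std_gauss)"
    unfolding \<phi>_def using std_gauss_proj(1)[of "\<lambda>x. F x * G x"] by (simp add: rot_def)
  have i: "integrable std_gauss (\<lambda>z. F (fst z) * G (snd z))"
    using BF BG by (intro integrable_bounded_std_gauss[of _ "BF * BG"]) (auto simp: abs_mult intro!: mult_mono)
  have "\<phi> (pi / 2) = (\<integral>z. F (fst z) * G (snd z) \<partial>std_gauss)"
    by (simp add: \<phi>_def rot_def)
  also have "\<dots> = (\<integral>x. \<integral>y. F x * G y \<partial>std_gauss \<partial>std_gauss)"
    using std_gauss_Fubini[OF i] by simp
  finally have \<phi>1: "\<phi> (pi / 2) = (\<integral>x. F x \<partial>std_gauss) * (\<integral>x. G x \<partial>std_gauss)" by simp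
  have cont: "continuous_on {0..pi/2} \<phi>"
    by (rule continuous_at_imp_continuous_on) (blast intro: DERIV_isCont[OF der(1)])
  define E where "E t = (\<integral>z. DF (fst z) \<bullet> DG (fst (rot t z)) \<partial>std_gauss)" for t
  have d: "(\<phi> has_real_derivative - sin t * E t) (at t)" "0 < sin t" "\<bar>E t\<bar> \<le> C" if "0 < t" "t < pi / 2" for t
    using der(2)[of t] C[OF that] sin_gt_zero2[OF that] by (auto simp: E_def)
  \<comment> \<open>The derivative is sin t (C - E t), which is nonnegative. As cos falls from 1 to
    0, exactly one \<open>C\<close> is lost; the mirrored function below gives the other
    sign.\<close>
  have "\<phi> 0 - C * cos 0 \<le> \<phi> (pi/2) - C * cos (pi/2)"
  proof (rule DERIV_nonneg_imp_increasing_open[where f="\<lambda>t. \<phi> t - C * cos t"])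
    show "\<exists>y. ((\<lambda>t. \<phi> t - C * cos t) has_real_derivative y) (at t) \<and> 0 \<le> y" if "0 < t" "t < pi/2" for t
      using d[OF that] mult_left_mono[of "E t" C "sin t"]
      by (intro exI[of _ "- sin t * E t + C * sin t"]) (auto intro!: derivative_eq_intros simp: mult.commute)
  qed (auto intro!: continuous_intros cont)
  moreover have "\<phi> (pi/2) + C * cos (pi/2) \<le> \<phi> 0 + C * cos 0"
  proof (rule DERIV_nonpos_imp_decreasing_open[where f="\<lambda>t. \<phi> t + C * cos t"])
    show "\<exists>y. ((\<lambda>t. \<phi> t + C * cos t) has_real_derivative y) (at t) \<and> y \<le> 0" if "0 < t" "t < pi/2" for t
      using d[OF that] mult_left_mono[of "- E t" C "sin t"]
      by (intro exI[of _ "- sin t * E t - C * sin t"]) (auto intro!: derivative_eq_intros simp: mult.commute)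
  qed (auto intro!: continuous_intros cont)
  ultimately show ?thesis using \<phi>0 \<phi>1 by auto
qed

section \<open>Covariance bounds and the Poincare inequality\<close>

lemma max_0_square_has_derivative:
  "((\<lambda>t. (max 0 t)\<^sup>2) has_real_derivative 2 * max 0 t) (at t)"
proof -
  consider "t < 0" | "t = 0" | "t > 0" by linarith
  then show ?thesis
  proof cases
    case 1
    have "((\<lambda>t::real. 0) has_real_derivative 2 * max 0 t) (at t)" using 1 by simp
    then show ?thesis
      by (rule has_field_derivative_transform_within_open[where S="{..<0}"]) (use 1 in auto)
  next
    case 2
    have "((\<lambda>y. (max 0 y)\<^sup>2 / y) \<longlongrightarrow> 0) (at (0::real))"
    proof (rule Lim_null_comparison)
      show "\<forall>\<^sub>F y in at (0::real). norm ((max 0 y)\<^sup>2 / y) \<le> \<bar>y\<bar>"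
        by (intro always_eventually allI) (auto simp: max_def power2_eq_square)
    qed (intro tendsto_rabs_zero tendsto_ident_at)
    then show ?thesis using 2 by (simp add: has_field_derivative_iff)
  next
    case 3
    have "((\<lambda>t. t\<^sup>2) has_real_derivative 2 * max 0 t) (at t)" using 3 by (auto intro!: derivative_eq_intros)
    then show ?thesis
      by (rule has_field_derivative_transform_within_open[where S="{0<..}"]) (use 3 in auto)
  qed
qed

text \<open>What matters is a gradient bound independent of \<open>n\<close>; 32 is generous, since
  the estimate passes through 16 / n. Squares of positive parts are C^1, which is all the smoothness
  asked of a cutoff here.\<close>

lemma smooth_cutoff:
  fixes n :: nat
  assumes n: "0 < n"
  obtains \<eta> :: "'a::euclidean_space \<Rightarrow> real" and D\<eta> :: "'a \<Rightarrow> 'a"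
  where "\<And>x. (\<eta> has_derivative (\<lambda>v. D\<eta> x \<bullet> v)) (at x)" "continuous_on UNIV D\<eta>"
    "\<And>x. 0 \<le> \<eta> x" "\<And>x. \<eta> x \<le> 1" "\<And>x. norm (D\<eta> x) \<le> 32"
    "\<And>x. norm x < real n \<Longrightarrow> \<eta> x = 1" "\<And>x. norm x < real n \<Longrightarrow> D\<eta> x = 0"
    "\<And>x. 2 * real n < norm x \<Longrightarrow> \<eta> x = 0" "\<And>x. 2 * real n < norm x \<Longrightarrow> D\<eta> x = 0"
proof
  \<comment> \<open>A C^1 step: equal to 1 for t <= 0, equal to 0 for t >= 1, with slope at most 4
    in absolute value.\<close>
  define \<rho> :: "real \<Rightarrow> real" where "\<rho> t = (max 0 (1 - (max 0 t)\<^sup>2))\<^sup>2" for t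
  define \<rho>' :: "real \<Rightarrow> real" where "\<rho>' t = 2 * max 0 (1 - (max 0 t)\<^sup>2) * (- (2 * max 0 t))" for t
  have d\<rho>: "(\<rho> has_real_derivative \<rho>' t) (at t)" for t
    unfolding \<rho>_def \<rho>'_def
    by (rule DERIV_chain2[OF max_0_square_has_derivative])
       (use DERIV_diff[OF DERIV_const max_0_square_has_derivative[of t], of 1] in simp)
  have c\<rho>': "continuous_on UNIV \<rho>'"
    unfolding \<rho>'_def by (intro continuous_intros)
  have \<rho>1: "\<rho> t = 1" "\<rho>' t = 0" if "t \<le> 0" for t using that by (simp_all add: \<rho>_def \<rho>'_def)
  have \<rho>0: "\<rho> t = 0" "\<rho>' t = 0" if "1 \<le> t" for t
  proof -
    have "max 0 (1 - (max 0 t)\<^sup>2) = 0"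
      using that one_le_power[OF that, of 2] by (intro max_absorb1) (simp add: max_absorb2)
    then show "\<rho> t = 0" "\<rho>' t = 0" by (simp_all add: \<rho>_def \<rho>'_def)
  qed
  have \<rho>b: "0 \<le> \<rho> t" "\<rho> t \<le> 1" for t
    unfolding \<rho>_def by (auto intro!: power_le_one simp: max_def)
  have \<rho>'b: "\<bar>\<rho>' t\<bar> \<le> 4" for t
  proof (cases "0 \<le> t \<and> t \<le> 1")
    case True
    then have "\<bar>\<rho>' t\<bar> = 4 * ((1 - t\<^sup>2) * t)" by (auto simp: \<rho>'_def max_def abs_mult power_le_one)
    also have "(1 - t\<^sup>2) * t \<le> 1 * 1" using True by (intro mult_mono) auto
    finally show ?thesis by simp
  qed (use \<rho>1[of t] \<rho>0[of t] in \<open>auto simp: not_le\<close>)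
  \<comment> \<open>Using the squared norm keeps the profile differentiable at the origin.
    \<open>s\<close> is at most 0 inside radius n and at least 1 once norm x ^ 2 is at least 2 n^2,
    in particular beyond radius 2 n.\<close>
  define s where "s x = (norm x)\<^sup>2 / (real n)\<^sup>2 - 1" for x :: 'a
  let ?\<eta> = "\<lambda>x::'a. \<rho> (s x)" and ?D = "\<lambda>x::'a. (2 * \<rho>' (s x) / (real n)\<^sup>2) *\<^sub>R x"
  have ds: "(s has_derivative (\<lambda>v. 2 / (real n)\<^sup>2 * (x \<bullet> v))) (at x)" for x
  proof -
    have "((\<lambda>x. (x \<bullet> x) * (1 / (real n)\<^sup>2) - 1) has_derivative (\<lambda>v. (x \<bullet> v + v \<bullet> x) * (1 / (real n)\<^sup>2) - 0)) (at x)"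
      by (intro has_derivative_diff has_derivative_mult_left has_derivative_inner has_derivative_ident has_derivative_const)
    then show ?thesis
      by (simp add: s_def[abs_def] power2_norm_eq_inner inner_commute)
  qed
  show "(?\<eta> has_derivative (\<lambda>v. ?D x \<bullet> v)) (at x)" for x
    by (rule has_derivative_eq_rhs, rule has_derivative_compose[OF ds d\<rho>[unfolded has_field_derivative_def]]) auto
  have cs: "continuous_on UNIV s" unfolding s_def using n by (intro continuous_intros) auto
  show "continuous_on UNIV ?D"
    using n by (intro continuous_intros continuous_on_compose2[OF c\<rho>' cs]) auto
  show "0 \<le> ?\<eta> x" "?\<eta> x \<le> 1" for x by (fact \<rho>b)+
  have small: "s x \<le> 0" if "norm x < real n" for x
    using that n by (simp add: s_def divide_le_eq power_mono)
  have big: "1 \<le> s x" if "2 * real n < norm x" for x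
  proof -
    have "(2 * real n)\<^sup>2 \<le> (norm x)\<^sup>2" using that by (intro power_mono) auto
    then have "2 * (real n)\<^sup>2 \<le> (norm x)\<^sup>2"
      using zero_le_power2[of "real n"] unfolding power_mult_distrib power2_eq_square[of 2] by linarith
    then show ?thesis using n by (simp add: s_def le_divide_eq le_diff_eq)
  qed
  show "?\<eta> x = 1" "?D x = 0" if "norm x < real n" for x using \<rho>1[OF small[OF that]] by auto
  show "?\<eta> x = 0" "?D x = 0" if "2 * real n < norm x" for x using \<rho>0[OF big[OF that]] by auto
  show "norm (?D x) \<le> 32" for x
  proof (cases "2 * real n < norm x")
    case False
    have "norm (?D x) = \<bar>\<rho>' (s x)\<bar> * (2 * norm x / (real n)\<^sup>2)" by (simp add: abs_mult)
    also have "\<dots> \<le> 4 * (4 / real n)"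
      using False n \<rho>'b by (intro mult_mono) (auto simp: power2_eq_square divide_simps)
    also have "\<dots> \<le> 32" using n by (simp add: divide_simps)
    finally show ?thesis .
  qed (use \<rho>0[OF big] in auto)
qed

text \<open>The C^1 members of the Gaussian Sobolev space W^{1,2}; the gradient is an explicit
  argument, tied to \<open>F\<close> by the derivative condition.\<close>

definition sobolev :: "('a::euclidean_space \<Rightarrow> real) \<Rightarrow> ('a \<Rightarrow> 'a) \<Rightarrow> bool" where
  "sobolev F DF \<longleftrightarrow> (\<forall>x. (F has_derivative (\<lambda>v. DF x \<bullet> v)) (at x)) \<and> continuous_on UNIV DF \<and>
     integrable std_gauss (\<lambda>x. (F x)\<^sup>2) \<and> integrable std_gauss (\<lambda>x. (norm (DF x))\<^sup>2)"

lemma sobolevD: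
  assumes "sobolev F DF"
  shows "(F has_derivative (\<lambda>v. DF x \<bullet> v)) (at x)" "continuous_on UNIV DF" "continuous_on UNIV F"
    "integrable std_gauss (\<lambda>x. (F x)\<^sup>2)" "integrable std_gauss (\<lambda>x. (norm (DF x))\<^sup>2)"
    "F \<in> borel_measurable borel" "DF \<in> borel_measurable borel" "integrable std_gauss F"
proof -
  show d: "(F has_derivative (\<lambda>v. DF x \<bullet> v)) (at x)" and c: "continuous_on UNIV DF"
    and i: "integrable std_gauss (\<lambda>x. (F x)\<^sup>2)" and "integrable std_gauss (\<lambda>x. (norm (DF x))\<^sup>2)" for x
    using assms by (auto simp: sobolev_def)
  show cF: "continuous_on UNIV F"
    using d by (meson assms continuous_at_imp_continuous_on has_derivative_continuous sobolev_def)
  show [measurable]: "F \<in> borel_measurable borel" and "DF \<in> borel_measurable borel"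
    using c cF by (auto intro: borel_measurable_continuous_onI)
  show "integrable std_gauss F"
    by (rule std_gauss.square_integrable_imp_integrable[OF _ i]) measurable
qed

text \<open>Density of compactly supported C^1 functions. The gradient error is (\<eta> - 1) DF + F
  D\<eta>; it is square-dominated uniformly in k because the cutoff gradients are uniformly bounded,
  and at each point it is eventually zero.\<close>

lemma sobolev_cutoff:
  fixes F :: "'a::euclidean_space \<Rightarrow> real"
  assumes "sobolev F DF"
  obtains Fk :: "nat \<Rightarrow> 'a \<Rightarrow> real" and DFk :: "nat \<Rightarrow> 'a \<Rightarrow> 'a"
  where "\<And>k x. (Fk k has_derivative (\<lambda>v. DFk k x \<bullet> v)) (at x)" "\<And>k. continuous_on UNIV (DFk k)"
    "\<And>k x. 2 * real (Suc k) < norm x \<Longrightarrow> Fk k x = 0" "\<And>k x. 2 * real (Suc k) < norm x \<Longrightarrow> DFk k x = 0"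
    "\<And>k x. \<bar>Fk k x\<bar> \<le> \<bar>F x\<bar>" "\<And>x. (\<lambda>k. Fk k x) \<longlonglongrightarrow> F x"
    "\<And>k. integrable std_gauss (\<lambda>x. (norm (DFk k x - DF x))\<^sup>2)"
    "(\<lambda>k. \<integral>x. (norm (DFk k x - DF x))\<^sup>2 \<partial>std_gauss) \<longlonglongrightarrow> 0"
proof -
  note F = sobolevD[OF assms]
  note [measurable] = F(6,7)
  define P where "P n \<eta> D\<eta> \<longleftrightarrow>
    (\<forall>x. (\<eta> has_derivative (\<lambda>v. D\<eta> x \<bullet> v)) (at x)) \<and> continuous_on UNIV D\<eta> \<and>
    (\<forall>x. 0 \<le> \<eta> x) \<and> (\<forall>x. \<eta> x \<le> 1) \<and> (\<forall>x. norm (D\<eta> x) \<le> 32) \<and>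
    (\<forall>x. norm x < real n \<longrightarrow> \<eta> x = 1) \<and> (\<forall>x. norm x < real n \<longrightarrow> D\<eta> x = 0) \<and>
    (\<forall>x. 2 * real n < norm x \<longrightarrow> \<eta> x = 0) \<and> (\<forall>x. 2 * real n < norm x \<longrightarrow> D\<eta> x = 0)"
    for n and \<eta> :: "'a \<Rightarrow> real" and D\<eta> :: "'a \<Rightarrow> 'a"
  have "\<exists>p. P (Suc k) (fst p) (snd p)" for k
  proof -
    obtain \<eta> D\<eta> where "P (Suc k) \<eta> D\<eta>"
      by (rule smooth_cutoff[OF zero_less_Suc[of k], where 'a='a]) (auto simp: P_def)
    then show ?thesis by (intro exI[of _ "(\<eta>, D\<eta>)"]) simp
  qed
  then obtain p where p: "\<And>k. P (Suc k) (fst (p k)) (snd (p k))" by metis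
  define \<eta> where "\<eta> k = fst (p k)" for k
  define D\<eta> where "D\<eta> k = snd (p k)" for k
  have \<eta>: "(\<eta> k has_derivative (\<lambda>v. D\<eta> k x \<bullet> v)) (at x)" "continuous_on UNIV (D\<eta> k)"
    "0 \<le> \<eta> k x" "\<eta> k x \<le> 1" "norm (D\<eta> k x) \<le> 32"
    "norm x < real (Suc k) \<Longrightarrow> \<eta> k x = 1" "norm x < real (Suc k) \<Longrightarrow> D\<eta> k x = 0"
    "2 * real (Suc k) < norm x \<Longrightarrow> \<eta> k x = 0" "2 * real (Suc k) < norm x \<Longrightarrow> D\<eta> k x = 0" for k x
    using p[of k] unfolding P_def \<eta>_def[symmetric] D\<eta>_def[symmetric] by blast+
  have c\<eta>: "continuous_on UNIV (\<eta> k)" for k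
    using \<eta>(1) by (meson continuous_at_imp_continuous_on has_derivative_continuous)
  have [measurable]: "\<eta> k \<in> borel_measurable borel" "D\<eta> k \<in> borel_measurable borel" for k
    using c\<eta> \<eta>(2) by (auto intro: borel_measurable_continuous_onI)
  define Fk where "Fk k x = \<eta> k x * F x" for k x
  define DFk where "DFk k x = \<eta> k x *\<^sub>R DF x + F x *\<^sub>R D\<eta> k x" for k x
  have [measurable]: "DFk k \<in> borel_measurable borel" for k
    unfolding DFk_def by measurable
  have ev: "\<forall>\<^sub>F k in sequentially. norm x < real (Suc k)" for x :: 'a
  proof -
    obtain N :: nat where "norm x < real N" using reals_Archimedean2 by blast
    then show ?thesis by (intro eventually_sequentiallyI[of N]) auto
  qed
  \<comment> \<open>From (a + b)^2 <= 2 a^2 + 2 b^2, with 32 the gradient bound of the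
    cutoffs.\<close>
  define w where "w x = 2 * (norm (DF x))\<^sup>2 + 2 * 32\<^sup>2 * (F x)\<^sup>2" for x
  have w: "integrable std_gauss w" unfolding w_def using F(4,5) by auto
  have bound: "(norm (DFk k x - DF x))\<^sup>2 \<le> w x" for k x
  proof -
    have "DFk k x - DF x = (\<eta> k x - 1) *\<^sub>R DF x + F x *\<^sub>R D\<eta> k x"
      by (simp add: DFk_def algebra_simps)
    then have "norm (DFk k x - DF x) \<le> norm ((\<eta> k x - 1) *\<^sub>R DF x) + norm (F x *\<^sub>R D\<eta> k x)"
      by (metis norm_triangle_ineq)
    also have "norm ((\<eta> k x - 1) *\<^sub>R DF x) \<le> 1 * norm (DF x)"
      unfolding norm_scaleR using \<eta>(3,4)[where k=k and x=x] by (intro mult_right_mono) auto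
    also have "norm (F x *\<^sub>R D\<eta> k x) \<le> \<bar>F x\<bar> * 32"
      unfolding norm_scaleR using \<eta>(5) by (intro mult_left_mono) auto
    finally have "(norm (DFk k x - DF x))\<^sup>2 \<le> (norm (DF x) + \<bar>F x\<bar> * 32)\<^sup>2"
      by (intro power_mono) auto
    also have "\<dots> \<le> w x"
      using sum_squares_bound[of "norm (DF x)" "\<bar>F x\<bar> * 32"] by (simp add: w_def power2_sum power_mult_distrib)
    finally show ?thesis .
  qed
  show ?thesis
  proof (rule that[of Fk DFk])
    show "(Fk k has_derivative (\<lambda>v. DFk k x \<bullet> v)) (at x)" for k x
      unfolding Fk_def DFk_def
      by (rule has_derivative_eq_rhs[OF has_derivative_mult[OF \<eta>(1) F(1)]]) (auto simp: inner_add_left)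
    show "continuous_on UNIV (DFk k)" for k
      unfolding DFk_def by (intro continuous_intros c\<eta> \<eta>(2) F(2,3))
    show "\<bar>Fk k x\<bar> \<le> \<bar>F x\<bar>" for k x
      unfolding Fk_def abs_mult using \<eta>(3,4)[where k=k and x=x] by (intro mult_left_le_one_le) auto
    show "(\<lambda>k. Fk k x) \<longlonglongrightarrow> F x" for x
      by (rule tendsto_eventually, rule eventually_mono[OF ev[of x]]) (simp add: Fk_def \<eta>(6))
    show "integrable std_gauss (\<lambda>x. (norm (DFk k x - DF x))\<^sup>2)" for k
      using bound by (intro Bochner_Integration.integrable_bound[OF w]) (auto intro!: AE_I2 order_trans[OF _ abs_ge_self])
    have "(\<lambda>k. \<integral>x. (norm (DFk k x - DF x))\<^sup>2 \<partial>std_gauss) \<longlonglongrightarrow> (\<integral>x. 0 \<partial>(std_gauss :: 'a measure))"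
    proof (rule integral_dominated_convergence[OF _ _ w])
      \<comment> \<open>Every point eventually lies in the region where the cutoff is identically 1,
        so the error is exactly 0 from some k on.\<close>
      show "AE x in std_gauss. (\<lambda>k. (norm (DFk k x - DF x))\<^sup>2) \<longlonglongrightarrow> 0"
      proof (intro AE_I2 tendsto_eventually)
        show "\<forall>\<^sub>F k in sequentially. (norm (DFk k x - DF x))\<^sup>2 = 0" for x
          by (rule eventually_mono[OF ev[of x]]) (simp add: DFk_def \<eta>(6,7))
      qed
    qed (use bound in auto)
    then show "(\<lambda>k. \<integral>x. (norm (DFk k x - DF x))\<^sup>2 \<partial>std_gauss) \<longlonglongrightarrow> 0" by simp
  qed (simp_all add: Fk_def DFk_def \<eta>)
qed

text \<open>Both \<open>fst z\<close> and \<open>fst (rot t z)\<close> are standard Gaussian, so the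
  two L2 norms do not depend on t. This uniformity in t is what the approximation argument
  needs.\<close>

lemma Cauchy_Schwarz_std_gauss_rot:
  fixes u v :: "'a::euclidean_space \<Rightarrow> 'a"
  assumes [measurable]: "u \<in> borel_measurable borel" "v \<in> borel_measurable borel"
    and iu: "integrable std_gauss (\<lambda>x. (norm (u x))\<^sup>2)" and iv: "integrable std_gauss (\<lambda>x. (norm (v x))\<^sup>2)"
    and t: "sin t \<noteq> 0"
  shows "integrable std_gauss (\<lambda>z. u (fst z) \<bullet> v (fst (rot t z)))"
    and "\<bar>\<integral>z. u (fst z) \<bullet> v (fst (rot t z)) \<partial>std_gauss\<bar> \<le>
      sqrt (\<integral>x. (norm (u x))\<^sup>2 \<partial>std_gauss) * sqrt (\<integral>x. (norm (v x))\<^sup>2 \<partial>std_gauss)"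
proof -
  have u: "integrable std_gauss (\<lambda>z::'a\<times>'a. (norm (u (fst z)))\<^sup>2)"
    "(\<integral>z. (norm (u (fst z)))\<^sup>2 \<partial>(std_gauss :: ('a\<times>'a) measure)) = (\<integral>x. (norm (u x))\<^sup>2 \<partial>std_gauss)"
    using std_gauss_proj[of "\<lambda>x. (norm (u x))\<^sup>2"] iu by auto
  have v: "integrable std_gauss (\<lambda>z::'a\<times>'a. (norm (v (fst z)))\<^sup>2)"
    "(\<integral>z. (norm (v (fst z)))\<^sup>2 \<partial>(std_gauss :: ('a\<times>'a) measure)) = (\<integral>x. (norm (v x))\<^sup>2 \<partial>std_gauss)"
    using std_gauss_proj[of "\<lambda>x. (norm (v x))\<^sup>2"] iv by auto
  have v': "integrable std_gauss (\<lambda>z. (norm (v (fst (rot t z))))\<^sup>2)"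
    "(\<integral>z. (norm (v (fst (rot t z))))\<^sup>2 \<partial>std_gauss) = (\<integral>x. (norm (v x))\<^sup>2 \<partial>std_gauss)"
    using std_gauss_rot[of "\<lambda>z. (norm (v (fst z)))\<^sup>2" t] v t by auto
  show "integrable std_gauss (\<lambda>z. u (fst z) \<bullet> v (fst (rot t z)))"
    by (rule Cauchy_Schwarz_integral_inner(1)) (use u v' in auto)
  show "\<bar>\<integral>z. u (fst z) \<bullet> v (fst (rot t z)) \<partial>std_gauss\<bar> \<le>
      sqrt (\<integral>x. (norm (u x))\<^sup>2 \<partial>std_gauss) * sqrt (\<integral>x. (norm (v x))\<^sup>2 \<partial>std_gauss)"
    using Cauchy_Schwarz_integral_inner(2)[of "\<lambda>z. u (fst z)" std_gauss "\<lambda>z. v (fst (rot t z))"] u v' by simp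
qed

text \<open>The hypothesis bounds the inner products for \<open>F\<close> and \<open>G\<close>
  themselves. Passing to cutoffs changes them by at most products of gradient norms with gradient
  errors, uniformly in t, so the compact case applies with a constant tending to
  \<open>C\<close>.\<close>

lemma std_gauss_covariance_bound:
  fixes F G :: "'a::euclidean_space \<Rightarrow> real"
  assumes F: "sobolev F DF" and G: "sobolev G DG"
    and C: "\<And>t. 0 < t \<Longrightarrow> t < pi / 2 \<Longrightarrow> \<bar>\<integral>z. DF (fst z) \<bullet> DG (fst (rot t z)) \<partial>std_gauss\<bar> \<le> C"
  shows "\<bar>(\<integral>x. F x * G x \<partial>std_gauss) - (\<integral>x. F x \<partial>std_gauss) * (\<integral>x. G x \<partial>std_gauss)\<bar> \<le> C"
proof -
  obtain Fk DFk where Fk: "\<And>k x. (Fk k has_derivative (\<lambda>v. DFk k x \<bullet> v)) (at x)" "\<And>k. continuous_on UNIV (DFk k)"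
    "\<And>k x. 2 * real (Suc k) < norm x \<Longrightarrow> Fk k x = 0" "\<And>k x. 2 * real (Suc k) < norm x \<Longrightarrow> DFk k x = 0"
    "\<And>k x. \<bar>Fk k x\<bar> \<le> \<bar>F x\<bar>" "\<And>x. (\<lambda>k. Fk k x) \<longlonglongrightarrow> F x"
    "\<And>k. integrable std_gauss (\<lambda>x. (norm (DFk k x - DF x))\<^sup>2)"
    "(\<lambda>k. \<integral>x. (norm (DFk k x - DF x))\<^sup>2 \<partial>std_gauss) \<longlonglongrightarrow> 0"
    using sobolev_cutoff[OF F] by blast
  obtain Gk DGk where Gk: "\<And>k x. (Gk k has_derivative (\<lambda>v. DGk k x \<bullet> v)) (at x)" "\<And>k. continuous_on UNIV (DGk k)"
    "\<And>k x. 2 * real (Suc k) < norm x \<Longrightarrow> Gk k x = 0" "\<And>k x. 2 * real (Suc k) < norm x \<Longrightarrow> DGk k x = 0"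
    "\<And>k x. \<bar>Gk k x\<bar> \<le> \<bar>G x\<bar>" "\<And>x. (\<lambda>k. Gk k x) \<longlonglongrightarrow> G x"
    "\<And>k. integrable std_gauss (\<lambda>x. (norm (DGk k x - DG x))\<^sup>2)"
    "(\<lambda>k. \<integral>x. (norm (DGk k x - DG x))\<^sup>2 \<partial>std_gauss) \<longlonglongrightarrow> 0"
    using sobolev_cutoff[OF G] by blast
  note F' = sobolevD[OF F] and G' = sobolevD[OF G]
  note [measurable] = F'(6,7) G'(6,7)
  have [measurable]: "DFk k \<in> borel_measurable borel" "DGk k \<in> borel_measurable borel" for k
    using Fk(2) Gk(2) by (auto intro: borel_measurable_continuous_onI)
  have "continuous_on UNIV (Fk k)" "continuous_on UNIV (Gk k)" for k
    using Fk(1) Gk(1) by (meson continuous_at_imp_continuous_on has_derivative_continuous)+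
  then have [measurable]: "Fk k \<in> borel_measurable borel" "Gk k \<in> borel_measurable borel" for k
    by (auto intro: borel_measurable_continuous_onI)
  define a where "a = sqrt (\<integral>x. (norm (DF x))\<^sup>2 \<partial>std_gauss)"
  define b where "b = sqrt (\<integral>x. (norm (DG x))\<^sup>2 \<partial>std_gauss)"
  define ak where "ak k = sqrt (\<integral>x. (norm (DFk k x - DF x))\<^sup>2 \<partial>std_gauss)" for k
  define bk where "bk k = sqrt (\<integral>x. (norm (DGk k x - DG x))\<^sup>2 \<partial>std_gauss)" for k
  have ak: "ak \<longlonglongrightarrow> 0" unfolding ak_def using tendsto_real_sqrt[OF Fk(8)] by simp
  have bk: "bk \<longlonglongrightarrow> 0" unfolding bk_def using tendsto_real_sqrt[OF Gk(8)] by simp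
  \<comment> \<open>The three extra terms bound the three error terms in the bilinear expansion
    around (DF, DG).\<close>
  define Ck where "Ck k = C + (ak k * b + ak k * bk k + a * bk k)" for k
  have Ck: "Ck \<longlonglongrightarrow> C"
    unfolding Ck_def using ak bk by (auto intro!: tendsto_eq_intros)
  define cov where "cov k = (\<integral>x. Fk k x * Gk k x \<partial>std_gauss) - (\<integral>x. Fk k x \<partial>std_gauss) * (\<integral>x. Gk k x \<partial>std_gauss)" for k
  have bound: "\<bar>cov k\<bar> \<le> Ck k" for k
    unfolding cov_def
  proof (rule std_gauss_covariance_bound_compact[OF Fk(1,2) Gk(1,2) Fk(3,4) Gk(3,4)])
    fix t :: real assume t: "0 < t" "t < pi / 2"
    have st: "sin t \<noteq> 0" using sin_gt_zero2[OF t] by simp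
    note CS1 = Cauchy_Schwarz_std_gauss_rot[OF _ _ F'(5) G'(5) st]
    note CS2 = Cauchy_Schwarz_std_gauss_rot[OF _ _ Fk(7) G'(5) st]
    note CS3 = Cauchy_Schwarz_std_gauss_rot[OF _ _ Fk(7) Gk(7) st]
    note CS4 = Cauchy_Schwarz_std_gauss_rot[OF _ _ F'(5) Gk(7) st]
    have eq: "DFk k (fst z) \<bullet> DGk k (fst (rot t z)) =
       DF (fst z) \<bullet> DG (fst (rot t z)) + (DFk k (fst z) - DF (fst z)) \<bullet> DG (fst (rot t z)) +
       (DFk k (fst z) - DF (fst z)) \<bullet> (DGk k (fst (rot t z)) - DG (fst (rot t z))) +
       DF (fst z) \<bullet> (DGk k (fst (rot t z)) - DG (fst (rot t z)))" for z
      by (simp add: inner_diff_left inner_diff_right)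
    have "(\<integral>z. DFk k (fst z) \<bullet> DGk k (fst (rot t z)) \<partial>std_gauss) =
       (\<integral>z. DF (fst z) \<bullet> DG (fst (rot t z)) \<partial>std_gauss) + (\<integral>z. (DFk k (fst z) - DF (fst z)) \<bullet> DG (fst (rot t z)) \<partial>std_gauss) +
       (\<integral>z. (DFk k (fst z) - DF (fst z)) \<bullet> (DGk k (fst (rot t z)) - DG (fst (rot t z))) \<partial>std_gauss) +
       (\<integral>z. DF (fst z) \<bullet> (DGk k (fst (rot t z)) - DG (fst (rot t z))) \<partial>std_gauss)"
      unfolding eq using CS1(1) CS2(1)[of k] CS3(1)[of k k] CS4(1)[of k] by simp
    moreover have "\<bar>\<integral>z. (DFk k (fst z) - DF (fst z)) \<bullet> DG (fst (rot t z)) \<partial>std_gauss\<bar> \<le> ak k * b"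
      using CS2(2)[of k] by (simp add: ak_def b_def)
    moreover have "\<bar>\<integral>z. (DFk k (fst z) - DF (fst z)) \<bullet> (DGk k (fst (rot t z)) - DG (fst (rot t z))) \<partial>std_gauss\<bar> \<le> ak k * bk k"
      using CS3(2)[of k k] by (simp add: ak_def bk_def)
    moreover have "\<bar>\<integral>z. DF (fst z) \<bullet> (DGk k (fst (rot t z)) - DG (fst (rot t z))) \<partial>std_gauss\<bar> \<le> a * bk k"
      using CS4(2)[of k] by (simp add: a_def bk_def)
    ultimately show "\<bar>\<integral>z. DFk k (fst z) \<bullet> DGk k (fst (rot t z)) \<partial>std_gauss\<bar> \<le> Ck k"
      using C[OF t] unfolding Ck_def by linarith
  qed
  have "cov \<longlonglongrightarrow> (\<integral>x. F x * G x \<partial>std_gauss) - (\<integral>x. F x \<partial>std_gauss) * (\<integral>x. G x \<partial>std_gauss)"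
    unfolding cov_def[abs_def]
  proof (intro tendsto_diff tendsto_mult)
    show "(\<lambda>k. \<integral>x. Fk k x * Gk k x \<partial>std_gauss) \<longlonglongrightarrow> (\<integral>x. F x * G x \<partial>std_gauss)"
    proof (rule integral_dominated_convergence)
      show "integrable std_gauss (\<lambda>x. \<bar>F x * G x\<bar>)"
        using Cauchy_Schwarz_integral(1)[of F std_gauss G] F'(4) G'(4) by auto
    qed (use Fk(5,6) Gk(5,6) in \<open>auto simp: abs_mult intro!: AE_I2 mult_mono tendsto_mult\<close>)
    show "(\<lambda>k. \<integral>x. Fk k x \<partial>std_gauss) \<longlonglongrightarrow> (\<integral>x. F x \<partial>std_gauss)"
      by (rule integral_dominated_convergence[where w="\<lambda>x. \<bar>F x\<bar>"]) (use F'(8) Fk(5,6) in auto)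
    show "(\<lambda>k. \<integral>x. Gk k x \<partial>std_gauss) \<longlonglongrightarrow> (\<integral>x. G x \<partial>std_gauss)"
      by (rule integral_dominated_convergence[where w="\<lambda>x. \<bar>G x\<bar>"]) (use G'(8) Gk(5,6) in auto)
  qed
  then show ?thesis
    by (intro LIMSEQ_le[OF tendsto_rabs Ck]) (use bound in auto)
qed

text \<open>Cauchy-Schwarz bounds the correlation of DF with its rotated version by the second
  moment of \<open>norm (DF x)\<close>, for every t; this is the constant \<open>C\<close>.\<close>

lemma Gaussian_Poincare:
  fixes F :: "'a::euclidean_space \<Rightarrow> real"
  assumes F: "sobolev F DF"
  shows "(\<integral>x. (F x)\<^sup>2 \<partial>std_gauss) - (\<integral>x. F x \<partial>std_gauss)\<^sup>2 \<le> (\<integral>x. (norm (DF x))\<^sup>2 \<partial>std_gauss)"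
proof -
  have "\<bar>(\<integral>x. F x * F x \<partial>std_gauss) - (\<integral>x. F x \<partial>std_gauss) * (\<integral>x. F x \<partial>std_gauss)\<bar>
    \<le> (\<integral>x. (norm (DF x))\<^sup>2 \<partial>std_gauss)"
  proof (rule std_gauss_covariance_bound[OF F F])
    fix t :: real assume t: "0 < t" "t < pi / 2"
    then show "\<bar>\<integral>z. DF (fst z) \<bullet> DF (fst (rot t z)) \<partial>std_gauss\<bar> \<le> (\<integral>x. (norm (DF x))\<^sup>2 \<partial>std_gauss)"
      using Cauchy_Schwarz_std_gauss_rot(2)[OF sobolevD(7,7,5,5)[OF F], of t] sin_gt_zero2[OF t] by simp
  qed
  then show ?thesis by (simp add: power2_eq_square)
qed

section \<open>The second order Poincare inequality\<close>

lemma adjoint_eq_sum: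
  fixes L :: "'a::euclidean_space \<Rightarrow> 'b::euclidean_space"
  assumes "linear L"
  shows "adjoint L y = (\<Sum>b\<in>Basis. (L b \<bullet> y) *\<^sub>R b)"
proof -
  have "adjoint L y = (\<Sum>b\<in>Basis. (adjoint L y \<bullet> b) *\<^sub>R b)" by (simp add: euclidean_representation)
  also have "\<dots> = (\<Sum>b\<in>Basis. (L b \<bullet> y) *\<^sub>R b)"
    using adjoint_works[OF assms] by (intro sum.cong refl) (metis inner_commute)
  finally show ?thesis .
qed

text \<open>In a basis the adjoint is a finite sum of inner products
  \<open>L z b \<bullet> y z\<close>, so continuity of \<open>L z v\<close> for each fixed
  \<open>v\<close> is enough.\<close>

lemma continuous_on_adjoint:
  fixes L :: "'c::topological_space \<Rightarrow> 'a::euclidean_space \<Rightarrow> 'b::euclidean_space"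
  assumes "\<And>z. linear (L z)" and "\<And>v. continuous_on S (\<lambda>z. L z v)" and "continuous_on S y"
  shows "continuous_on S (\<lambda>z. adjoint (L z) (y z))"
  unfolding adjoint_eq_sum[OF assms(1)] by (intro continuous_intros assms)

text \<open>The reflection \<^term>\<open>r\<close> exchanges the first coordinate with its rotated version, so both
  summands of the gradient of T have the same second moment.\<close>

lemma std_gauss_reflect:
  fixes f :: "'a::euclidean_space \<times> 'a \<Rightarrow> real"
  assumes [measurable]: "f \<in> borel_measurable borel" and t: "0 < t" "t < pi / 2"
  defines "r \<equiv> \<lambda>z. (snd (rot (t - pi / 2) z), fst (rot (t - pi / 2) z))"
  shows "fst (r z) = fst (rot t z)" and "fst (rot t (r z)) = fst z"
    and "(\<integral>z. f (r z) \<partial>std_gauss) = (\<integral>z. f z \<partial>std_gauss)"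
    and "integrable std_gauss (\<lambda>z. f (r z)) \<longleftrightarrow> integrable std_gauss f"
proof -
  \<comment> \<open>Rotating by t - pi/2 puts the interpolated variable into the second slot, and
    the swap moves it to the first; both maps preserve the Gaussian measure.\<close>
  have tr: "sin (t - pi / 2) = - cos t" "cos (t - pi / 2) = sin t"
    by (simp_all add: sin_diff cos_diff)
  show "fst (r z) = fst (rot t z)"
    by (simp add: r_def rot_def tr)
  show "fst (rot t (r z)) = fst z"
    by (simp add: r_def rot_def tr scaleR_diff_right scaleR_add_right mult.commute)
       (simp flip: scaleR_add_left)
  have s: "sin (t - pi / 2) \<noteq> 0"
    using cos_gt_zero[OF t] by (simp add: tr)
  have [measurable]: "(\<lambda>z. (snd z, fst z)) \<in> measurable (std_gauss :: ('a \<times> 'a) measure) borel" by measurable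
  have g: "(\<lambda>z. f (snd z, fst z)) \<in> borel_measurable borel" by measurable
  have "(\<integral>z. f (r z) \<partial>std_gauss) = (\<integral>z. f (snd z, fst z) \<partial>std_gauss)"
    unfolding r_def using std_gauss_rot(1)[OF g s] by simp
  also have "\<dots> = (\<integral>z. f z \<partial>std_gauss)"
    by (subst (2) distr_std_gauss_swap[symmetric]) (simp add: integral_distr)
  finally show "(\<integral>z. f (r z) \<partial>std_gauss) = (\<integral>z. f z \<partial>std_gauss)" .
  have "integrable std_gauss (\<lambda>z. f (r z)) \<longleftrightarrow> integrable std_gauss (\<lambda>z. f (snd z, fst z))"
    unfolding r_def using std_gauss_rot(2)[OF g s] by simp
  also have "\<dots> \<longleftrightarrow> integrable std_gauss f"
    by (subst (2) distr_std_gauss_swap[symmetric]) (simp add: integrable_distr_eq)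
  finally show "integrable std_gauss (\<lambda>z. f (r z)) \<longleftrightarrow> integrable std_gauss f" .
qed

text \<open>A bounded derivative forces linear growth,
  \<open>\<bar>f w\<bar> \<le> \<bar>f 0\<bar> + B * \<bar>w\<bar>\<close>, so square integrability
  survives composition.\<close>

lemma square_integrable_compose_Lipschitz:
  fixes h :: "'a::euclidean_space \<Rightarrow> real" and f :: "real \<Rightarrow> real"
  assumes [measurable]: "h \<in> borel_measurable borel" "f \<in> borel_measurable borel"
    and ih: "integrable std_gauss (\<lambda>x. (h x)\<^sup>2)"
    and df: "\<And>w. (f has_real_derivative f' w) (at w)" and Bf': "\<And>w. \<bar>f' w\<bar> \<le> B"
  shows "integrable std_gauss (\<lambda>x. (f (h x))\<^sup>2)"
proof -
  have fb: "\<bar>f w\<bar> \<le> \<bar>f 0\<bar> + B * \<bar>w\<bar>" for w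
  proof -
    have "norm (f w - f 0) \<le> B * norm (w - 0)"
      by (rule field_differentiable_bound[where S=UNIV and f'=f']) (use df Bf' in auto)
    then show ?thesis by simp
  qed
  have sq2: "(a + b)\<^sup>2 \<le> 2 * a\<^sup>2 + 2 * b\<^sup>2" for a b :: real
    using sum_squares_bound[of a b] by (simp add: power2_sum)
  show "integrable std_gauss (\<lambda>x. (f (h x))\<^sup>2)"
  proof (rule Bochner_Integration.integrable_bound)
    show "integrable std_gauss (\<lambda>x. 2 * (f 0)\<^sup>2 + 2 * (B\<^sup>2 * (h x)\<^sup>2))" using ih by auto
    have "(f (h x))\<^sup>2 \<le> 2 * (f 0)\<^sup>2 + 2 * (B\<^sup>2 * (h x)\<^sup>2)" for x
    proof -
      have "(f (h x))\<^sup>2 = \<bar>f (h x)\<bar>\<^sup>2" by simp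
      also have "\<dots> \<le> (\<bar>f 0\<bar> + B * \<bar>h x\<bar>)\<^sup>2" using fb by (intro power_mono) auto
      also have "\<dots> \<le> 2 * (f 0)\<^sup>2 + 2 * (B\<^sup>2 * (h x)\<^sup>2)"
        using sq2[of "\<bar>f 0\<bar>" "B * \<bar>h x\<bar>"] by (simp add: power_mult_distrib)
      finally show ?thesis .
    qed
    then show "AE x in std_gauss. norm ((f (h x))\<^sup>2) \<le> norm (2 * (f 0)\<^sup>2 + 2 * (B\<^sup>2 * (h x)\<^sup>2))"
      by (intro AE_I2) simp
  qed measurable
qed

text \<open>Collects what the Stein argument requires of \<open>h\<close>, so that the shape of the
  underlying vector enters only when the locale is interpreted. \<open>H x\<close> is the Hessian as
  a linear map; its adjoint appears when \<open>H x v \<bullet> w\<close> is read as a gradient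
  paired with \<open>v\<close>. The fourth moment of \<open>Dh\<close> puts the inner product T into
  L2.\<close>

locale gaussian_functional =
  fixes h :: "'a::euclidean_space \<Rightarrow> real" and Dh :: "'a \<Rightarrow> 'a" and H :: "'a \<Rightarrow> 'a \<Rightarrow> 'a" and K :: real
  assumes dh: "\<And>x. (h has_derivative (\<lambda>v. Dh x \<bullet> v)) (at x)"
    and dDh: "\<And>x. (Dh has_derivative H x) (at x)"
    and cH: "\<And>v. continuous_on UNIV (\<lambda>x. H x v)"
    and ih: "integrable std_gauss (\<lambda>x. (h x)\<^sup>2)"
    and iDh: "integrable std_gauss (\<lambda>x. norm (Dh x) ^ 4)"
    and K0: "0 \<le> K"
    and iK: "\<And>t. 0 < t \<Longrightarrow> t < pi / 2 \<Longrightarrow>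
      integrable std_gauss (\<lambda>z. (norm (adjoint (H (fst z)) (Dh (fst (rot t z)))))\<^sup>2)"
    and K: "\<And>t. 0 < t \<Longrightarrow> t < pi / 2 \<Longrightarrow>
      (\<integral>z. (norm (adjoint (H (fst z)) (Dh (fst (rot t z)))))\<^sup>2 \<partial>std_gauss) \<le> K\<^sup>2"

text \<open>The left-hand side is the covariance of \<open>h\<close> with f(h) - c h, where c is the
  mean of f'(h): the subtracted term accounts for the product of c with the variance of
  \<open>h\<close>. It measures how far \<open>h\<close> is from satisfying the Gaussian identity
  for \<open>f\<close>.\<close>

lemma (in gaussian_functional) second_order_Stein_bound:
  fixes f :: "real \<Rightarrow> real"
  assumes df: "\<And>w. (f has_real_derivative f' w) (at w)" and cf': "continuous_on UNIV f'"
    and Bf': "\<And>w. \<bar>f' w\<bar> \<le> B"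
  shows "\<bar>(\<integral>x. f (h x) * h x \<partial>std_gauss) - (\<integral>x. f (h x) \<partial>std_gauss) * (\<integral>x. h x \<partial>std_gauss) -
     (\<integral>x. f' (h x) \<partial>std_gauss) * ((\<integral>x. (h x)\<^sup>2 \<partial>std_gauss) - (\<integral>x. h x \<partial>std_gauss)\<^sup>2)\<bar> \<le> 2 * B * K"
proof -
  have B0: "0 \<le> B" using Bf'[of 0] by linarith
  have ch: "continuous_on UNIV h" and cDh: "continuous_on UNIV Dh" and cf: "continuous_on UNIV f"
    using dh dDh df by (meson continuous_at_imp_continuous_on has_derivative_continuous DERIV_isCont)+
  have [measurable]: "h \<in> borel_measurable borel" "Dh \<in> borel_measurable borel"
      "f \<in> borel_measurable borel" "f' \<in> borel_measurable borel"
    using ch cDh cf cf' by (auto intro: borel_measurable_continuous_onI)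
  have lin: "linear (H x)" for x using dDh[of x] by (rule has_derivative_linear)
  have iDh2: "integrable std_gauss (\<lambda>x. (norm (Dh x))\<^sup>2)"
  proof (rule std_gauss.square_integrable_imp_integrable)
    show "integrable std_gauss (\<lambda>x. ((norm (Dh x))\<^sup>2)\<^sup>2)" using iDh by (simp add: power_mult[symmetric])
  qed measurable
  have sh: "sobolev h Dh" unfolding sobolev_def using dh cDh ih iDh2 by blast
  have ih1: "integrable std_gauss h" using sobolevD(8)[OF sh] .
  define c where "c = (\<integral>x. f' (h x) \<partial>std_gauss)"
  define F where "F x = f (h x) - c * h x" for x
  define DF where "DF x = (f' (h x) - c) *\<^sub>R Dh x" for x
  have [measurable]: "F \<in> borel_measurable borel" "DF \<in> borel_measurable borel"
    unfolding F_def DF_def by measurable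
  have if2: "integrable std_gauss (\<lambda>x. (f (h x))\<^sup>2)"
    by (rule square_integrable_compose_Lipschitz[OF _ _ ih df Bf']) measurable
  have ifh: "integrable std_gauss (\<lambda>x. f (h x))"
    by (rule std_gauss.square_integrable_imp_integrable[OF _ if2]) measurable
  have ifhh: "integrable std_gauss (\<lambda>x. f (h x) * h x)"
    by (rule Cauchy_Schwarz_integral(1)) (use if2 ih in measurable)
  have sF: "sobolev F DF"
    unfolding sobolev_def
  proof (intro conjI allI)
    show "(F has_derivative (\<lambda>v. DF x \<bullet> v)) (at x)" for x
    proof -
      have "((\<lambda>x. f (h x)) has_derivative (\<lambda>v. f' (h x) * (Dh x \<bullet> v))) (at x)"
        using has_derivative_compose[OF dh df[unfolded has_field_derivative_def]] by simp
      from has_derivative_diff[OF this has_derivative_mult_right[OF dh, of c]] show ?thesis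
        unfolding F_def[abs_def] DF_def by (simp add: left_diff_distrib)
    qed
    show "continuous_on UNIV DF"
      unfolding DF_def by (intro continuous_intros continuous_on_compose2[OF cf'] ch cDh) auto
    have "integrable std_gauss (\<lambda>x. (f (h x))\<^sup>2 - 2 * c * (f (h x) * h x) + c\<^sup>2 * (h x)\<^sup>2)"
      using if2 ifhh ih by auto
    then show "integrable std_gauss (\<lambda>x. (F x)\<^sup>2)"
      by (simp add: F_def power2_diff power_mult_distrib algebra_simps)
    show "integrable std_gauss (\<lambda>x. (norm (DF x))\<^sup>2)"
    proof (rule Bochner_Integration.integrable_bound)
      show "integrable std_gauss (\<lambda>x. (B + \<bar>c\<bar>)\<^sup>2 * (norm (Dh x))\<^sup>2)" using iDh2 by auto
      have "norm (DF x) \<le> (B + \<bar>c\<bar>) * norm (Dh x)" for x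
        unfolding DF_def norm_scaleR using Bf'[of "h x"] by (intro mult_right_mono) auto
      then show "AE x in std_gauss. norm ((norm (DF x))\<^sup>2) \<le> norm ((B + \<bar>c\<bar>)\<^sup>2 * (norm (Dh x))\<^sup>2)"
        by (intro AE_I2) (simp add: power_mult_distrib[symmetric] power_mono)
    qed measurable
  qed
  have "\<bar>(\<integral>x. F x * h x \<partial>std_gauss) - (\<integral>x. F x \<partial>std_gauss) * (\<integral>x. h x \<partial>std_gauss)\<bar> \<le> 2 * B * K"
  proof (rule std_gauss_covariance_bound[OF sF sh])
    fix t :: real assume t: "0 < t" "t < pi / 2"
    have st: "sin t \<noteq> 0" using sin_gt_zero2[OF t] by simp
    define T where "T z = Dh (fst z) \<bullet> Dh (fst (rot t z))" for z
    define a where "a z = adjoint (H (fst z)) (Dh (fst (rot t z)))" for z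
    define b where "b z = adjoint (H (fst (rot t z))) (Dh (fst z))" for z
    \<comment> \<open>Gradient of \<open>T\<close> on the doubled space. The first copy enters
      directly (\<open>a\<close>) and through the rotated argument with weight cos t; the second
      copy enters only through the latter, with weight sin t.\<close>
    define DT where "DT z = (a z + cos t *\<^sub>R b z, sin t *\<^sub>R b z)" for z
    have crot: "continuous_on UNIV (\<lambda>z. fst (rot t z))" by (intro continuous_intros continuous_rot)
    have cfst: "continuous_on UNIV (fst :: 'a \<times> 'a \<Rightarrow> 'a)" by (intro continuous_intros)
    have ca: "continuous_on UNIV a" and cb: "continuous_on UNIV b"
      unfolding a_def b_def
      by (intro continuous_on_adjoint lin continuous_on_compose2[OF cDh] continuous_on_compose2[OF cH] crot cfst; auto)+
    have [measurable]: "a \<in> borel_measurable borel" "b \<in> borel_measurable borel" "T \<in> borel_measurable borel"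
      using ca cb by (auto intro: borel_measurable_continuous_onI simp: T_def[abs_def])
    have ia: "integrable std_gauss (\<lambda>z. (norm (a z))\<^sup>2)" and Ka: "(\<integral>z. (norm (a z))\<^sup>2 \<partial>std_gauss) \<le> K\<^sup>2"
      using iK[OF t] K[OF t] by (simp_all add: a_def)
    have am: "(\<lambda>z. (norm (a z))\<^sup>2) \<in> borel_measurable borel" by measurable
    note reflect = std_gauss_reflect[OF am t]
    have ib: "integrable std_gauss (\<lambda>z. (norm (b z))\<^sup>2)" and Kb: "(\<integral>z. (norm (b z))\<^sup>2 \<partial>std_gauss) \<le> K\<^sup>2"
      using reflect(3,4) ia Ka unfolding a_def b_def reflect(1,2) by simp_all
    have n4: "integrable std_gauss (\<lambda>z::'a\<times>'a. norm (Dh (fst z)) ^ 4)"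
      using std_gauss_proj(2)[of "\<lambda>x. norm (Dh x) ^ 4"] iDh by simp
    have n4': "integrable std_gauss (\<lambda>z. norm (Dh (fst (rot t z))) ^ 4)"
      using std_gauss_rot(2)[of "\<lambda>z. norm (Dh (fst z)) ^ 4" t] n4 st by simp
    \<comment> \<open>The two contributions of \<open>b\<close> recombine by cos^2 + sin^2 = 1; the
      cross term is then split evenly, so no dependence on t remains.\<close>
    have DTb: "(norm (DT z))\<^sup>2 \<le> 2 * (norm (a z))\<^sup>2 + 2 * (norm (b z))\<^sup>2" for z
    proof -
      have "(norm (DT z))\<^sup>2 = (norm (a z + cos t *\<^sub>R b z))\<^sup>2 + (norm (sin t *\<^sub>R b z))\<^sup>2"
        by (simp add: DT_def norm_prod_def)
      also have "\<dots> = (norm (a z))\<^sup>2 + 2 * cos t * (a z \<bullet> b z) + ((cos t)\<^sup>2 + (sin t)\<^sup>2) * (norm (b z))\<^sup>2"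
        unfolding power2_norm_eq_inner by (simp add: inner_add inner_commute algebra_simps power2_eq_square
            del: sin_cos_squared_add sin_cos_squared_add2 sin_cos_squared_add3)
      also have "\<dots> = (norm (a z))\<^sup>2 + 2 * (cos t * (a z \<bullet> b z)) + (norm (b z))\<^sup>2" by simp
      also have "cos t * (a z \<bullet> b z) \<le> 1 * (norm (a z) * norm (b z))"
      proof (rule order_trans[OF abs_ge_self])
        show "\<bar>cos t * (a z \<bullet> b z)\<bar> \<le> 1 * (norm (a z) * norm (b z))"
          unfolding abs_mult by (intro mult_mono Cauchy_Schwarz_ineq2) auto
      qed
      finally show ?thesis
        using sum_squares_bound[of "norm (a z)" "norm (b z)"] by simp
    qed
    have sT: "sobolev T DT"
      unfolding sobolev_def
    proof (intro conjI allI)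
      show "(T has_derivative (\<lambda>v. DT z \<bullet> v)) (at z)" for z
      proof -
        have 1: "((\<lambda>z. Dh (fst z)) has_derivative (\<lambda>v. H (fst z) (fst v))) (at z)"
          by (rule has_derivative_compose[OF _ dDh]) (auto intro!: derivative_eq_intros)
        have 2: "((\<lambda>z. Dh (fst (rot t z))) has_derivative (\<lambda>v. H (fst (rot t z)) (fst (rot t v)))) (at z)"
          by (rule has_derivative_compose[OF _ dDh]) (auto simp: rot_def intro!: derivative_eq_intros)
        have "DT z \<bullet> v = Dh (fst z) \<bullet> H (fst (rot t z)) (fst (rot t v)) + H (fst z) (fst v) \<bullet> Dh (fst (rot t z))" for v
        proof -
          have "Dh (fst z) \<bullet> H (fst (rot t z)) (fst (rot t v)) = fst (rot t v) \<bullet> b z"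
            unfolding b_def adjoint_works[OF lin] by (rule inner_commute)
          moreover have "H (fst z) (fst v) \<bullet> Dh (fst (rot t z)) = fst v \<bullet> a z"
            unfolding a_def adjoint_works[OF lin] ..
          ultimately show ?thesis
            by (simp add: DT_def rot_def inner_prod_def inner_add inner_commute)
        qed
        with has_derivative_inner[OF 1 2] show ?thesis
          unfolding T_def[abs_def] by simp
      qed
      show "continuous_on UNIV DT"
        unfolding DT_def by (intro continuous_intros ca cb)
      show "integrable std_gauss (\<lambda>z. (T z)\<^sup>2)"
      proof (rule Bochner_Integration.integrable_bound)
        show "integrable std_gauss (\<lambda>z. norm (Dh (fst z)) ^ 4 + norm (Dh (fst (rot t z))) ^ 4)"
          using n4 n4' by auto
        have "(T z)\<^sup>2 \<le> norm (Dh (fst z)) ^ 4 + norm (Dh (fst (rot t z))) ^ 4" for z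
        proof -
          let ?u = "(norm (Dh (fst z)))\<^sup>2" and ?v = "(norm (Dh (fst (rot t z))))\<^sup>2"
          have "(T z)\<^sup>2 \<le> ?u * ?v"
            unfolding T_def power_mult_distrib[symmetric]
            by (rule power2_le_iff_abs_le[THEN iffD2]) (auto simp: Cauchy_Schwarz_ineq2)
          also have "\<dots> \<le> ?u\<^sup>2 + ?v\<^sup>2"
          proof -
            have "0 \<le> ?u * ?v" by simp
            with sum_squares_bound[of ?u ?v] show ?thesis by (simp only: mult.assoc)
          qed
          finally show ?thesis by (simp add: power_mult[symmetric])
        qed
        then show "AE z in std_gauss. norm ((T z)\<^sup>2) \<le> norm (norm (Dh (fst z)) ^ 4 + norm (Dh (fst (rot t z))) ^ 4)"
          by (intro AE_I2) simp
      qed measurable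
      show "integrable std_gauss (\<lambda>z. (norm (DT z))\<^sup>2)"
      proof (rule Bochner_Integration.integrable_bound)
        show "integrable std_gauss (\<lambda>z. 2 * (norm (a z))\<^sup>2 + 2 * (norm (b z))\<^sup>2)" using ia ib by auto
        show "AE z in std_gauss. norm ((norm (DT z))\<^sup>2) \<le> norm (2 * (norm (a z))\<^sup>2 + 2 * (norm (b z))\<^sup>2)"
          using DTb by (intro AE_I2) simp
      qed (auto simp: DT_def)
    qed
    note T = sobolevD[OF sT]
    define m where "m = (\<integral>z. T z \<partial>std_gauss)"
    have "(\<integral>z. (T z - m)\<^sup>2 \<partial>std_gauss) = (\<integral>z. (T z)\<^sup>2 \<partial>std_gauss) - m\<^sup>2"
      unfolding m_def by (rule std_gauss.variance_eq[OF T(8,4)])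
    also have "\<dots> \<le> (\<integral>z. (norm (DT z))\<^sup>2 \<partial>std_gauss)"
      unfolding m_def by (rule Gaussian_Poincare[OF sT])
    also have "\<dots> \<le> (\<integral>z. 2 * (norm (a z))\<^sup>2 + 2 * (norm (b z))\<^sup>2 \<partial>std_gauss)"
      by (rule integral_mono) (use T(5) ia ib DTb in auto)
    also have "\<dots> \<le> (2 * K)\<^sup>2" using ia ib Ka Kb by (simp add: power_mult_distrib)
    finally have sT2: "sqrt (\<integral>z. (T z - m)\<^sup>2 \<partial>std_gauss) \<le> 2 * K" using K0 by (intro real_le_lsqrt) auto
    have sf': "sqrt (\<integral>z. (f' (h (fst z)))\<^sup>2 \<partial>(std_gauss :: ('a\<times>'a) measure)) \<le> B"
    proof -
      have "(\<integral>z. (f' (h (fst z)))\<^sup>2 \<partial>(std_gauss :: ('a\<times>'a) measure)) \<le> B\<^sup>2"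
        by (rule std_gauss.integral_le_const)
           (use Bf' B0 in \<open>auto intro!: integrable_bounded_std_gauss[of _ "B\<^sup>2"] AE_I2 simp: abs_le_square_iff[symmetric]\<close>)
      then show ?thesis using B0 by (intro real_le_lsqrt) auto
    qed
    have if': "integrable std_gauss (\<lambda>z::'a\<times>'a. f' (h (fst z)))"
      using Bf' by (intro integrable_bounded_std_gauss[of _ B]) auto
    have if'2: "integrable std_gauss (\<lambda>z::'a\<times>'a. (f' (h (fst z)))\<^sup>2)"
      using Bf' B0 by (intro integrable_bounded_std_gauss[of _ "B\<^sup>2"]) (auto simp: abs_le_square_iff[symmetric])
    have iTm: "integrable std_gauss (\<lambda>z. (T z - m)\<^sup>2)"
      using T(4,8) by (simp add: power2_diff)
    have f'T: "integrable std_gauss (\<lambda>z. f' (h (fst z)) * (T z - m))"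
      "\<bar>\<integral>z. f' (h (fst z)) * (T z - m) \<partial>std_gauss\<bar> \<le>
        sqrt (\<integral>z. (f' (h (fst z)))\<^sup>2 \<partial>(std_gauss :: ('a\<times>'a) measure)) * sqrt (\<integral>z. (T z - m)\<^sup>2 \<partial>std_gauss)"
      by (rule Cauchy_Schwarz_integral; use if'2 iTm in measurable)+
    \<comment> \<open>The last bracket integrates to m c - c m = 0: since f' - c is centred, the
      mean \<open>m\<close> may be subtracted from \<open>T\<close>.\<close>
    have "(\<integral>z. DF (fst z) \<bullet> Dh (fst (rot t z)) \<partial>std_gauss) =
        (\<integral>z. f' (h (fst z)) * (T z - m) + (m * f' (h (fst z)) - c * T z) \<partial>std_gauss)"
      by (simp add: DF_def T_def algebra_simps)
    also have "\<dots> = (\<integral>z. f' (h (fst z)) * (T z - m) \<partial>std_gauss)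
        + (m * (\<integral>z. f' (h (fst z)) \<partial>(std_gauss :: ('a\<times>'a) measure)) - c * (\<integral>z. T z \<partial>std_gauss))"
      using f'T(1) if' T(8) by simp
    also have "(\<integral>z. f' (h (fst z)) \<partial>(std_gauss :: ('a\<times>'a) measure)) = c"
      unfolding c_def by (rule std_gauss_proj(1)) measurable
    finally have "(\<integral>z. DF (fst z) \<bullet> Dh (fst (rot t z)) \<partial>std_gauss) = (\<integral>z. f' (h (fst z)) * (T z - m) \<partial>std_gauss)"
      by (simp add: m_def)
    then have "\<bar>\<integral>z. DF (fst z) \<bullet> Dh (fst (rot t z)) \<partial>std_gauss\<bar> \<le>
        sqrt (\<integral>z. (f' (h (fst z)))\<^sup>2 \<partial>(std_gauss :: ('a\<times>'a) measure)) * sqrt (\<integral>z. (T z - m)\<^sup>2 \<partial>std_gauss)"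
      using f'T(2) by simp
    also have "\<dots> \<le> B * (2 * K)"
      using sT2 sf' B0 by (intro mult_mono) auto
    finally show "\<bar>\<integral>z. DF (fst z) \<bullet> Dh (fst (rot t z)) \<partial>std_gauss\<bar> \<le> 2 * B * K" by simp
  qed
  also have "(\<integral>x. F x * h x \<partial>std_gauss) = (\<integral>x. f (h x) * h x - c * (h x)\<^sup>2 \<partial>std_gauss)"
    by (simp add: F_def algebra_simps power2_eq_square)
  also have "\<dots> = (\<integral>x. f (h x) * h x \<partial>std_gauss) - c * (\<integral>x. (h x)\<^sup>2 \<partial>std_gauss)"
    using ifhh ih by simp
  also have "(\<integral>x. F x \<partial>std_gauss) = (\<integral>x. f (h x) \<partial>std_gauss) - c * (\<integral>x. h x \<partial>std_gauss)"
    unfolding F_def using ifh ih1 by simp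
  finally show ?thesis
    unfolding c_def by (simp add: algebra_simps power2_eq_square)
qed

section \<open>Stein's equation and total variation\<close>

lemma has_real_derivative_gauss_density:
  "((gauss_density :: real \<Rightarrow> real) has_real_derivative - (x * gauss_density x)) (at x)"
  using has_derivative_gauss_density[of x] unfolding has_field_derivative_def
  by (rule has_derivative_eq_rhs) (auto simp: mult.commute mult.left_commute)

lemma gauss_density_real_eq: "gauss_density (x::real) = std_normal_density x"
  by (simp add: gauss_density_def std_normal_density_def)

lemma integrable_gauss_density: "integrable lborel (gauss_density :: 'a::euclidean_space \<Rightarrow> real)"
  using integral_std_gauss(2)[of "\<lambda>_::'a. 1"] by simp

text \<open>Mills ratio bound: on [x, \<infinity>) the factor 1 is at most t / x, and t times the
  density is the derivative of minus the density.\<close>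

lemma gauss_density_tail:
  fixes x :: real
  assumes "0 < x"
  shows "(\<integral>\<^sup>+t. ennreal (gauss_density t) * indicator {x..} t \<partial>lborel) \<le> ennreal (gauss_density x / x)"
proof -
  have lim: "((\<lambda>t::real. - gauss_density t) \<longlongrightarrow> - 0) at_top"
  proof (intro tendsto_minus)
    have "filterlim (\<lambda>x::real. 1 / 2 * x ^ 2) at_top at_top"
      by (intro filterlim_tendsto_pos_mult_at_top[OF tendsto_const] filterlim_pow_at_top filterlim_ident) auto
    then have "((\<lambda>x::real. exp (- (1 / 2 * x ^ 2))) \<longlongrightarrow> 0) at_top"
      by (intro filterlim_compose[OF exp_at_bot]) (simp add: filterlim_uminus_at_top[symmetric] del: filterlim_uminus_at_top)
    from tendsto_mult_left[OF this, of "1 / sqrt (2 * pi)"]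
    show "((gauss_density :: real \<Rightarrow> real) \<longlongrightarrow> 0) at_top"
      by (simp add: gauss_density_def[abs_def])
  qed
  have "(\<integral>\<^sup>+t. ennreal (t * gauss_density t) * indicator {x..} t \<partial>lborel) = ennreal (- 0 - (- gauss_density x))"
    using assms
    by (intro nn_integral_FTC_atLeast lim)
       (auto intro!: derivative_eq_intros has_real_derivative_gauss_density)
  then have eq: "(\<integral>\<^sup>+t. ennreal (t * gauss_density t) * indicator {x..} t \<partial>lborel) = ennreal (gauss_density x)"
    by simp
  have "(\<integral>\<^sup>+t. ennreal (gauss_density t) * indicator {x..} t \<partial>lborel)
    \<le> (\<integral>\<^sup>+t. ennreal (1 / x) * (ennreal (t * gauss_density t) * indicator {x..} t) \<partial>lborel)"
  proof (rule nn_integral_mono)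
    fix t :: real
    show "ennreal (gauss_density t) * indicator {x..} t \<le> ennreal (1 / x) * (ennreal (t * gauss_density t) * indicator {x..} t)"
    proof (cases "x \<le> t")
      case True
      then have "gauss_density t * 1 \<le> gauss_density t * (t / x)"
        using assms by (intro mult_left_mono) auto
      then have "gauss_density t \<le> 1 / x * (t * gauss_density t)" by (simp add: mult.commute)
      then show ?thesis using True assms by (simp add: ennreal_mult[symmetric])
    qed auto
  qed
  also have "\<dots> = ennreal (gauss_density x / x)"
    using assms by (subst nn_integral_cmult) (auto simp: eq ennreal_mult[symmetric])
  finally show ?thesis .
qed

lemma gauss_density_tail_neg:
  fixes x :: real
  assumes "x < 0"
  shows "(\<integral>\<^sup>+t. ennreal (gauss_density t) * indicator {..x} t \<partial>lborel) \<le> ennreal (gauss_density x / \<bar>x\<bar>)"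
proof -
  have g: "gauss_density (- t) = gauss_density t" for t :: real by (simp add: gauss_density_def)
  have "(\<integral>\<^sup>+t. ennreal (gauss_density t) * indicator {..x} t \<partial>lborel)
     = (\<integral>\<^sup>+t. ennreal (gauss_density (0 + -1 * t)) * indicator {..x} (0 + -1 * t) \<partial>lborel)"
    by (subst nn_integral_real_affine[of _ "-1" 0]) auto
  also have "\<dots> = (\<integral>\<^sup>+t. ennreal (gauss_density t) * indicator {-x..} t \<partial>lborel)"
    by (intro nn_integral_cong) (auto simp: g split: split_indicator)
  also have "\<dots> \<le> ennreal (gauss_density (- x) / (- x))"
    using assms by (intro gauss_density_tail) auto
  finally show ?thesis using assms by (simp add: g)
qed

lemma abs_integral_indicator_le:
  fixes q p :: "real \<Rightarrow> real"
  assumes [measurable]: "p \<in> borel_measurable borel" "A \<in> sets borel"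
    and qp: "\<And>t. \<bar>q t\<bar> \<le> p t" and le: "(\<integral>\<^sup>+t. ennreal (p t) * indicator A t \<partial>lborel) \<le> ennreal r"
    and i: "integrable lborel p" and r: "0 \<le> r"
  shows "\<bar>\<integral>t. q t * indicator A t \<partial>lborel\<bar> \<le> r"
proof -
  have p0: "0 \<le> p t" for t using qp[of t] by linarith
  have ip: "integrable lborel (\<lambda>t. p t * indicator A t)" by (intro integrable_real_mult_indicator i) auto
  have "\<bar>\<integral>t. q t * indicator A t \<partial>lborel\<bar> \<le> (\<integral>t. p t * indicator A t \<partial>lborel)"
  proof (cases "integrable lborel (\<lambda>t. q t * indicator A t)")
    case True
    have "norm (\<integral>t. q t * indicator A t \<partial>lborel) \<le> (\<integral>t. p t * indicator A t \<partial>lborel)"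
      by (rule Bochner_Integration.integral_norm_bound_integral[OF True ip]) (auto simp: qp split: split_indicator)
    then show ?thesis by simp
  next
    \<comment> \<open>A Bochner integral of a non-integrable function is 0 by convention, so the
      estimate holds here too.\<close>
    case False
    then show ?thesis using p0 by (simp add: not_integrable_integral_eq)
  qed
  also have "\<dots> \<le> r"
  proof -
    have "ennreal (\<integral>t. p t * indicator A t \<partial>lborel) = (\<integral>\<^sup>+t. ennreal (p t * indicator A t) \<partial>lborel)"
      by (rule nn_integral_eq_integral[OF ip, symmetric]) (auto simp: p0)
    also have "\<dots> = (\<integral>\<^sup>+t. ennreal (p t) * indicator A t \<partial>lborel)"
      by (intro nn_integral_cong) (auto split: split_indicator)
    also note le
    finally show ?thesis using r by simp
  qed
  finally show ?thesis .
qed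

text \<open>The solution is the integral up to x of the centred test function against the density,
  divided by the density. Both tails obey the Mills bound, so x f(x) is at most 1 in absolute value;
  the centred test function adds at most 1 more, which is the origin of the bound 2.\<close>

lemma Stein_equation_solution:
  fixes \<phi> :: "real \<Rightarrow> real"
  assumes c\<phi>: "continuous_on UNIV \<phi>" and \<phi>0: "\<And>x. 0 \<le> \<phi> x" and \<phi>1: "\<And>x. \<phi> x \<le> 1"
  obtains f f' :: "real \<Rightarrow> real"
  where "\<And>x. (f has_real_derivative f' x) (at x)" "continuous_on UNIV f'" "\<And>x. \<bar>f' x\<bar> \<le> 2"
    "\<And>x. f' x - x * f x = \<phi> x - (\<integral>x. \<phi> x \<partial>std_gauss)"
proof -
  let ?p = "gauss_density :: real \<Rightarrow> real"
  define a where "a = (\<integral>x. \<phi> x \<partial>std_gauss)"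
  have [measurable]: "\<phi> \<in> borel_measurable borel" using c\<phi> by (rule borel_measurable_continuous_onI)
  have i\<phi>: "integrable std_gauss \<phi>"
    using \<phi>0 \<phi>1 by (intro integrable_bounded_std_gauss[of _ 1]) auto
  have a: "0 \<le> a" "a \<le> 1"
    unfolding a_def using \<phi>0 \<phi>1 i\<phi> by (auto intro: integral_nonneg std_gauss.integral_le_const)
  define q where "q x = (\<phi> x - a) * ?p x" for x
  have cq: "continuous_on UNIV q"
    unfolding q_def by (intro continuous_intros c\<phi> continuous_gauss_density)
  have [measurable]: "q \<in> borel_measurable borel" using cq by (rule borel_measurable_continuous_onI)
  have \<phi>a: "\<bar>\<phi> x - a\<bar> \<le> 1" for x using \<phi>0[of x] \<phi>1[of x] a by (auto simp: abs_le_iff)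
  have qp: "\<bar>q x\<bar> \<le> ?p x" for x
    unfolding q_def abs_mult using \<phi>a[of x] mult_right_mono[of "\<bar>\<phi> x - a\<bar>" 1 "?p x"] by simp
  have iq: "integrable lborel q"
    by (rule Bochner_Integration.integrable_bound[OF integrable_gauss_density]) (use qp in auto)
  have q0: "(\<integral>x. q x \<partial>lborel) = 0"
  proof -
    have "(\<integral>x. q x \<partial>lborel) = (\<integral>x. \<phi> x - a \<partial>std_gauss)"
      by (subst integral_std_gauss(1)) (auto simp: q_def[abs_def] mult.commute)
    also have "\<dots> = 0" using i\<phi> std_gauss.prob_space[where 'a=real] by (simp add: a_def)
    finally show ?thesis .
  qed
  define Q where "Q x = (\<integral>t. q t * indicator {..x} t \<partial>lborel)" for x
  \<comment> \<open>\<open>Q\<close> is an integral over a half-line. It is compared with an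
    antiderivative \<open>Q0\<close>, from which it differs by the constant \<open>d\<close>, and
    inherits its derivative.\<close>
  obtain Q0 where Q0: "\<And>x. (Q0 has_real_derivative q x) (at x)"
    using einterval_antiderivative[of "-\<infinity>" "\<infinity>" q] cq
    unfolding has_real_derivative_iff_has_vector_derivative
    by (auto simp: continuous_on_eq_continuous_at)
  have QQ0: "Q x - Q y = Q0 x - Q0 y" if "y \<le> x" for x y
  proof -
    have "Q x - Q y = (\<integral>t. q t * indicator {..x} t - q t * indicator {..y} t \<partial>lborel)"
      unfolding Q_def using iq by (intro Bochner_Integration.integral_diff[symmetric] integrable_real_mult_indicator) auto
    also have "\<dots> = (\<integral>t. q t * indicator {y..x} t \<partial>lborel)"
      using AE_lborel_singleton[of y] that
      by (intro integral_cong_AE) (auto elim!: eventually_mono split: split_indicator)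
    also have "\<dots> = Q0 x - Q0 y"
      using that Q0 cq by (intro integral_FTC_Icc_real) (auto simp: continuous_on_eq_continuous_at)
    finally show ?thesis .
  qed
  define d where "d = Q 0 - Q0 0"
  have QQ: "Q x = Q0 x + d" for x
    using QQ0[of x 0] QQ0[of 0 x] by (cases "x \<le> 0") (auto simp: d_def)
  have dQ: "(Q has_real_derivative q x) (at x)" for x
    unfolding QQ[abs_def] using Q0[of x] by (auto intro!: derivative_eq_intros)
  have tail: "\<bar>x * Q x\<bar> \<le> ?p x" for x
  proof -
    consider "x < 0" | "x = 0" | "0 < x" by linarith
    then show ?thesis
    proof cases
      case 1
      have "\<bar>Q x\<bar> \<le> ?p x / \<bar>x\<bar>"
        unfolding Q_def
        by (rule abs_integral_indicator_le[OF _ _ qp gauss_density_tail_neg[OF 1] integrable_gauss_density]) auto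
      then show ?thesis using 1 by (simp add: abs_mult field_simps)
    next
      case 3
      \<comment> \<open>For positive x the lower integral is traded for the upper tail; this is
        where the vanishing total integral of \<open>q\<close>, that is the centring by
        \<open>a\<close>, is used.\<close>
      have "Q x = (\<integral>t. q t - q t * indicator {x..} t \<partial>lborel)"
        unfolding Q_def using AE_lborel_singleton[of x]
        by (intro integral_cong_AE) (auto elim!: eventually_mono split: split_indicator)
      also have "\<dots> = - (\<integral>t. q t * indicator {x..} t \<partial>lborel)"
        using iq q0 by (subst Bochner_Integration.integral_diff) (auto intro: integrable_real_mult_indicator)
      finally have "\<bar>Q x\<bar> = \<bar>\<integral>t. q t * indicator {x..} t \<partial>lborel\<bar>" by simp
      also have "\<dots> \<le> ?p x / x"
        by (rule abs_integral_indicator_le[OF _ _ qp gauss_density_tail[OF 3] integrable_gauss_density]) (use 3 in auto)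
      finally show ?thesis using 3 by (simp add: abs_mult field_simps)
    qed simp
  qed
  define f where "f x = Q x / ?p x" for x
  \<comment> \<open>Stein's equation itself is taken as the definition of \<open>f'\<close>, which
    makes continuity and the bound immediate; that it is the derivative is checked below.\<close>
  define f' where "f' x = (\<phi> x - a) + x * f x" for x
  have pos: "0 < ?p x" for x by (rule gauss_density_pos)
  show ?thesis
  proof (rule that[of f f'])
    show df: "(f has_real_derivative f' x) (at x)" for x
    proof -
      have "((\<lambda>x. Q x / ?p x) has_real_derivative (q x * ?p x - Q x * - (x * ?p x)) / (?p x * ?p x)) (at x)"
        using pos[of x] by (intro DERIV_divide dQ has_real_derivative_gauss_density) auto
      also have "(q x * ?p x - Q x * - (x * ?p x)) / (?p x * ?p x) = f' x"
        using pos[of x] by (simp add: f'_def f_def q_def field_simps)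
      finally show ?thesis by (simp add: f_def[abs_def])
    qed
    have "continuous_on UNIV f"
      by (rule continuous_at_imp_continuous_on) (blast intro: DERIV_isCont df)
    then show "continuous_on UNIV f'"
      unfolding f'_def by (intro continuous_intros c\<phi>)
    show "\<bar>f' x\<bar> \<le> 2" for x
    proof -
      have "\<bar>x * f x\<bar> = \<bar>x * Q x\<bar> / ?p x" using pos[of x] by (simp add: f_def abs_mult)
      also have "\<dots> \<le> 1" using tail[of x] pos[of x] by simp
      finally show ?thesis using \<phi>a[of x] unfolding f'_def by linarith
    qed
    show "f' x - x * f x = \<phi> x - (\<integral>x. \<phi> x \<partial>std_gauss)" for x
      by (simp add: f'_def a_def)
  qed
qed

section \<open>From continuous test functions to Borel sets\<close>

lemma closed_indicator_approx:
  fixes A :: "'a::metric_space set"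
  assumes "closed A"
  obtains \<phi> :: "nat \<Rightarrow> 'a \<Rightarrow> real"
  where "\<And>k. continuous_on UNIV (\<phi> k)" "\<And>k x. 0 \<le> \<phi> k x" "\<And>k x. \<phi> k x \<le> 1"
    "\<And>x. (\<lambda>k. \<phi> k x) \<longlonglongrightarrow> indicator A x"
\<comment> \<open>\<open>infdist\<close> to the empty set is 0 by convention, so the ramp used below
  would be constantly 1 there.\<close>
proof (cases "A = {}")
  case True
  then show ?thesis by (intro that[of "\<lambda>_ _. 0"]) auto
next
  case False
  define \<phi> where "\<phi> k x = max 0 (1 - real k * infdist x A)" for k x
  show ?thesis
  proof (rule that[of \<phi>])
    show "continuous_on UNIV (\<phi> k)" for k unfolding \<phi>_def by (intro continuous_intros)
    show "(\<lambda>k. \<phi> k x) \<longlonglongrightarrow> indicator A x" for x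
    proof (cases "x \<in> A")
      case True
      then show ?thesis by (simp add: \<phi>_def)
    next
      case xA: False
      then have pos: "0 < infdist x A"
        using assms False infdist_nonneg[of x A] in_closed_iff_infdist_zero[of A x] by fastforce
      then obtain N :: nat where N: "1 < real N * infdist x A" using ex_less_of_nat_mult by blast
      have "\<phi> k x = 0" if "N \<le> k" for k
      proof -
        have "real N * infdist x A \<le> real k * infdist x A" using that by (intro mult_right_mono infdist_nonneg) auto
        then show ?thesis using N by (simp add: \<phi>_def)
      qed
      then show ?thesis using xA by (intro tendsto_eventually eventually_sequentiallyI[of N]) auto
    qed
  qed (auto simp: \<phi>_def infdist_nonneg)
qed

lemma (in finite_measure) integral_tendsto_measure:
  fixes \<phi> :: "nat \<Rightarrow> 'a \<Rightarrow> real"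
  assumes A: "A \<in> sets M" and [measurable]: "\<And>k. \<phi> k \<in> borel_measurable M"
    and "\<And>k x. 0 \<le> \<phi> k x" "\<And>k x. \<phi> k x \<le> 1" "\<And>x. (\<lambda>k. \<phi> k x) \<longlonglongrightarrow> indicator A x"
  shows "(\<lambda>k. \<integral>x. \<phi> k x \<partial>M) \<longlonglongrightarrow> measure M A"
proof -
  have "(\<lambda>k. \<integral>x. \<phi> k x \<partial>M) \<longlonglongrightarrow> (\<integral>x. indicator A x \<partial>M)"
    by (rule integral_dominated_convergence[where w="\<lambda>_. 1"]) (use assms in auto)
  then show ?thesis using A by simp
qed

text \<open>Distance ramps decrease to the indicator of a closed set, which settles closed sets with
  the same constant; Borel sets follow by inner regularity, up to an arbitrary
  \<open>e\<close>.\<close>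

lemma measure_diff_le_of_continuous_tests:
  fixes \<mu> \<nu> :: "'a::polish_space measure"
  assumes "prob_space \<mu>" "prob_space \<nu>" and s: "sets \<mu> = sets borel" "sets \<nu> = sets borel"
    and tests: "\<And>\<phi>. continuous_on UNIV \<phi> \<Longrightarrow> (\<And>x. 0 \<le> \<phi> x) \<Longrightarrow> (\<And>x. \<phi> x \<le> 1) \<Longrightarrow>
      \<bar>(\<integral>x. \<phi> x \<partial>\<mu>) - (\<integral>x. \<phi> x \<partial>\<nu>)\<bar> \<le> (C::real)"
    and B: "B \<in> sets borel"
  shows "\<bar>measure \<mu> B - measure \<nu> B\<bar> \<le> C"
proof -
  interpret \<mu>: prob_space \<mu> by fact
  interpret \<nu>: prob_space \<nu> by fact
  note [measurable_cong] = s
  have cl: "\<bar>measure \<mu> A - measure \<nu> A\<bar> \<le> C" if A: "closed A" for A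
  proof -
    obtain \<phi> :: "nat \<Rightarrow> 'a \<Rightarrow> real" where \<phi>: "\<And>k. continuous_on UNIV (\<phi> k)" "\<And>k x. 0 \<le> \<phi> k x" "\<And>k x. \<phi> k x \<le> 1"
      "\<And>x. (\<lambda>k. \<phi> k x) \<longlonglongrightarrow> indicator A x"
      using closed_indicator_approx[OF A] by blast
    have [measurable]: "\<phi> k \<in> borel_measurable borel" for k using \<phi>(1) by (rule borel_measurable_continuous_onI)
    have "A \<in> sets \<mu>" "A \<in> sets \<nu>" using A s by auto
    then have "(\<lambda>k. \<bar>(\<integral>x. \<phi> k x \<partial>\<mu>) - (\<integral>x. \<phi> k x \<partial>\<nu>)\<bar>) \<longlonglongrightarrow> \<bar>measure \<mu> A - measure \<nu> A\<bar>"
      by (intro tendsto_intros \<mu>.integral_tendsto_measure \<nu>.integral_tendsto_measure \<phi>) auto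
    then show ?thesis
      by (rule LIMSEQ_le_const2) (use tests \<phi> in auto)
  qed
  show ?thesis
  proof (rule field_le_epsilon)
    fix e :: real assume e: "0 < e"
    have approx: "\<exists>K. K \<subseteq> B \<and> closed K \<and> measure m B - e \<le> measure m K"
      if "prob_space m" "sets m = sets borel" for m :: "'a measure"
    proof -
      interpret m: prob_space m by fact
      show ?thesis
      \<comment> \<open>\<open>ennreal\<close> truncates negative numbers to 0, so strict
        inequalities transfer only when the difference is nonnegative; otherwise the empty set will
        do.\<close>
      proof (cases "measure m B - e < 0")
        case True
        then show ?thesis by (intro exI[of _ "{}"]) auto
      next
        case False
        have "ennreal (measure m B - e) < emeasure m B"
          using e False by (simp add: m.emeasure_eq_measure ennreal_less_iff)
        also have "emeasure m B = (SUP K \<in> {K. K \<subseteq> B \<and> compact K}. emeasure m K)"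
          by (rule inner_regular[OF that(2) _ B]) simp
        finally obtain K where "K \<subseteq> B" "compact K" "ennreal (measure m B - e) < emeasure m K"
          unfolding less_SUP_iff by auto
        then show ?thesis
          using False by (intro exI[of _ K]) (auto simp: compact_imp_closed m.emeasure_eq_measure ennreal_less_iff)
      qed
    qed
    obtain K1 where K1: "K1 \<subseteq> B" "closed K1" "measure \<mu> B - e \<le> measure \<mu> K1" using approx[of \<mu>] assms by auto
    obtain K2 where K2: "K2 \<subseteq> B" "closed K2" "measure \<nu> B - e \<le> measure \<nu> K2" using approx[of \<nu>] assms by auto
    \<comment> \<open>The union stays inside \<open>B\<close> and is closed, so one set approximates
      \<open>B\<close> from within for both measures at once.\<close>
    have K: "\<bar>measure \<mu> (K1 \<union> K2) - measure \<nu> (K1 \<union> K2)\<bar> \<le> C" using K1 K2 by (intro cl) auto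
    have "measure \<mu> K1 \<le> measure \<mu> (K1 \<union> K2)" "measure \<mu> (K1 \<union> K2) \<le> measure \<mu> B"
      using K1 K2 B s by (auto intro!: \<mu>.finite_measure_mono)
    moreover have "measure \<nu> K2 \<le> measure \<nu> (K1 \<union> K2)" "measure \<nu> (K1 \<union> K2) \<le> measure \<nu> B"
      using K1 K2 B s by (auto intro!: \<nu>.finite_measure_mono)
    ultimately show "\<bar>measure \<mu> B - measure \<nu> B\<bar> \<le> C + e"
      using K K1(3) K2(3) unfolding abs_le_iff by linarith
  qed
qed

section \<open>Normal laws and the total variation bound\<close>

lemma std_gauss_real_eq: "(std_gauss :: real measure) = density lborel std_normal_density"
  by (simp add: std_gauss_def gauss_density_real_eq)

lemma std_gauss_real_moments:
  "integrable (std_gauss :: real measure) (\<lambda>x. x ^ k)"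
  "(\<integral>x. x \<partial>(std_gauss :: real measure)) = 0"
  "(\<integral>x. x\<^sup>2 \<partial>(std_gauss :: real measure)) = 1"
  using integrable_std_normal_distribution_moment[of k] integral_std_normal_distribution_moment_odd[of 1]
    std_normal_distribution_even_moments(1)[of 1]
  by (simp_all add: std_gauss_real_eq)

text \<open>Describing normal laws as affine images treats the degenerate case uniformly: for s = 0
  the map is constant and its law is the point mass.\<close>

lemma normal_law_eq_distr:
  assumes "0 \<le> s"
  shows "normal_law m s = distr (std_gauss :: real measure) borel (\<lambda>x. m + s * x)"
proof (cases "s = 0")
  case True
  have "distr (std_gauss :: real measure) borel (\<lambda>x. m) = return borel m"
    by (rule std_gauss.distr_const) simp
  then show ?thesis using True by (simp add: normal_law_def)
next
  case False
  have "distributed (std_gauss :: real measure) lborel (\<lambda>x. x) (normal_density 0 1)"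
    unfolding distributed_def std_gauss_real_eq by (auto simp: distr_id2 sets_eq_imp_space_eq)
  from std_gauss.normal_density_affine[OF this _ False, of m]
  have "distr std_gauss lborel (\<lambda>x. m + s * x) = density lborel (normal_density m s)"
    using assms by (simp add: distributed_def)
  moreover have "distr std_gauss lborel (\<lambda>x. m + s * x) = distr std_gauss borel (\<lambda>x. m + s * x)"
    by (rule distr_cong) auto
  ultimately show ?thesis using False by (simp add: normal_law_def)
qed

text \<open>Lets the parameters in the law of Z be read as its mean and standard deviation, hence as
  those of W; it also supplies second moments wherever only normality is known.\<close>

lemma normal_law_moments:
  assumes "prob_space N" and Z: "Z \<in> borel_measurable N" and d: "distr N borel Z = normal_law m s" and s: "0 \<le> s"
  shows "mean N Z = m" "var N Z = s\<^sup>2" "integrable N (\<lambda>\<omega>. (Z \<omega>)\<^sup>2)"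
proof -
  interpret prob_space N by fact
  note [measurable] = Z
  have i: "integrable (std_gauss :: real measure) (\<lambda>x. x)" "integrable (std_gauss :: real measure) (\<lambda>x. x\<^sup>2)"
    using std_gauss_real_moments(1)[of 1] std_gauss_real_moments(1)[of 2] by simp_all
  have t: "(\<integral>\<omega>. f (Z \<omega>) \<partial>N) = (\<integral>x. f (m + s * x) \<partial>std_gauss)"
    "integrable N (\<lambda>\<omega>. f (Z \<omega>)) \<longleftrightarrow> integrable std_gauss (\<lambda>x. f (m + s * x))"
    if [measurable]: "f \<in> borel_measurable borel" for f :: "real \<Rightarrow> real"
    using integral_distr[of Z N borel f] integral_distr[of "\<lambda>x. m + s * x" std_gauss borel f]
      integrable_distr_eq[of Z N borel f] integrable_distr_eq[of "\<lambda>x. m + s * x" std_gauss borel f]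
    by (simp_all add: d normal_law_eq_distr[OF s])
  have one: "measure (std_gauss :: real measure) UNIV = 1"
    using std_gauss.prob_space[where 'a=real] by simp
  have "mean N Z = (\<integral>x. m + s * x \<partial>(std_gauss :: real measure))"
    by (rule t(1)) measurable
  also have "\<dots> = m"
    by (simp add: i(1) one std_gauss_real_moments(2))
  finally show m: "mean N Z = m" .
  have "integrable (std_gauss :: real measure) (\<lambda>x. m\<^sup>2 + s\<^sup>2 * x\<^sup>2 + 2 * m * s * x)"
    by (intro Bochner_Integration.integrable_add integrable_mult_right i std_gauss.integrable_const)
  then show "integrable N (\<lambda>\<omega>. (Z \<omega>)\<^sup>2)"
    by (subst t(2)) (auto simp: power2_sum power_mult_distrib mult.assoc)
  have "var N Z = (\<integral>x. (m + s * x - m)\<^sup>2 \<partial>(std_gauss :: real measure))"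
    unfolding m by (rule t(1)) measurable
  also have "\<dots> = s\<^sup>2"
    by (simp add: power_mult_distrib std_gauss_real_moments(3))
  finally show "var N Z = s\<^sup>2" .
qed

text \<open>Stein's equation for the standardized test function, rescaled to mean m and variance
  s^2, expresses s^2 times the error on the test function through
  \<open>second_order_Stein_bound\<close> with B = 2.\<close>

lemma (in gaussian_functional) normal_approximation:
  assumes m: "m = (\<integral>x. h x \<partial>std_gauss)" and s: "0 < s" "s\<^sup>2 = (\<integral>x. (h x - m)\<^sup>2 \<partial>std_gauss)"
    and A: "A \<in> sets borel"
  shows "\<bar>measure (distr std_gauss borel h) A - measure (normal_law m s) A\<bar> \<le> 4 * K / s\<^sup>2"
proof -
  have "continuous_on UNIV h"
    using dh by (meson continuous_at_imp_continuous_on has_derivative_continuous)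
  then have [measurable]: "h \<in> borel_measurable borel"
    by (rule borel_measurable_continuous_onI)
  have ih1: "integrable std_gauss h"
    by (rule std_gauss.square_integrable_imp_integrable[OF _ ih]) measurable
  have s2: "s\<^sup>2 = (\<integral>x. (h x)\<^sup>2 \<partial>std_gauss) - (\<integral>x. h x \<partial>std_gauss)\<^sup>2"
    unfolding s m by (rule std_gauss.variance_eq[OF ih1 ih])
  have nl: "normal_law m s = distr (std_gauss :: real measure) borel (\<lambda>x. m + s * x)"
    using s by (intro normal_law_eq_distr) auto
  show ?thesis
  proof (rule measure_diff_le_of_continuous_tests[OF _ _ _ _ _ A])
    show "prob_space (distr std_gauss borel h)" "prob_space (normal_law m s)"
      unfolding nl by (auto intro!: std_gauss.prob_space_distr)
    show "sets (distr std_gauss borel h) = sets borel" "sets (normal_law m s) = sets borel"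
      by (simp_all add: nl)
    fix \<phi> :: "real \<Rightarrow> real" assume \<phi>: "continuous_on UNIV \<phi>" "\<And>x. 0 \<le> \<phi> x" "\<And>x. \<phi> x \<le> 1"
    have [measurable]: "\<phi> \<in> borel_measurable borel" using \<phi>(1) by (rule borel_measurable_continuous_onI)
    have "continuous_on UNIV (\<lambda>x. \<phi> (m + s * x))"
      by (intro continuous_on_compose2[OF \<phi>(1)] continuous_intros) auto
    then obtain f0 f0' where f0: "\<And>x. (f0 has_real_derivative f0' x) (at x)" "continuous_on UNIV f0'"
      "\<And>x. \<bar>f0' x\<bar> \<le> 2" "\<And>x. f0' x - x * f0 x = \<phi> (m + s * x) - (\<integral>x. \<phi> (m + s * x) \<partial>std_gauss)"
      using Stein_equation_solution[of "\<lambda>x. \<phi> (m + s * x)"] \<phi> by blast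
    have cf0: "continuous_on UNIV f0"
      by (rule continuous_at_imp_continuous_on) (blast intro: DERIV_isCont f0(1))
    have [measurable]: "f0 \<in> borel_measurable borel" "f0' \<in> borel_measurable borel"
      using cf0 f0(2) by (auto intro: borel_measurable_continuous_onI)
    \<comment> \<open>The prefactor \<open>s\<close> cancels the 1 / s from the chain rule, so
      \<open>f'\<close> keeps the bound 2 of the standardized solution.\<close>
    define f where "f w = s * f0 ((w - m) / s)" for w
    define f' where "f' w = f0' ((w - m) / s)" for w
    have [measurable]: "f \<in> borel_measurable borel" "f' \<in> borel_measurable borel"
      unfolding f_def f'_def by measurable
    have df: "(f has_real_derivative f' w) (at w)" for w
    proof -
      have "((\<lambda>w. (w - m) / s) has_real_derivative 1 / s) (at w)"
        using s by (auto intro!: derivative_eq_intros)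
      from DERIV_cmult[OF DERIV_chain2[OF f0(1) this], of s] show ?thesis
        using s by (simp add: f_def[abs_def] f'_def)
    qed
    have cf': "continuous_on UNIV f'"
      unfolding f'_def using s by (intro continuous_on_compose2[OF f0(2)] continuous_intros) auto
    have bf': "\<bar>f' w\<bar> \<le> 2" for w unfolding f'_def by (rule f0(3))
    define x where "x z = (h z - m) / s" for z
    have hx: "h z = m + s * x z" for z using s by (simp add: x_def)
    have [measurable]: "x \<in> borel_measurable borel" unfolding x_def by measurable
    have if': "integrable std_gauss (\<lambda>z. f' (h z))"
      using bf' by (intro integrable_bounded_std_gauss[of _ 2]) auto
    have i\<phi>: "integrable std_gauss (\<lambda>z. \<phi> (h z))"
      using \<phi> by (intro integrable_bounded_std_gauss[of _ 1]) auto
    define c where "c = (\<integral>x. \<phi> (m + s * x) \<partial>std_gauss)"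
    have pt: "s\<^sup>2 * f' (h z) - f (h z) * (h z - m) = s\<^sup>2 * (\<phi> (h z) - c)" for z
    proof -
      have "f (h z) * (h z - m) = s\<^sup>2 * (x z * f0 (x z))"
        using s(1) by (simp add: f_def x_def power2_eq_square field_simps)
      then have "s\<^sup>2 * f' (h z) - f (h z) * (h z - m) = s\<^sup>2 * (f0' (x z) - x z * f0 (x z))"
        by (simp add: f'_def x_def right_diff_distrib)
      then show ?thesis unfolding f0(4) hx[of z] c_def .
    qed
    have "\<bar>(\<integral>x. f (h x) * h x \<partial>std_gauss) - (\<integral>x. f (h x) \<partial>std_gauss) * (\<integral>x. h x \<partial>std_gauss) -
       (\<integral>x. f' (h x) \<partial>std_gauss) * ((\<integral>x. (h x)\<^sup>2 \<partial>std_gauss) - (\<integral>x. h x \<partial>std_gauss)\<^sup>2)\<bar> \<le> 2 * 2 * K"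
      by (rule second_order_Stein_bound[OF df cf' bf'])
    moreover have "(\<integral>x. f (h x) * h x \<partial>std_gauss) - (\<integral>x. f (h x) \<partial>std_gauss) * (\<integral>x. h x \<partial>std_gauss) -
       (\<integral>x. f' (h x) \<partial>std_gauss) * ((\<integral>x. (h x)\<^sup>2 \<partial>std_gauss) - (\<integral>x. h x \<partial>std_gauss)\<^sup>2)
       = - (s\<^sup>2 * ((\<integral>z. \<phi> (h z) \<partial>std_gauss) - c))"
    proof -
      \<comment> \<open>By \<open>pt\<close> this product equals a difference of two bounded
        functions.\<close>
      have fm: "integrable std_gauss (\<lambda>z. f (h z) * (h z - m))"
      proof -
        have "integrable std_gauss (\<lambda>z. s\<^sup>2 * f' (h z) - s\<^sup>2 * (\<phi> (h z) - c))"
          using if' i\<phi> by auto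
        then show ?thesis by (simp flip: pt)
      qed
      have fh: "integrable std_gauss (\<lambda>z. f (h z))"
        by (rule std_gauss.square_integrable_imp_integrable[OF _ square_integrable_compose_Lipschitz[OF _ _ ih df bf']])
           measurable
      have fhh: "integrable std_gauss (\<lambda>z. f (h z) * h z)"
        using Bochner_Integration.integrable_add[OF fm integrable_mult_right[OF fh, of m]]
        by (simp add: algebra_simps)
      have "s\<^sup>2 * ((\<integral>z. \<phi> (h z) \<partial>std_gauss) - c) = (\<integral>z. s\<^sup>2 * (\<phi> (h z) - c) \<partial>std_gauss)"
        using i\<phi> std_gauss.prob_space[where 'a='a] by simp
      also have "\<dots> = (\<integral>z. s\<^sup>2 * f' (h z) - (f (h z) * h z - m * f (h z)) \<partial>std_gauss)"
        unfolding pt[symmetric] by (simp add: algebra_simps)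
      also have "\<dots> = s\<^sup>2 * (\<integral>z. f' (h z) \<partial>std_gauss) - ((\<integral>z. f (h z) * h z \<partial>std_gauss) - m * (\<integral>z. f (h z) \<partial>std_gauss))"
        using if' fh fhh by simp
      finally have e: "s\<^sup>2 * ((\<integral>z. \<phi> (h z) \<partial>std_gauss) - c) = \<dots>" .
      have "(\<integral>x. (h x)\<^sup>2 \<partial>std_gauss) - (\<integral>x. h x \<partial>std_gauss)\<^sup>2 = s\<^sup>2" by (simp add: s2)
      then show ?thesis unfolding e m[symmetric] by (simp add: algebra_simps)
    qed
    ultimately have "s\<^sup>2 * \<bar>(\<integral>z. \<phi> (h z) \<partial>std_gauss) - c\<bar> \<le> 4 * K"
      by (simp add: abs_mult)
    then have "\<bar>(\<integral>z. \<phi> (h z) \<partial>std_gauss) - c\<bar> \<le> 4 * K / s\<^sup>2"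
      using s(1) by (simp add: le_divide_eq mult.commute)
    moreover have "(\<integral>z. \<phi> (h z) \<partial>std_gauss) = (\<integral>x. \<phi> x \<partial>distr std_gauss borel h)"
      by (rule integral_distr[symmetric]) auto
    moreover have "c = (\<integral>x. \<phi> x \<partial>normal_law m s)"
      unfolding c_def nl by (rule integral_distr[symmetric]) auto
    ultimately show "\<bar>(\<integral>x. \<phi> x \<partial>distr std_gauss borel h) - (\<integral>x. \<phi> x \<partial>normal_law m s)\<bar> \<le> 4 * K / s\<^sup>2"
      by simp
  qed
qed

lemma tv_dist_leI:
  assumes "\<And>A. A \<in> sets borel \<Longrightarrow> \<bar>measure (distr M borel W) A - measure (distr N borel Z) A\<bar> \<le> C"
    and "W \<in> borel_measurable M" "Z \<in> borel_measurable N"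
  shows "tv_dist M W N Z \<le> C"
  unfolding tv_dist_def
proof (rule cSUP_least)
  fix A :: "real set" assume A: "A \<in> sets borel"
  have "{\<omega> \<in> space M. W \<omega> \<in> A} = W -` A \<inter> space M" "{\<omega> \<in> space N. Z \<omega> \<in> A} = Z -` A \<inter> space N" by auto
  then show "\<bar>measure M {\<omega> \<in> space M. W \<omega> \<in> A} - measure N {\<omega> \<in> space N. Z \<omega> \<in> A}\<bar> \<le> C"
    using assms A by (simp add: measure_distr)
qed auto

lemma (in gaussian_functional) tv_dist_le:
  fixes M :: "'b measure" and N :: "'c measure"
  assumes N: "prob_space N"
    and W: "W \<in> borel_measurable M" "distr M borel W = distr std_gauss borel h"
    and Z: "normal_rv N Z" "mean N Z = mean M W" "var N Z = var M W"
    and pos: "0 < var M W"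
  shows "tv_dist M W N Z \<le> 4 * K / var M W"
proof -
  have "continuous_on UNIV h"
    using dh by (meson continuous_at_imp_continuous_on has_derivative_continuous)
  then have [measurable]: "h \<in> borel_measurable borel"
    by (auto intro: borel_measurable_continuous_onI)
  note [measurable] = W(1)
  have t: "(\<integral>\<omega>. f (W \<omega>) \<partial>M) = (\<integral>x. f (h x) \<partial>std_gauss)"
    if [measurable]: "f \<in> borel_measurable borel" for f :: "real \<Rightarrow> real"
    using integral_distr[of W M borel f] integral_distr[of h std_gauss borel f]
    by (simp_all add: W(2))
  obtain m s where ms: "0 \<le> s" "distr N borel Z = normal_law m s" and Zm: "Z \<in> borel_measurable N"
    using Z(1) unfolding normal_rv_def by blast
  note mom = normal_law_moments[OF N Zm ms(2,1)]
  have s: "s\<^sup>2 = var M W" and m: "m = mean M W" using mom Z by simp_all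
  have "0 < s" using pos ms(1) s by (cases "s = 0") auto
  show ?thesis
  proof (rule tv_dist_leI[OF _ W(1) Zm])
    fix A :: "real set" assume A: "A \<in> sets borel"
    have "\<bar>measure (distr std_gauss borel h) A - measure (normal_law m s) A\<bar> \<le> 4 * K / s\<^sup>2"
    proof (rule normal_approximation[OF _ \<open>0 < s\<close> _ A])
      show "m = (\<integral>x. h x \<partial>std_gauss)" using t[of "\<lambda>x. x"] m by simp
      show "s\<^sup>2 = (\<integral>x. (h x - m)\<^sup>2 \<partial>std_gauss)" using t[of "\<lambda>x. (x - m)\<^sup>2"] m s by simp
    qed
    then show "\<bar>measure (distr M borel W) A - measure (distr N borel Z) A\<bar> \<le> 4 * K / var M W"
      by (simp add: W(2) ms(2) s)
  qed
qed

text \<open>Zero variance makes W almost surely constant, and Z has the same point mass as its law.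
  Needed because a numerator of 0 over variance 0 is 0 in \<open>ennreal\<close>, so the final bound
  is not trivial there.\<close>

lemma tv_dist_degenerate:
  assumes M: "prob_space M" and N: "prob_space N" and W: "W \<in> borel_measurable M" "integrable M (\<lambda>\<omega>. (W \<omega>)\<^sup>2)"
    and Z: "normal_rv N Z" "mean N Z = mean M W" "var N Z = var M W" and v: "var M W = 0"
  shows "tv_dist M W N Z \<le> 0"
proof -
  interpret M: prob_space M by fact
  obtain m s where ms: "0 \<le> s" "distr N borel Z = normal_law m s" and Zm: "Z \<in> borel_measurable N"
    using Z(1) unfolding normal_rv_def by blast
  note mom = normal_law_moments[OF N Zm ms(2,1)]
  have "s = 0" and m: "m = mean M W" using mom Z v by simp_all
  then have dZ: "distr N borel Z = return borel m" by (simp add: ms(2) normal_law_def)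
  have iW: "integrable M W" by (rule M.square_integrable_imp_integrable[OF W])
  have "AE \<omega> in M. (W \<omega> - m)\<^sup>2 = 0"
  proof (rule integral_nonneg_eq_0_iff_AE[THEN iffD1])
    show "integrable M (\<lambda>\<omega>. (W \<omega> - m)\<^sup>2)" using W iW by (simp add: power2_diff)
    show "(\<integral>\<omega>. (W \<omega> - m)\<^sup>2 \<partial>M) = 0" using v m by simp
  qed simp
  then have "distr M borel W = distr M borel (\<lambda>_. m)"
    using W(1) by (intro distr_cong_AE) auto
  then have "distr M borel W = return borel m" by (simp add: M.distr_const)
  then show ?thesis by (intro tv_dist_leI W(1) Zm) (simp add: dZ)
qed

section \<open>Functionals of independent variables\<close>

lemma gradient_has_derivative:
  fixes g :: "real ^ 'n \<Rightarrow> real"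
  assumes "g differentiable (at x)"
  shows "(g has_derivative (\<lambda>v. gradient g x \<bullet> v)) (at x)"
proof -
  let ?F = "frechet_derivative g (at x)"
  have F: "(g has_derivative ?F) (at x)" using assms by (simp add: frechet_derivative_works)
  have "?F v = gradient g x \<bullet> v" for v
  proof -
    have "?F v = ?F (\<Sum>i\<in>UNIV. v $ i *\<^sub>R axis i 1)" by (simp add: basis_expansion scalar_mult_eq_scaleR[symmetric])
    also have "\<dots> = (\<Sum>i\<in>UNIV. v $ i * ?F (axis i 1))"
      using has_derivative_linear[OF F] by (simp add: linear_sum linear_scale)
    finally show ?thesis by (simp add: gradient_def inner_vec_def mult.commute)
  qed
  then have "?F = (\<lambda>v. gradient g x \<bullet> v)" by (rule ext)
  with F show ?thesis by (simp only:)
qed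

lemma C2D:
  fixes g :: "real ^ 'n \<Rightarrow> real"
  assumes "C2 g"
  shows "(g has_derivative (\<lambda>v. gradient g x \<bullet> v)) (at x)"
    and "(gradient g has_derivative (\<lambda>v. hessian g x *v v)) (at x)"
    and "continuous_on UNIV g" and "continuous_on UNIV (gradient g)" and "continuous_on UNIV (hessian g)"
proof -
  show d: "(g has_derivative (\<lambda>v. gradient g x \<bullet> v)) (at x)" for x
    using assms by (intro gradient_has_derivative) (auto simp: C2_def)
  show d2: "(gradient g has_derivative (\<lambda>v. hessian g x *v v)) (at x)" for x
    using assms jacobian_works[of "gradient g" "at x"] by (auto simp: C2_def hessian_def)
  show "continuous_on UNIV g" "continuous_on UNIV (gradient g)"
    using d d2 by (meson continuous_at_imp_continuous_on has_derivative_continuous)+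
  show "continuous_on UNIV (hessian g)" using assms by (simp add: C2_def)
qed

section \<open>Matrix norms, moment bounds and the common estimate\<close>

lemma norm_matrix_vector_mult_le: "norm (A *v x) \<le> mat_norm A * norm x"
  unfolding mat_norm_def by (rule onorm) simp

lemma mat_norm_nonneg: "0 \<le> mat_norm A"
  unfolding mat_norm_def by (rule onorm_pos_le) simp

text \<open>Pair the image with itself, move the transpose across the inner product, and cancel one
  factor of its norm.\<close>

lemma norm_transpose_mult_le:
  fixes A :: "real ^ 'n ^ 'm"
  shows "norm (transpose A *v y) \<le> mat_norm A * norm y"
proof (cases "transpose A *v y = 0")
  case True
  then show ?thesis by (simp add: mat_norm_nonneg)
next
  case False
  let ?w = "transpose A *v y"
  have "norm ?w * norm ?w = ?w \<bullet> ?w" by (simp add: power2_norm_eq_inner[symmetric] power2_eq_square)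
  also have "\<dots> = y \<bullet> (A *v ?w)"
    by (simp add: dot_lmul_matrix[symmetric] inner_commute)
  also have "\<dots> \<le> norm y * norm (A *v ?w)" by (rule norm_cauchy_schwarz)
  also have "\<dots> \<le> norm y * (mat_norm A * norm ?w)"
    by (intro mult_left_mono norm_matrix_vector_mult_le) auto
  finally have "norm ?w * norm ?w \<le> (mat_norm A * norm y) * norm ?w" by (simp add: mult.commute mult.left_commute)
  then show ?thesis using False by simp
qed

text \<open>The operator norm is Lipschitz for the sum of absolute entries. Continuity is what makes
  the integrand of \<open>kappa2\<close> measurable.\<close>

lemma continuous_mat_norm: "continuous_on UNIV (mat_norm :: real ^ 'n ^ 'm \<Rightarrow> real)"
proof -
  have le: "mat_norm A \<le> mat_norm B + (\<Sum>i\<in>UNIV. \<Sum>j\<in>UNIV. \<bar>(A - B) $ i $ j\<bar>)" for A B :: "real ^ 'n ^ 'm"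
  proof -
    have "mat_norm A = onorm (\<lambda>v. B *v v + (A - B) *v v)"
      by (simp add: mat_norm_def matrix_vector_mult_add_rdistrib[symmetric])
    also have "\<dots> \<le> mat_norm B + onorm (\<lambda>v. (A - B) *v v)"
      unfolding mat_norm_def by (rule onorm_triangle) auto
    also have "onorm (\<lambda>v. (A - B) *v v) \<le> (\<Sum>i\<in>UNIV. \<Sum>j\<in>UNIV. \<bar>(A - B) $ i $ j\<bar>)"
      by (rule onorm_le_matrix_component_sum)
    finally show ?thesis by simp
  qed
  have "(mat_norm \<longlongrightarrow> mat_norm B) (at B)" for B :: "real ^ 'n ^ 'm"
  proof -
    have "((\<lambda>A. mat_norm A - mat_norm B) \<longlongrightarrow> 0) (at B)"
    proof (rule Lim_null_comparison)
      show "\<forall>\<^sub>F A in at B. norm (mat_norm A - mat_norm B) \<le> (\<Sum>i\<in>UNIV. \<Sum>j\<in>UNIV. \<bar>(A - B) $ i $ j\<bar>)"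
      proof (intro always_eventually allI)
        fix A
        show "norm (mat_norm A - mat_norm B) \<le> (\<Sum>i\<in>UNIV. \<Sum>j\<in>UNIV. \<bar>(A - B) $ i $ j\<bar>)"
          using le[of A B] le[of B A] by (simp add: abs_le_iff abs_minus_commute)
      qed
      have "((\<lambda>A. \<Sum>i\<in>UNIV. \<Sum>j\<in>UNIV. \<bar>(A - B) $ i $ j\<bar>) \<longlongrightarrow> (\<Sum>i\<in>UNIV. \<Sum>j\<in>UNIV. \<bar>(B - B) $ i $ j\<bar>)) (at B)"
        by (intro tendsto_intros)
      then show "((\<lambda>A. \<Sum>i\<in>UNIV. \<Sum>j\<in>UNIV. \<bar>(A - B) $ i $ j\<bar>) \<longlongrightarrow> 0) (at B)" by simp
    qed
    then show ?thesis by (simp add: LIM_zero_iff)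
  qed
  then show ?thesis by (simp add: continuous_on_def)
qed

text \<open>\<open>ennreal_root\<close> is infinite exactly at infinity, so a finite kappa means a
  finite integral. Equality of laws then moves it to the Gaussian space as an ordinary real
  integral.\<close>

lemma ennreal_root_nn_integral_transfer:
  fixes f :: "'c::topological_space \<Rightarrow> real"
  assumes X: "X \<in> borel_measurable M" and U: "U \<in> borel_measurable L" and d: "distr M borel X = distr L borel U"
    and [measurable]: "f \<in> borel_measurable borel" and f0: "\<And>x. 0 \<le> f x"
    and fin: "ennreal_root k (\<integral>\<^sup>+x. ennreal (f (X x)) \<partial>M) < \<top>"
  shows "integrable L (\<lambda>x. f (U x))"
    and "ennreal_root k (\<integral>\<^sup>+x. ennreal (f (X x)) \<partial>M) = ennreal (root k (\<integral>x. f (U x) \<partial>L))"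
proof -
  note [measurable] = X U
  have eq: "(\<integral>\<^sup>+x. ennreal (f (X x)) \<partial>M) = (\<integral>\<^sup>+x. ennreal (f (U x)) \<partial>L)"
    using nn_integral_distr[OF X, of "\<lambda>x. ennreal (f x)"] nn_integral_distr[OF U, of "\<lambda>x. ennreal (f x)"] by (simp add: d)
  have "(\<integral>\<^sup>+x. ennreal (f (U x)) \<partial>L) < \<top>"
    using fin unfolding eq by (auto simp: ennreal_root_def less_top split: if_splits)
  then show i: "integrable L (\<lambda>x. f (U x))" using f0 by (intro integrableI_nonneg) auto
  then have "(\<integral>\<^sup>+x. ennreal (f (U x)) \<partial>L) = ennreal (\<integral>x. f (U x) \<partial>L)"
    using f0 by (intro nn_integral_eq_integral) auto
  then show "ennreal_root k (\<integral>\<^sup>+x. ennreal (f (X x)) \<partial>M) = ennreal (root k (\<integral>x. f (U x) \<partial>L))"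
    unfolding eq using f0 by (simp add: ennreal_root_def Bochner_Integration.integral_nonneg)
qed

lemma root_4_power2: "0 \<le> x \<Longrightarrow> (root 4 x)\<^sup>2 = sqrt x"
  by (rule real_sqrt_unique[symmetric]) (auto simp: power_mult[symmetric])

text \<open>Triangle inequality in L2; it keeps the plain sum \<open>A + B\<close> of the two root
  mean squares, which is the shape of the final bound.\<close>

lemma Minkowski_square:
  fixes \<alpha> \<beta> :: "'b \<Rightarrow> real"
  assumes [measurable]: "\<alpha> \<in> borel_measurable M" "\<beta> \<in> borel_measurable M"
    and i: "integrable M (\<lambda>x. (\<alpha> x)\<^sup>2)" "integrable M (\<lambda>x. (\<beta> x)\<^sup>2)"
    and A: "(\<integral>x. (\<alpha> x)\<^sup>2 \<partial>M) \<le> A\<^sup>2" "0 \<le> A" and B: "(\<integral>x. (\<beta> x)\<^sup>2 \<partial>M) \<le> B\<^sup>2" "0 \<le> B"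
  shows "integrable M (\<lambda>x. (\<alpha> x + \<beta> x)\<^sup>2)" "(\<integral>x. (\<alpha> x + \<beta> x)\<^sup>2 \<partial>M) \<le> (A + B)\<^sup>2"
proof -
  note CS = Cauchy_Schwarz_integral[OF assms(1,2) i]
  show "integrable M (\<lambda>x. (\<alpha> x + \<beta> x)\<^sup>2)"
    using CS(1) i by (simp add: power2_sum mult.assoc)
  have "(\<integral>x. \<alpha> x * \<beta> x \<partial>M) \<le> A * B"
  proof -
    have "sqrt (\<integral>x. (\<alpha> x)\<^sup>2 \<partial>M) \<le> A" "sqrt (\<integral>x. (\<beta> x)\<^sup>2 \<partial>M) \<le> B"
      using A B by (auto intro: real_le_lsqrt)
    then have "sqrt (\<integral>x. (\<alpha> x)\<^sup>2 \<partial>M) * sqrt (\<integral>x. (\<beta> x)\<^sup>2 \<partial>M) \<le> A * B"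
      using A by (intro mult_mono) auto
    then show ?thesis using CS(2) by linarith
  qed
  moreover have "(\<integral>x. (\<alpha> x + \<beta> x)\<^sup>2 \<partial>M) = (\<integral>x. (\<alpha> x)\<^sup>2 \<partial>M) + (\<integral>x. (\<beta> x)\<^sup>2 \<partial>M) + 2 * (\<integral>x. \<alpha> x * \<beta> x \<partial>M)"
    using CS(1) i by (simp add: power2_sum mult.assoc)
  ultimately show "(\<integral>x. (\<alpha> x + \<beta> x)\<^sup>2 \<partial>M) \<le> (A + B)\<^sup>2"
    using A(1) B(1) by (simp add: power2_sum)
qed

text \<open>Cauchy-Schwarz for the squares of the two factors. Each factor sees only a standard
  Gaussian marginal, whatever their correlation; for the Hessian and the gradient this gives the
  product of \<open>kappa1\<close> and \<open>kappa2\<close>.\<close>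

lemma integral_product_rot_le:
  fixes u v :: "'a::euclidean_space \<Rightarrow> real"
  assumes [measurable]: "u \<in> borel_measurable borel" "v \<in> borel_measurable borel"
    and iu: "integrable std_gauss (\<lambda>x. (u x) ^ 4)" and iv: "integrable std_gauss (\<lambda>x. (v x) ^ 4)"
    and t: "sin t \<noteq> 0"
  shows "integrable std_gauss (\<lambda>z. (u (fst z) * v (fst (rot t z)))\<^sup>2)"
    and "(\<integral>z. (u (fst z) * v (fst (rot t z)))\<^sup>2 \<partial>std_gauss) \<le>
      sqrt (\<integral>x. (u x) ^ 4 \<partial>std_gauss) * sqrt (\<integral>x. (v x) ^ 4 \<partial>std_gauss)"
proof -
  have u: "integrable std_gauss (\<lambda>z::'a\<times>'a. ((u (fst z))\<^sup>2)\<^sup>2)"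
    "(\<integral>z. ((u (fst z))\<^sup>2)\<^sup>2 \<partial>(std_gauss :: ('a\<times>'a) measure)) = (\<integral>x. (u x) ^ 4 \<partial>std_gauss)"
    using std_gauss_proj[of "\<lambda>x. (u x) ^ 4"] iu by (auto simp: power_mult[symmetric])
  have v0: "integrable std_gauss (\<lambda>z::'a\<times>'a. (v (fst z)) ^ 4)"
    "(\<integral>z. (v (fst z)) ^ 4 \<partial>(std_gauss :: ('a\<times>'a) measure)) = (\<integral>x. (v x) ^ 4 \<partial>std_gauss)"
    using std_gauss_proj[of "\<lambda>x. (v x) ^ 4"] iv by auto
  have v: "integrable std_gauss (\<lambda>z. ((v (fst (rot t z)))\<^sup>2)\<^sup>2)"
    "(\<integral>z. ((v (fst (rot t z)))\<^sup>2)\<^sup>2 \<partial>std_gauss) = (\<integral>x. (v x) ^ 4 \<partial>std_gauss)"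
    using std_gauss_rot[of "\<lambda>z. (v (fst z)) ^ 4" t] v0 t by (auto simp: power_mult[symmetric])
  note CS = Cauchy_Schwarz_integral[of "\<lambda>z. (u (fst z))\<^sup>2" std_gauss "\<lambda>z. (v (fst (rot t z)))\<^sup>2", OF _ _ u(1) v(1)]
  show "integrable std_gauss (\<lambda>z. (u (fst z) * v (fst (rot t z)))\<^sup>2)"
    using CS(1) by (simp add: power_mult_distrib)
  show "(\<integral>z. (u (fst z) * v (fst (rot t z)))\<^sup>2 \<partial>std_gauss) \<le>
      sqrt (\<integral>x. (u x) ^ 4 \<partial>std_gauss) * sqrt (\<integral>x. (v x) ^ 4 \<partial>std_gauss)"
    using CS(2) unfolding u(2) v(2) by (simp add: power_mult_distrib)
qed

text \<open>Common core of both parts: X has the law of U(\<xi>) and h is g after U. The Hessian of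
  h splits into a conjugate of the Hessian of g by the derivative of U and a term from the second
  derivative of U. The term with \<open>c ^ 3\<close> covers the former, two factors from the
  conjugation and one from \<open>Dh\<close>; \<open>\<alpha>\<close> covers the latter.\<close>

lemma tv_dist_transported_functional_le:
  fixes U :: "'a::euclidean_space \<Rightarrow> real ^ 'n" and M :: "'b measure" and N :: "'c measure"
  assumes M: "prob_space M" and N: "prob_space N" and g: "C2 g"
    and W4: "integrable M (\<lambda>\<omega>. g (X \<omega>) ^ 4)"
    and Z: "normal_rv N Z" "mean N Z = mean M (\<lambda>\<omega>. g (X \<omega>))" "var N Z = var M (\<lambda>\<omega>. g (X \<omega>))"
    and Xm: "X \<in> borel_measurable M" and dX: "distr M borel X = distr std_gauss borel U"
    and cU: "continuous_on UNIV U"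
    and dh: "\<And>x. ((\<lambda>x. g (U x)) has_derivative (\<lambda>v. Dh x \<bullet> v)) (at x)"
    and dDh: "\<And>x. (Dh has_derivative L x) (at x)"
    and cL: "\<And>v. continuous_on UNIV (\<lambda>x. L x v)"
    and c: "0 \<le> c" and nDh: "\<And>x. norm (Dh x) \<le> c * norm (gradient g (U x))"
    and bd: "\<And>x y. norm (adjoint (L x) (Dh y)) \<le>
      \<alpha> x y + c ^ 3 * (mat_norm (hessian g (U x)) * norm (gradient g (U y)))"
    and \<alpha>m: "\<And>t. (\<lambda>z. \<alpha> (fst z) (fst (rot t z))) \<in> borel_measurable borel"
    and i\<alpha>: "\<And>t. sin t \<noteq> 0 \<Longrightarrow> integrable std_gauss (\<lambda>z. (\<alpha> (fst z) (fst (rot t z)))\<^sup>2)"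
    and A: "\<And>t. sin t \<noteq> 0 \<Longrightarrow> (\<integral>z. (\<alpha> (fst z) (fst (rot t z)))\<^sup>2 \<partial>std_gauss) \<le> A\<^sup>2" "0 \<le> A"
    and fin: "kappa1 M X g < \<top>" "kappa2 M X g < \<top>"
  shows "ennreal (tv_dist M (\<lambda>\<omega>. g (X \<omega>)) N Z) \<le>
    ennreal (2 * sqrt 5) * (ennreal A + ennreal (c ^ 3) * kappa1 M X g * kappa2 M X g)
    / ennreal (var M (\<lambda>\<omega>. g (X \<omega>)))"
proof -
  interpret M: prob_space M by fact
  define W where "W \<omega> = g (X \<omega>)" for \<omega>
  define h where "h x = g (U x)" for x
  note Z = Z[folded W_def] and dh = dh[folded h_def]
  note gD = C2D[OF g]
  let ?G = "gradient g" and ?H = "hessian g"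
  have Um: "U \<in> borel_measurable borel"
    using cU by (rule borel_measurable_continuous_onI)
  then have Us: "U \<in> borel_measurable std_gauss"
    by (simp add: measurable_cong_sets[OF sets_std_gauss refl])
  note [measurable] = Xm Um \<alpha>m
  have [measurable]: "g \<in> borel_measurable borel" "?G \<in> borel_measurable borel"
      "?H \<in> borel_measurable borel" "(mat_norm :: real ^ 'n ^ 'n \<Rightarrow> real) \<in> borel_measurable borel"
    using gD(3-5) continuous_mat_norm by (auto intro: borel_measurable_continuous_onI)
  have [measurable]: "W \<in> borel_measurable M" "h \<in> borel_measurable borel"
    unfolding W_def h_def by measurable
  have cDh: "continuous_on UNIV Dh"
    using dDh by (meson continuous_at_imp_continuous_on has_derivative_continuous)
  then have [measurable]: "Dh \<in> borel_measurable borel" by (rule borel_measurable_continuous_onI)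
  have W2: "integrable M (\<lambda>\<omega>. (W \<omega>)\<^sup>2)"
  proof (rule M.square_integrable_imp_integrable)
    show "integrable M (\<lambda>\<omega>. ((W \<omega>)\<^sup>2)\<^sup>2)" using W4 by (simp add: W_def power_mult[symmetric])
  qed measurable
  have dW: "distr M borel W = distr std_gauss borel h"
  proof -
    have "distr M borel W = distr (distr M borel X) borel g"
      by (subst distr_distr) (auto simp: comp_def W_def[abs_def])
    also have "\<dots> = distr std_gauss borel h"
      unfolding dX by (subst distr_distr) (auto simp: comp_def h_def[abs_def])
    finally show ?thesis .
  qed
  define I1 where "I1 = (\<integral>x. norm (?G (U x)) ^ 4 \<partial>std_gauss)"
  define I2 where "I2 = (\<integral>x. mat_norm (?H (U x)) ^ 4 \<partial>std_gauss)"
  note transfer = ennreal_root_nn_integral_transfer[OF Xm Us dX]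
  have i1: "integrable std_gauss (\<lambda>x. norm (?G (U x)) ^ 4)" and k1: "kappa1 M X g = ennreal (root 4 I1)"
    using transfer[OF _ _ fin(1)[unfolded kappa1_def]] by (simp_all add: kappa1_def I1_def)
  have i2: "integrable std_gauss (\<lambda>x. mat_norm (?H (U x)) ^ 4)" and k2: "kappa2 M X g = ennreal (root 4 I2)"
    using transfer[OF _ _ fin(2)[unfolded kappa2_def]] by (simp_all add: kappa2_def I2_def mat_norm_nonneg)
  have I: "0 \<le> I1" "0 \<le> I2"
    unfolding I1_def I2_def by (auto intro!: Bochner_Integration.integral_nonneg simp: mat_norm_nonneg)
  define B where "B = c ^ 3 * (root 4 I1 * root 4 I2)"
  have B0: "0 \<le> B" using c I by (simp add: B_def)
  have rhs: "ennreal A + ennreal (c ^ 3) * kappa1 M X g * kappa2 M X g = ennreal (A + B)"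
    unfolding k1 k2 B_def using c I A(2) by (simp add: ennreal_plus ennreal_mult mult.assoc)
  have "ennreal (tv_dist M W N Z) \<le> ennreal (2 * sqrt 5) * ennreal (A + B) / ennreal (var M W)"
  proof (cases "var M W = 0")
    \<comment> \<open>The right-hand side may be 0 / 0 = 0 here, so the distance must be shown to
      vanish.\<close>
    case True
    then have "tv_dist M W N Z \<le> 0" using tv_dist_degenerate[OF M N _ W2 Z] by simp
    then show ?thesis by (simp add: ennreal_neg)
  next
    case False
    moreover have "0 \<le> var M W" by (rule Bochner_Integration.integral_nonneg) simp
    ultimately have pos: "0 < var M W" by linarith
    \<comment> \<open>\<open>A\<close> and \<open>B\<close> bound the root mean squares of the two
      parts of the adjoint Hessian applied to the rotated gradient; Minkowski adds them.\<close>
    interpret gaussian_functional h Dh L "A + B"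
    proof
      show "integrable std_gauss (\<lambda>x. (h x)\<^sup>2)"
        using W2 integrable_distr_eq[of W M borel "\<lambda>x. x\<^sup>2"] integrable_distr_eq[of h std_gauss borel "\<lambda>x. x\<^sup>2"]
        by (simp add: dW)
      show "integrable std_gauss (\<lambda>x. norm (Dh x) ^ 4)"
      proof (rule Bochner_Integration.integrable_bound)
        show "integrable std_gauss (\<lambda>x. c ^ 4 * norm (?G (U x)) ^ 4)" using i1 by simp
        show "AE x in std_gauss. norm (norm (Dh x) ^ 4) \<le> norm (c ^ 4 * norm (?G (U x)) ^ 4)"
          by (intro AE_I2) (simp add: power_mult_distrib[symmetric] power_mono nDh)
      qed measurable
      fix t :: real assume t: "0 < t" "t < pi / 2"
      have s: "sin t \<noteq> 0" using sin_gt_zero2[OF t] by simp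
      have lin: "linear (L x)" for x using dDh[of x] by (rule has_derivative_linear)
      have "continuous_on UNIV (\<lambda>z. adjoint (L (fst z)) (Dh (fst (rot t z))))"
        by (intro continuous_on_adjoint lin continuous_on_compose2[OF cDh] continuous_on_compose2[OF cL]
            continuous_intros continuous_rot) auto
      then have [measurable]: "(\<lambda>z. adjoint (L (fst z)) (Dh (fst (rot t z)))) \<in> borel_measurable borel"
        by (rule borel_measurable_continuous_onI)
      define \<alpha>' where "\<alpha>' z = \<alpha> (fst z) (fst (rot t z))" for z
      define \<beta> where "\<beta> z = c ^ 3 * (mat_norm (?H (U (fst z))) * norm (?G (U (fst (rot t z)))))" for z
      have [measurable]: "\<alpha>' \<in> borel_measurable borel" "\<beta> \<in> borel_measurable borel"
        unfolding \<alpha>'_def \<beta>_def by measurable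
      have i\<beta>: "integrable std_gauss (\<lambda>z. (\<beta> z)\<^sup>2)" and B: "(\<integral>z. (\<beta> z)\<^sup>2 \<partial>std_gauss) \<le> B\<^sup>2"
      proof -
        note P = integral_product_rot_le[OF _ _ i2 i1 s]
        have "integrable std_gauss (\<lambda>z. (mat_norm (?H (U (fst z))) * norm (?G (U (fst (rot t z)))))\<^sup>2)"
          by (rule P(1)) auto
        then show "integrable std_gauss (\<lambda>z. (\<beta> z)\<^sup>2)" by (simp add: \<beta>_def power_mult_distrib)
        have "(\<integral>z. (mat_norm (?H (U (fst z))) * norm (?G (U (fst (rot t z)))))\<^sup>2 \<partial>std_gauss) \<le> sqrt I2 * sqrt I1"
          unfolding I1_def I2_def by (rule P(2)) auto
        then have "(c ^ 3)\<^sup>2 * (\<integral>z. (mat_norm (?H (U (fst z))) * norm (?G (U (fst (rot t z)))))\<^sup>2 \<partial>std_gauss)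
           \<le> (c ^ 3)\<^sup>2 * (sqrt I2 * sqrt I1)"
          by (rule mult_left_mono) simp
        then show "(\<integral>z. (\<beta> z)\<^sup>2 \<partial>std_gauss) \<le> B\<^sup>2"
          unfolding \<beta>_def B_def power_mult_distrib[of "c ^ 3"]
          by (simp add: power_mult_distrib root_4_power2[OF I(1)] root_4_power2[OF I(2)] mult.commute)
      qed
      note Mi = Minkowski_square[OF _ _ i\<alpha>[OF s, folded \<alpha>'_def] i\<beta> A(1)[OF s, folded \<alpha>'_def] A(2) B B0]
      have le: "(norm (adjoint (L (fst z)) (Dh (fst (rot t z)))))\<^sup>2 \<le> (\<alpha>' z + \<beta> z)\<^sup>2" for z
        using bd[of "fst z" "fst (rot t z)"] by (intro power_mono) (auto simp: \<alpha>'_def \<beta>_def)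
      have Mi1: "integrable std_gauss (\<lambda>z. (\<alpha>' z + \<beta> z)\<^sup>2)" by (rule Mi(1)) auto
      show i: "integrable std_gauss (\<lambda>z. (norm (adjoint (L (fst z)) (Dh (fst (rot t z)))))\<^sup>2)"
        by (rule Bochner_Integration.integrable_bound[OF Mi1]) (use le in auto)
      have "(\<integral>z. (norm (adjoint (L (fst z)) (Dh (fst (rot t z)))))\<^sup>2 \<partial>std_gauss) \<le> (\<integral>z. (\<alpha>' z + \<beta> z)\<^sup>2 \<partial>std_gauss)"
        by (intro integral_mono i Mi1 le)
      also have "\<dots> \<le> (A + B)\<^sup>2" by (rule Mi(2)) auto
      finally show "(\<integral>z. (norm (adjoint (L (fst z)) (Dh (fst (rot t z)))))\<^sup>2 \<partial>std_gauss) \<le> (A + B)\<^sup>2" .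
    qed (use dh dDh cL A(2) B0 in auto)
    have "tv_dist M W N Z \<le> 4 * (A + B) / var M W"
      by (rule tv_dist_le[OF N _ dW Z pos]) measurable
    also have "\<dots> \<le> 2 * sqrt 5 * (A + B) / var M W"
    proof -
      have "(2::real) \<le> sqrt 5" by (rule real_le_rsqrt) simp
      then show ?thesis using A(2) B0 pos by (intro divide_right_mono mult_right_mono) auto
    qed
    finally have "ennreal (tv_dist M W N Z) \<le> ennreal (2 * sqrt 5 * (A + B) / var M W)"
      by (rule ennreal_leI)
    also have "\<dots> = ennreal (2 * sqrt 5) * ennreal (A + B) / ennreal (var M W)"
      using A(2) B0 pos by (simp add: divide_ennreal[symmetric] ennreal_mult)
    finally show ?thesis .
  qed
  then show ?thesis unfolding rhs W_def .
qed

section \<open>Independent coordinates as images of a Gaussian vector\<close>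

lemma has_derivative_vec_lambda:
  fixes f :: "'a::real_normed_vector \<Rightarrow> real ^ 'n"
  assumes "\<And>i. ((\<lambda>x. f x $ i) has_derivative (\<lambda>v. f' v $ i)) (at x)"
  shows "(f has_derivative f') (at x)"
  unfolding has_derivative_componentwise_within[of f f' x UNIV]
  using assms by (auto simp: Basis_vec_def inner_axis)

lemma borel_measurable_vec_lambda:
  fixes f :: "'a \<Rightarrow> real ^ 'n"
  assumes "\<And>i. (\<lambda>x. f x $ i) \<in> borel_measurable M"
  shows "f \<in> borel_measurable M"
  unfolding borel_measurable_euclidean_space[of f M]
  using assms by (auto simp: Basis_vec_def inner_axis)

lemma emeasure_std_gauss_Pi:
  fixes B :: "'n::finite \<Rightarrow> real set"
  assumes [measurable]: "\<And>i. B i \<in> sets borel"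
  shows "emeasure (std_gauss :: (real ^ 'n) measure) {x. \<forall>i. x $ i \<in> B i} = (\<Prod>i\<in>UNIV. emeasure std_gauss (B i))"
proof -
  have Basis: "(Basis :: (real ^ 'n) set) = (\<lambda>i. axis i 1) ` UNIV" by (auto simp: Basis_vec_def)
  have inj: "inj (\<lambda>i::'n. axis i (1::real))" by (auto simp: inj_on_def axis_eq_axis)
  have m: "{x :: real ^ 'n. \<forall>i. x $ i \<in> B i} \<in> sets borel" by measurable
  have "emeasure (std_gauss :: (real ^ 'n) measure) {x. \<forall>i. x $ i \<in> B i} =
      (\<integral>\<^sup>+x. indicator {x :: real ^ 'n. \<forall>i. x $ i \<in> B i} x \<partial>std_gauss)"
    using m by simp
  also have "\<dots> = (\<integral>\<^sup>+x. ennreal (\<Prod>b\<in>Basis. indicator (B (axis_index b)) (x \<bullet> b)) \<partial>(std_gauss :: (real ^ 'n) measure))"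
  proof (rule nn_integral_cong)
    fix x :: "real ^ 'n"
    have "(\<Prod>b\<in>Basis. indicator (B (axis_index b)) (x \<bullet> b) :: real) = (\<Prod>i\<in>UNIV. indicator (B i) (x $ i))"
      unfolding Basis by (subst prod.reindex[OF inj]) (simp add: inner_axis)
    also have "\<dots> = indicator {x. \<forall>i. x $ i \<in> B i} x"
      by (auto simp: indicator_def prod_zero_iff)
    finally show "indicator {x. \<forall>i. x $ i \<in> B i} x = ennreal (\<Prod>b\<in>Basis. indicator (B (axis_index b)) (x \<bullet> b))"
      by (simp split: split_indicator)
  qed
  also have "\<dots> = (\<Prod>b\<in>(Basis :: (real ^ 'n) set). \<integral>\<^sup>+x. ennreal (indicator (B (axis_index b)) x * std_normal_density x) \<partial>lborel)"
    by (rule nn_integral_std_gauss_prod) auto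
  also have "\<dots> = (\<Prod>i\<in>UNIV. \<integral>\<^sup>+x. ennreal (indicator (B i) x * std_normal_density x) \<partial>lborel)"
    unfolding Basis by (subst prod.reindex[OF inj]) simp
  also have "\<dots> = (\<Prod>i\<in>UNIV. emeasure std_gauss (B i))"
  proof (rule prod.cong[OF refl])
    fix i
    have "emeasure std_gauss (B i) = (\<integral>\<^sup>+x. ennreal (std_normal_density x) * indicator (B i) x \<partial>lborel)"
      by (simp add: std_gauss_real_eq emeasure_density)
    also have "\<dots> = (\<integral>\<^sup>+x. ennreal (indicator (B i) x * std_normal_density x) \<partial>lborel)"
      by (intro nn_integral_cong) (auto split: split_indicator)
    finally show "(\<integral>\<^sup>+x. ennreal (indicator (B i) x * std_normal_density x) \<partial>lborel) = emeasure std_gauss (B i)" ..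
  qed
  finally show ?thesis .
qed

lemma distr_std_gauss_nth:
  "distr std_gauss borel (\<lambda>x :: real ^ 'n. x $ i) = (std_gauss :: real measure)"
  using distr_std_gauss_inner_Basis[of "axis i 1 :: real ^ 'n"] by (simp add: inner_axis std_gauss_real_eq)

text \<open>Independence is equality of the joint law with the product law, and a product measure is
  determined by its values on rectangles.\<close>

lemma indep_vars_std_gauss_coordinates:
  "std_gauss.indep_vars (\<lambda>_. borel) (\<lambda>i (x :: real ^ 'n). x $ i) UNIV"
proof -
  have r [measurable]: "(\<lambda>x :: real ^ 'n. \<lambda>i\<in>UNIV. x $ i) \<in> measurable std_gauss (\<Pi>\<^sub>M i\<in>UNIV. borel)"
    by (rule measurable_restrict) simp
  interpret P: product_prob_space "\<lambda>_ :: 'n. (std_gauss :: real measure)" UNIV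
    by (intro product_prob_spaceI std_gauss.prob_space_axioms)
  have "distr std_gauss (\<Pi>\<^sub>M i\<in>UNIV. borel) (\<lambda>x :: real ^ 'n. \<lambda>i\<in>UNIV. x $ i) = (\<Pi>\<^sub>M i\<in>UNIV. std_gauss)"
  proof (rule P.PiM_eqI)
    show "sets (distr std_gauss (\<Pi>\<^sub>M i\<in>UNIV. borel) (\<lambda>x :: real ^ 'n. \<lambda>i\<in>UNIV. x $ i)) =
      sets (\<Pi>\<^sub>M i\<in>UNIV. (std_gauss :: real measure))"
      by (simp cong: sets_PiM_cong)
    fix A :: "'n \<Rightarrow> real set" assume "\<And>i. i \<in> UNIV \<Longrightarrow> A i \<in> sets std_gauss"
    then have A [measurable]: "A i \<in> sets borel" for i by simp
    have "emeasure (distr std_gauss (\<Pi>\<^sub>M i\<in>UNIV. borel) (\<lambda>x :: real ^ 'n. \<lambda>i\<in>UNIV. x $ i)) (Pi\<^sub>E UNIV A) =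
       emeasure std_gauss ((\<lambda>x :: real ^ 'n. \<lambda>i\<in>UNIV. x $ i) -` (Pi\<^sub>E UNIV A) \<inter> space std_gauss)"
      by (rule emeasure_distr) (auto intro!: sets_PiM_I_finite r)
    also have "(\<lambda>x :: real ^ 'n. \<lambda>i\<in>UNIV. x $ i) -` (Pi\<^sub>E UNIV A) \<inter> space std_gauss = {x. \<forall>i. x $ i \<in> A i}"
      by (auto simp: PiE_iff)
    also have "emeasure std_gauss \<dots> = (\<Prod>i\<in>UNIV. emeasure std_gauss (A i))"
      by (rule emeasure_std_gauss_Pi[OF A])
    finally show "emeasure (distr std_gauss (\<Pi>\<^sub>M i\<in>UNIV. borel) (\<lambda>x :: real ^ 'n. \<lambda>i\<in>UNIV. x $ i)) (Pi\<^sub>E UNIV A) =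
      (\<Prod>i\<in>UNIV. emeasure std_gauss (A i))" .
  qed simp
  then show ?thesis
    by (subst std_gauss.indep_vars_iff_distr_eq_PiM) (auto simp: distr_std_gauss_nth)
qed

text \<open>Joint laws of independent families are determined by the marginals. \<open>X\<close> and
  the coordinatewise image of a Gaussian vector have the same marginals and are both independent, so
  their laws agree.\<close>

lemma distr_indep_eq_distr_std_gauss:
  fixes X :: "'a \<Rightarrow> real ^ 'n" and u :: "'n \<Rightarrow> real \<Rightarrow> real"
  assumes M: "prob_space M"
    and ind: "prob_space.indep_vars M (\<lambda>_. borel) (\<lambda>i \<omega>. X \<omega> $ i) UNIV"
    and d: "\<And>i. distr M borel (\<lambda>\<omega>. X \<omega> $ i) = distr std_gauss borel (u i)"
    and u: "\<And>i. u i \<in> borel_measurable borel"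
  shows "X \<in> borel_measurable M" and "distr M borel X = distr std_gauss borel (\<lambda>x. \<chi> i. u i (x $ i))"
proof -
  interpret M: prob_space M by fact
  note [measurable] = u
  have rv [measurable]: "(\<lambda>\<omega>. X \<omega> $ i) \<in> borel_measurable M" for i
    using ind by (auto simp: M.indep_vars_def)
  show X: "X \<in> borel_measurable M" by (rule borel_measurable_vec_lambda) (rule rv)
  define U where "U x = (\<chi> i. u i (x $ i))" for x
  have U [measurable]: "U \<in> borel_measurable borel"
    by (rule borel_measurable_vec_lambda) (simp add: U_def)
  have Ur [measurable]: "(\<lambda>x. \<lambda>i\<in>UNIV. U x $ i) \<in> measurable std_gauss (\<Pi>\<^sub>M i\<in>UNIV. borel)"
    by (rule measurable_restrict) (simp add: U_def)
  have Xr [measurable]: "(\<lambda>\<omega>. \<lambda>i\<in>UNIV. X \<omega> $ i) \<in> measurable M (\<Pi>\<^sub>M i\<in>UNIV. borel)"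
    by (rule measurable_restrict) (rule rv)
  have Ui: "(\<lambda>x. U x $ i) \<in> borel_measurable std_gauss" for i
    by (simp add: U_def)
  have Uind: "std_gauss.indep_vars (\<lambda>_. borel) (\<lambda>i x. U x $ i) UNIV"
    using std_gauss.indep_vars_compose2[OF indep_vars_std_gauss_coordinates u] by (simp add: U_def)
  have dU: "distr std_gauss borel (\<lambda>x. U x $ i) = distr std_gauss borel (u i)" for i
  proof -
    have "distr std_gauss borel (u i) = distr (distr std_gauss borel (\<lambda>x :: real ^ 'n. x $ i)) borel (u i)"
      unfolding distr_std_gauss_nth ..
    also have "\<dots> = distr std_gauss borel (\<lambda>x. U x $ i)"
      by (subst distr_distr) (auto simp: comp_def U_def)
    finally show ?thesis ..
  qed
  have eq: "distr M (\<Pi>\<^sub>M i\<in>UNIV. borel) (\<lambda>\<omega>. \<lambda>i\<in>UNIV. X \<omega> $ i) =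
    distr std_gauss (\<Pi>\<^sub>M i\<in>UNIV. borel) (\<lambda>x. \<lambda>i\<in>UNIV. U x $ i)"
    using M.indep_vars_iff_distr_eq_PiM[where I=UNIV and M'="\<lambda>_. borel" and X="\<lambda>i \<omega>. X \<omega> $ i"]
      std_gauss.indep_vars_iff_distr_eq_PiM[where I=UNIV and M'="\<lambda>_. borel" and X="\<lambda>i x. U x $ i"] ind Uind
    by (simp add: d dU Ui)
  \<comment> \<open>Reassembling a vector from the function of its coordinates is measurable, which
    carries equality of product laws over to the vector type.\<close>
  have v [measurable]: "(\<lambda>f. \<chi> i. f i) \<in> measurable (\<Pi>\<^sub>M i\<in>UNIV. borel) (borel :: (real ^ 'n) measure)"
    by (rule borel_measurable_vec_lambda) simp
  have "distr M borel X = distr (distr M (\<Pi>\<^sub>M i\<in>UNIV. borel) (\<lambda>\<omega>. \<lambda>i\<in>UNIV. X \<omega> $ i)) borel (\<lambda>f. \<chi> i. f i)"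
    unfolding distr_distr[OF v Xr] by (simp add: comp_def restrict_def)
  also have "\<dots> = distr (distr std_gauss (\<Pi>\<^sub>M i\<in>UNIV. borel) (\<lambda>x. \<lambda>i\<in>UNIV. U x $ i)) borel (\<lambda>f. \<chi> i. f i)"
    by (simp only: eq)
  also have "\<dots> = distr std_gauss borel U"
    unfolding distr_distr[OF v Ur] by (simp add: comp_def restrict_def)
  finally show "distr M borel X = distr std_gauss borel (\<lambda>x. \<chi> i. u i (x $ i))"
    by (simp add: U_def[abs_def])
qed

lemma C2_realD:
  assumes "C2_real u"
  shows "(u has_real_derivative deriv u x) (at x)" "(deriv u has_real_derivative deriv (deriv u) x) (at x)"
    "continuous_on UNIV u" "continuous_on UNIV (deriv u)" "continuous_on UNIV (deriv (deriv u))"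
proof -
  show d: "(u has_real_derivative deriv u x) (at x)" "(deriv u has_real_derivative deriv (deriv u) x) (at x)" for x
    using assms by (simp_all add: C2_real_def DERIV_deriv_iff_real_differentiable)
  show "continuous_on UNIV u" "continuous_on UNIV (deriv u)"
    using d by (auto intro!: continuous_at_imp_continuous_on intro: DERIV_isCont)
  show "continuous_on UNIV (deriv (deriv u))" using assms by (simp add: C2_real_def)
qed

lemma norm_vec_mult_le:
  fixes y :: "real ^ 'n"
  assumes "\<And>i. \<bar>d i\<bar> \<le> c"
  shows "norm (\<chi> i. d i * y $ i) \<le> c * norm y"
proof -
  \<comment> \<open>Index types are inhabited, so \<open>undefined\<close> serves as some
    index.\<close>
  have c: "0 \<le> c" using assms[of undefined] by linarith
  have "norm (\<chi> i. d i * y $ i) \<le> norm (c *\<^sub>R y)"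
    by (rule norm_le_componentwise_cart)
       (use assms c in \<open>auto simp: abs_mult intro: mult_right_mono\<close>)
  then show ?thesis using c by simp
qed

lemma inner_matrix_vector_transpose:
  fixes A :: "real ^ 'n ^ 'm"
  shows "(A *v x) \<bullet> y = x \<bullet> (transpose A *v y)"
  by (metis dot_lmul_matrix inner_commute transpose_matrix_vector)

text \<open>This is the form of the Hessian of g after a coordinatewise U: a diagonal part from the
  second derivatives of U, plus the Hessian of g between two diagonal matrices. Diagonal matrices
  are self-adjoint, so only the inner matrix is transposed.\<close>

lemma adjoint_diagonal_conjugation:
  fixes G :: "real ^ 'n ^ 'n"
  assumes "linear (\<lambda>v. \<chi> i. e i * v $ i + d i * (G *v (\<chi> j. d j * v $ j)) $ i)"
  shows "adjoint (\<lambda>v. \<chi> i. e i * v $ i + d i * (G *v (\<chi> j. d j * v $ j)) $ i) =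
    (\<lambda>y. (\<chi> i. e i * y $ i) + (\<chi> i. d i * (transpose G *v (\<chi> j. d j * y $ j)) $ i))"
proof (rule adjoint_unique, intro allI)
  fix v y :: "real ^ 'n"
  let ?D = "\<lambda>v. \<chi> j. d j * v $ j"
  have "?D (G *v ?D v) \<bullet> y = (G *v ?D v) \<bullet> ?D y"
    by (simp add: inner_vec_def mult_ac)
  also have "\<dots> = ?D v \<bullet> (transpose G *v ?D y)"
    by (rule inner_matrix_vector_transpose)
  also have "\<dots> = v \<bullet> ?D (transpose G *v ?D y)"
    by (simp add: inner_vec_def mult_ac)
  finally have "?D (G *v ?D v) \<bullet> y = v \<bullet> ?D (transpose G *v ?D y)" .
  moreover have "(\<chi> i. e i * v $ i) \<bullet> y = v \<bullet> (\<chi> i. e i * y $ i)"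
    by (simp add: inner_vec_def mult_ac)
  moreover have "(\<chi> i. e i * v $ i + d i * (G *v ?D v) $ i) = (\<chi> i. e i * v $ i) + ?D (G *v ?D v)"
    by (simp add: vec_eq_iff)
  ultimately show "(\<chi> i. e i * v $ i + d i * (G *v (\<chi> j. d j * v $ j)) $ i) \<bullet> y =
     v \<bullet> ((\<chi> i. e i * y $ i) + (\<chi> i. d i * (transpose G *v (\<chi> j. d j * y $ j)) $ i))"
    by (simp add: inner_add_left inner_add_right)
qed

lemma borel_measurable_vec_nth [measurable (raw)]:
  fixes f :: "'a \<Rightarrow> real ^ 'n"
  assumes "f \<in> borel_measurable M"
  shows "(\<lambda>x. f x $ i) \<in> borel_measurable M"
  by (rule measurable_compose[OF assms]) (intro borel_measurable_continuous_onI continuous_intros)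

text \<open>Here U acts coordinatewise by the maps u_i. The diagonal part of the Hessian brings
  u_i'' times the i-th partial of g at one copy, against u_i' times the i-th partial at the other:
  hence c1 c2 and a sum over coordinates of products, controlled by \<open>kappa0\<close>. The
  conjugated part has three factors c1.\<close>

lemma tv_dist_independent_le:
  fixes M :: "'a measure" and N :: "'b measure"
    and X :: "'a \<Rightarrow> real ^ 'n" and g :: "real ^ 'n \<Rightarrow> real" and Z :: "'b \<Rightarrow> real"
  assumes M: "prob_space M" and N: "prob_space N" and g: "C2 g"
    and W4: "integrable M (\<lambda>\<omega>. g (X \<omega>) ^ 4)"
    and Z: "normal_rv N Z" "mean N Z = mean M (\<lambda>\<omega>. g (X \<omega>))" "var N Z = var M (\<lambda>\<omega>. g (X \<omega>))"
    and c: "0 < c1" "0 < c2"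
    and ind: "prob_space.indep_vars M (\<lambda>_. borel) (\<lambda>i \<omega>. X \<omega> $ i) UNIV"
    and law: "\<And>i. distr M borel (\<lambda>\<omega>. X \<omega> $ i) \<in> lip_gauss_laws c1 c2"
    and fin: "kappa0 M X g < \<top>" "kappa1 M X g < \<top>" "kappa2 M X g < \<top>"
  shows "ennreal (tv_dist M (\<lambda>\<omega>. g (X \<omega>)) N Z) \<le>
    ennreal (2 * sqrt 5) *
      (ennreal (c1 * c2) * kappa0 M X g + ennreal (c1 ^ 3) * kappa1 M X g * kappa2 M X g)
    / ennreal (var M (\<lambda>\<omega>. g (X \<omega>)))"
proof -
  have "\<exists>u. distr M borel (\<lambda>\<omega>. X \<omega> $ i) = distr std_gauss borel u \<and> C2_real u \<and>
      (\<forall>x. \<bar>deriv u x\<bar> \<le> c1) \<and> (\<forall>x. \<bar>deriv (deriv u) x\<bar> \<le> c2)" for i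
    using law[of i] by (auto simp: lip_gauss_laws_def std_gauss_real_eq)
  then obtain u where ud: "\<And>i. distr M borel (\<lambda>\<omega>. X \<omega> $ i) = distr std_gauss borel (u i)"
    and uC: "\<And>i. C2_real (u i)" and u1: "\<And>i x. \<bar>deriv (u i) x\<bar> \<le> c1" and u2: "\<And>i x. \<bar>deriv (deriv (u i)) x\<bar> \<le> c2"
    by metis
  note uD = C2_realD[OF uC]
  have um [measurable]: "u i \<in> borel_measurable borel" for i
    using uD(3) by (rule borel_measurable_continuous_onI)
  define U where "U x = (\<chi> i. u i (x $ i))" for x
  have X [measurable]: "X \<in> borel_measurable M" and dX: "distr M borel X = distr std_gauss borel U"
    using distr_indep_eq_distr_std_gauss[OF M ind ud um] by (simp_all add: U_def[abs_def])
  note gD = C2D[OF g]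
  let ?G = "gradient g" and ?H = "hessian g"
  have U_cont: "continuous_on UNIV U"
    unfolding U_def by (intro continuous_intros continuous_on_compose2[OF uD(3)]) auto
  have Um [measurable]: "U \<in> borel_measurable borel"
    using U_cont by (rule borel_measurable_continuous_onI)
  have [measurable]: "g \<in> borel_measurable borel" "?G \<in> borel_measurable borel"
      "?H \<in> borel_measurable borel" "(mat_norm :: real ^ 'n ^ 'n \<Rightarrow> real) \<in> borel_measurable borel"
    using gD(3-5) continuous_mat_norm by (auto intro: borel_measurable_continuous_onI)
  have Us: "U \<in> borel_measurable std_gauss"
    by (simp add: measurable_cong_sets[OF sets_std_gauss refl])
  define I0 where "I0 = (\<integral>x. (\<Sum>i\<in>UNIV. \<bar>?G (U x) $ i\<bar> ^ 4) \<partial>std_gauss)"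
  have m0: "(\<lambda>x. \<Sum>i\<in>UNIV. \<bar>?G x $ i\<bar> ^ 4) \<in> borel_measurable borel" by measurable
  have i0: "integrable std_gauss (\<lambda>x. \<Sum>i\<in>UNIV. \<bar>?G (U x) $ i\<bar> ^ 4)" and k0: "kappa0 M X g = ennreal (sqrt I0)"
    using ennreal_root_nn_integral_transfer[OF X Us dX m0 _ fin(1)[unfolded kappa0_def]]
    by (simp_all add: kappa0_def I0_def sum_nonneg sqrt_def)
  have I0: "0 \<le> I0"
    unfolding I0_def by (auto intro!: Bochner_Integration.integral_nonneg sum_nonneg)
  define Dh where "Dh x = (\<chi> i. deriv (u i) (x $ i) * ?G (U x) $ i)" for x
  define L where "L x v = (\<chi> i. (deriv (deriv (u i)) (x $ i) * ?G (U x) $ i) * v $ i +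
      deriv (u i) (x $ i) * (?H (U x) *v (\<chi> j. deriv (u j) (x $ j) * v $ j)) $ i)" for x v
  have nth: "((\<lambda>x. x $ i) has_derivative (\<lambda>v. v $ i)) (at x)" for i and x :: "real ^ 'n"
    by (rule bounded_linear_imp_has_derivative[OF bounded_linear_vec_nth])
  have dU: "(U has_derivative (\<lambda>v. \<chi> i. deriv (u i) (x $ i) * v $ i)) (at x)" for x
  proof (rule has_derivative_vec_lambda)
    show "((\<lambda>x. U x $ i) has_derivative (\<lambda>v. (\<chi> i. deriv (u i) (x $ i) * v $ i) $ i)) (at x)" for i
      using has_derivative_compose[OF nth uD(1)[unfolded has_field_derivative_def]] by (simp add: U_def)
  qed
  have dh: "((\<lambda>x. g (U x)) has_derivative (\<lambda>v. Dh x \<bullet> v)) (at x)" for x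
    using has_derivative_compose[OF dU gD(1)]
    by (simp add: Dh_def inner_vec_def mult_ac)
  have dDh: "(Dh has_derivative L x) (at x)" for x
  proof (rule has_derivative_vec_lambda)
    fix i
    have 1: "((\<lambda>x. deriv (u i) (x $ i)) has_derivative (\<lambda>v. deriv (deriv (u i)) (x $ i) * v $ i)) (at x)"
      using has_derivative_compose[OF nth uD(2)[unfolded has_field_derivative_def]] by simp
    have 2: "((\<lambda>x. ?G (U x) $ i) has_derivative (\<lambda>v. (?H (U x) *v (\<chi> j. deriv (u j) (x $ j) * v $ j)) $ i)) (at x)"
      by (rule has_derivative_compose[OF has_derivative_compose[OF dU gD(2)] nth])
    show "((\<lambda>x. Dh x $ i) has_derivative (\<lambda>v. L x v $ i)) (at x)"
      by (rule has_derivative_eq_rhs, unfold Dh_def vec_lambda_beta, rule has_derivative_mult[OF 1 2])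
         (simp add: L_def mult_ac add.commute)
  qed
  have cL: "continuous_on UNIV (\<lambda>x. L x v)" for v
    unfolding L_def matrix_vector_mult_def
    by (intro continuous_intros continuous_on_compose2[OF uD(4)] continuous_on_compose2[OF uD(5)]
          continuous_on_compose2[OF gD(4) U_cont] continuous_on_compose2[OF gD(5) U_cont]) auto
  have nDh: "norm (Dh x) \<le> c1 * norm (?G (U x))" for x
    unfolding Dh_def by (rule norm_vec_mult_le) (rule u1)
  \<comment> \<open>Coordinatewise product of the gradients at the two correlated points; all that
    is left of the diagonal part once u_i' and u_i'' are bounded.\<close>
  define P where "P x y = (\<chi> i. ?G (U x) $ i * ?G (U y) $ i)" for x y
  define \<alpha> where "\<alpha> x y = c1 * c2 * norm (P x y)" for x y
  have bd: "norm (adjoint (L x) (Dh y)) \<le> \<alpha> x y + c1 ^ 3 * (mat_norm (?H (U x)) * norm (?G (U y)))" for x y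
  proof -
    let ?D = "\<lambda>w. \<chi> i. deriv (u i) (x $ i) * w $ i"
    have "adjoint (L x) (Dh y) = (\<chi> i. deriv (deriv (u i)) (x $ i) * ?G (U x) $ i * Dh y $ i) +
       ?D (transpose (?H (U x)) *v ?D (Dh y))"
      using adjoint_diagonal_conjugation[OF has_derivative_linear[OF dDh[of x, unfolded L_def[abs_def]]]]
      by (simp add: L_def[abs_def])
    then have "norm (adjoint (L x) (Dh y)) \<le> norm (\<chi> i. deriv (deriv (u i)) (x $ i) * ?G (U x) $ i * Dh y $ i) +
       norm (?D (transpose (?H (U x)) *v ?D (Dh y)))"
      by (simp only: norm_triangle_ineq)
    moreover have "norm (\<chi> i. deriv (deriv (u i)) (x $ i) * ?G (U x) $ i * Dh y $ i) \<le> \<alpha> x y"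
    proof -
      \<comment> \<open>Regrouped so that u_i'' at \<open>x\<close> and u_i' at \<open>y\<close>
        form one diagonal multiplier, bounded by c1 c2, acting on \<open>P x y\<close>.\<close>
      have eq: "(\<chi> i. deriv (deriv (u i)) (x $ i) * ?G (U x) $ i * Dh y $ i) =
         (\<chi> i. (deriv (deriv (u i)) (x $ i) * deriv (u i) (y $ i)) * P x y $ i)"
        by (simp add: Dh_def P_def mult.assoc mult.left_commute)
      show ?thesis
        unfolding eq \<alpha>_def
      proof (rule norm_vec_mult_le)
        fix i
        have "\<bar>deriv (deriv (u i)) (x $ i)\<bar> * \<bar>deriv (u i) (y $ i)\<bar> \<le> c2 * c1"
          using c by (intro mult_mono u1 u2) auto
        then show "\<bar>deriv (deriv (u i)) (x $ i) * deriv (u i) (y $ i)\<bar> \<le> c1 * c2"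
          by (simp add: abs_mult mult.commute[of c1 c2])
      qed
    qed
    moreover have "norm (?D (transpose (?H (U x)) *v ?D (Dh y))) \<le> c1 ^ 3 * (mat_norm (?H (U x)) * norm (?G (U y)))"
    proof -
      have D: "norm (?D w) \<le> c1 * norm w" for w by (rule norm_vec_mult_le) (rule u1)
      have "norm (?D (transpose (?H (U x)) *v ?D (Dh y))) \<le> c1 * norm (transpose (?H (U x)) *v ?D (Dh y))"
        by (rule D)
      also have "\<dots> \<le> c1 * (mat_norm (?H (U x)) * norm (?D (Dh y)))"
        using c by (intro mult_left_mono norm_transpose_mult_le) auto
      also have "\<dots> \<le> c1 * (mat_norm (?H (U x)) * (c1 * (c1 * norm (?G (U y)))))"
        using c by (intro mult_left_mono order_trans[OF D] nDh mat_norm_nonneg) auto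
      also have "\<dots> = c1 ^ 3 * (mat_norm (?H (U x)) * norm (?G (U y)))" by (simp add: power3_eq_cube)
      finally show ?thesis .
    qed
    ultimately show ?thesis by linarith
  qed
  have Pm [measurable]: "(\<lambda>z. P (fst z) (fst (rot t z))) \<in> borel_measurable borel" for t
    by (rule borel_measurable_vec_lambda) (simp add: P_def)
  have \<alpha>: "integrable std_gauss (\<lambda>z. (\<alpha> (fst z) (fst (rot t z)))\<^sup>2)"
      "(\<integral>z. (\<alpha> (fst z) (fst (rot t z)))\<^sup>2 \<partial>std_gauss) \<le> (c1 * c2 * sqrt I0)\<^sup>2" if s: "sin t \<noteq> 0" for t
  proof -
    let ?f = "\<lambda>x. \<Sum>i\<in>UNIV. \<bar>?G (U x) $ i\<bar> ^ 4"
    \<comment> \<open>From a^2 b^2 <= (a^4 + b^4) / 2 in each coordinate. Both halves have the same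
      Gaussian marginal, so the average again integrates to \<open>I0\<close>, the square of
      \<open>kappa0\<close>.\<close>
    define w where "w z = (?f (fst z) + ?f (fst (rot t z))) / 2" for z
    have p: "integrable std_gauss (\<lambda>z. ?f (fst z))" "(\<integral>z. ?f (fst z) \<partial>(std_gauss :: ((real^'n) \<times> (real^'n)) measure)) = I0"
      using std_gauss_proj[of ?f] i0 by (simp_all add: I0_def)
    have r: "integrable std_gauss (\<lambda>z. ?f (fst (rot t z)))" "(\<integral>z. ?f (fst (rot t z)) \<partial>std_gauss) = I0"
      using std_gauss_rot[of "\<lambda>z. ?f (fst z)" t] s p by simp_all
    have w: "integrable std_gauss w" "(\<integral>z. w z \<partial>std_gauss) = I0"
      unfolding w_def[abs_def] integral_divide_zero Bochner_Integration.integral_add[OF p(1) r(1)] p(2) r(2)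
      by (intro integrable_divide_zero impI Bochner_Integration.integrable_add p(1) r(1)) simp
    have le: "(norm (P (fst z) (fst (rot t z))))\<^sup>2 \<le> w z" for z
    proof -
      have "(norm (P (fst z) (fst (rot t z))))\<^sup>2 =
        (\<Sum>i\<in>UNIV. (?G (U (fst z)) $ i)\<^sup>2 * (?G (U (fst (rot t z))) $ i)\<^sup>2)"
        unfolding power2_norm_eq_inner inner_vec_def P_def by (simp add: power2_eq_square mult_ac)
      also have "\<dots> \<le> (\<Sum>i\<in>UNIV. (\<bar>?G (U (fst z)) $ i\<bar> ^ 4 + \<bar>?G (U (fst (rot t z))) $ i\<bar> ^ 4) / 2)"
      proof (rule sum_mono)
        fix i
        show "(?G (U (fst z)) $ i)\<^sup>2 * (?G (U (fst (rot t z))) $ i)\<^sup>2 \<le> (\<bar>?G (U (fst z)) $ i\<bar> ^ 4 + \<bar>?G (U (fst (rot t z))) $ i\<bar> ^ 4) / 2"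
          using sum_squares_bound[of "(?G (U (fst z)) $ i)\<^sup>2" "(?G (U (fst (rot t z))) $ i)\<^sup>2"]
          by (simp add: power_mult[symmetric] power_even_abs)
      qed
      also have "\<dots> = w z" by (simp add: w_def sum.distrib sum_divide_distrib[symmetric])
      finally show ?thesis .
    qed
    have P1: "integrable std_gauss (\<lambda>z. (norm (P (fst z) (fst (rot t z))))\<^sup>2)"
    proof (rule Bochner_Integration.integrable_bound[OF w(1)])
      show "AE z in std_gauss. norm ((norm (P (fst z) (fst (rot t z))))\<^sup>2) \<le> norm (w z)"
        using le by (intro AE_I2) (auto intro: order_trans[OF _ abs_ge_self])
      show "(\<lambda>z. (norm (P (fst z) (fst (rot t z))))\<^sup>2) \<in> borel_measurable std_gauss"
        using Pm[of t] by measurable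
    qed
    then show "integrable std_gauss (\<lambda>z. (\<alpha> (fst z) (fst (rot t z)))\<^sup>2)" by (simp add: \<alpha>_def power_mult_distrib)
    have "(\<integral>z. (norm (P (fst z) (fst (rot t z))))\<^sup>2 \<partial>std_gauss) \<le> I0"
      unfolding w(2)[symmetric] by (intro integral_mono P1 w(1) le)
    then have "(c1 * c2)\<^sup>2 * (\<integral>z. (norm (P (fst z) (fst (rot t z))))\<^sup>2 \<partial>std_gauss) \<le> (c1 * c2)\<^sup>2 * I0"
      by (rule mult_left_mono) simp
    then show "(\<integral>z. (\<alpha> (fst z) (fst (rot t z)))\<^sup>2 \<partial>std_gauss) \<le> (c1 * c2 * sqrt I0)\<^sup>2"
      unfolding \<alpha>_def power_mult_distrib[of "c1 * c2"] using I0 by simp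
  qed
  have "ennreal (tv_dist M (\<lambda>\<omega>. g (X \<omega>)) N Z) \<le> ennreal (2 * sqrt 5) *
      (ennreal (c1 * c2 * sqrt I0) + ennreal (c1 ^ 3) * kappa1 M X g * kappa2 M X g) / ennreal (var M (\<lambda>\<omega>. g (X \<omega>)))"
  proof (rule tv_dist_transported_functional_le[OF M N g W4 Z X dX U_cont dh dDh cL _ nDh bd _ \<alpha> _ fin(2,3)])
    show "(\<lambda>z. \<alpha> (fst z) (fst (rot t z))) \<in> borel_measurable borel" for t
      unfolding \<alpha>_def by measurable
  qed (use c I0 in auto)
  also have "ennreal (c1 * c2 * sqrt I0) = ennreal (c1 * c2) * kappa0 M X g"
    unfolding k0 using c I0 by (simp add: ennreal_mult)
  finally show ?thesis .
qed

section \<open>Functionals of Gaussian vectors\<close>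

lemma quadratic_form_perturb:
  fixes S :: "'n::finite \<Rightarrow> 'n \<Rightarrow> real"
  assumes sym: "\<And>i j. S i j = S j i"
  shows "(\<Sum>j\<in>UNIV. \<Sum>k\<in>UNIV. (v j + (if j = i then t else 0)) * S j k * (v k + (if k = i then t else 0))) =
    (\<Sum>j\<in>UNIV. \<Sum>k\<in>UNIV. v j * S j k * v k) + 2 * t * (\<Sum>j\<in>UNIV. S i j * v j) + t\<^sup>2 * S i i"
proof -
  let ?d = "\<lambda>j. if j = i then t else 0"
  have "(\<Sum>j\<in>UNIV. \<Sum>k\<in>UNIV. (v j + ?d j) * S j k * (v k + ?d k)) =
     (\<Sum>j\<in>UNIV. \<Sum>k\<in>UNIV. v j * S j k * v k) + (\<Sum>j\<in>UNIV. \<Sum>k\<in>UNIV. v j * S j k * ?d k)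
     + (\<Sum>j\<in>UNIV. \<Sum>k\<in>UNIV. ?d j * S j k * v k) + (\<Sum>j\<in>UNIV. \<Sum>k\<in>UNIV. ?d j * S j k * ?d k)"
    by (simp add: distrib_left distrib_right sum.distrib)
  also have "(\<Sum>j\<in>UNIV. \<Sum>k\<in>UNIV. v j * S j k * ?d k) = t * (\<Sum>j\<in>UNIV. S i j * v j)"
    by (simp add: if_distrib[of "\<lambda>x. _ * x"] sum_distrib_left sym[of _ i] mult_ac cong: if_cong)
  also have "(\<Sum>j\<in>UNIV. \<Sum>k\<in>UNIV. ?d j * S j k * v k) = t * (\<Sum>j\<in>UNIV. S i j * v j)"
  proof -
    have "(\<Sum>j\<in>UNIV. \<Sum>k\<in>UNIV. ?d j * S j k * v k) = (\<Sum>j\<in>UNIV. if j = i then t * (\<Sum>k\<in>UNIV. S i k * v k) else 0)"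
      by (intro sum.cong) (auto simp: sum_distrib_left mult.assoc)
    then show ?thesis by simp
  qed
  also have "(\<Sum>j\<in>UNIV. \<Sum>k\<in>UNIV. ?d j * S j k * ?d k) = t\<^sup>2 * S i i"
  proof -
    have "(\<Sum>j\<in>UNIV. \<Sum>k\<in>UNIV. ?d j * S j k * ?d k) = (\<Sum>j\<in>UNIV. if j = i then t\<^sup>2 * S i i else 0)"
      by (intro sum.cong) (auto simp: if_distrib[of "\<lambda>x. _ * x"] power2_eq_square mult_ac cong: if_cong)
    then show ?thesis by simp
  qed
  finally show ?thesis by simp
qed

text \<open>Induction on a set of indices supporting the matrix. Subtracting the rank-one matrix
  built from row i clears that row and column, and the Schur complement that remains is again
  positive semidefinite. Singular matrices are included.\<close>

lemma Cholesky_decomposition: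
  fixes S :: "'n::finite \<Rightarrow> 'n \<Rightarrow> real"
  assumes "finite I" and "\<And>i j. S i j = S j i"
    and "\<And>v. 0 \<le> (\<Sum>j\<in>UNIV. \<Sum>k\<in>UNIV. v j * S j k * v k)"
    and "\<And>i j. i \<notin> I \<Longrightarrow> S i j = 0"
  shows "\<exists>a. \<forall>i j. S i j = (\<Sum>k\<in>I. a k i * a k j)"
  using assms
proof (induction I arbitrary: S rule: finite_induct)
  case empty
  then show ?case by simp
next
  case (insert i I)
  note sym = insert.prems(1) and psd = insert.prems(2) and supp = insert.prems(3)
  note pert = quadratic_form_perturb[OF sym, where i=i]
  \<comment> \<open>If the pivot is 0 then division by zero gives b = 0, which is the right choice
    since the whole row vanishes by \<open>z\<close>.\<close>
  define b where "b j = S i j / sqrt (S i i)" for j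
  have Sii: "0 \<le> S i i"
    using psd[of "\<lambda>j. if j = i then 1 else 0"] pert[of "\<lambda>_. 0" 1] by simp
  have z: "S i j = 0" if "S i i = 0" for j
  proof (rule ccontr)
    assume nz: "S i j \<noteq> 0"
    define v :: "'n \<Rightarrow> real" where "v k = (if k = j then 1 else 0)" for k
    have "(\<Sum>k\<in>UNIV. S i k * v k) = S i j"
      by (simp add: v_def if_distrib[of "\<lambda>x. _ * x"] cong: if_cong)
    moreover define q where "q = (\<Sum>j\<in>UNIV. \<Sum>k\<in>UNIV. v j * S j k * v k)"
    ultimately have "0 \<le> q + 2 * t * S i j" for t
      using psd[of "\<lambda>j. v j + (if j = i then t else 0)"] pert[of v t] that by simp
    \<comment> \<open>With pivot 0 the form is affine in t, and this t makes it -1; a nonzero slope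
      is therefore incompatible with nonnegativity.\<close>
    moreover have "2 * (- (q + 1) / (2 * S i j)) * S i j = - (q + 1)" using nz by simp
    ultimately have "0 \<le> q + - (q + 1)" by metis
    then show False by simp
  qed
  have bi: "b i * b j = S i j" for j
    using z[of j] Sii by (cases "S i i = 0") (simp_all add: b_def real_div_sqrt)
  define S' where "S' j k = S j k - b j * b k" for j k
  have "\<exists>a. \<forall>i j. S' i j = (\<Sum>k\<in>I. a k i * a k j)"
  proof (rule insert.IH)
    show "S' j k = S' k j" for j k using sym[of j k] by (simp add: S'_def mult.commute)
    show "S' j k = 0" if "j \<notin> I" for j k
    proof (cases "j = i")
      case True
      then show ?thesis using bi[of k] by (simp add: S'_def)
    next
      case False
      then have "j \<notin> insert i I" using that by simp
      then show ?thesis using supp[of j k] supp[of j i] sym[of i j] by (simp add: S'_def b_def)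
    qed
    show "0 \<le> (\<Sum>j\<in>UNIV. \<Sum>k\<in>UNIV. v j * S' j k * v k)" for v
    proof -
      let ?q = "\<Sum>j\<in>UNIV. \<Sum>k\<in>UNIV. v j * S j k * v k" and ?l = "\<Sum>j\<in>UNIV. S i j * v j"
      have "(\<Sum>j\<in>UNIV. \<Sum>k\<in>UNIV. v j * S' j k * v k) = ?q - (\<Sum>j\<in>UNIV. \<Sum>k\<in>UNIV. (b j * v j) * (b k * v k))"
        by (simp add: S'_def left_diff_distrib right_diff_distrib sum_subtractf mult_ac)
      also have "(\<Sum>j\<in>UNIV. \<Sum>k\<in>UNIV. (b j * v j) * (b k * v k)) = (\<Sum>j\<in>UNIV. b j * v j)\<^sup>2"
        by (simp add: sum_product power2_eq_square)
      also have "(\<Sum>j\<in>UNIV. b j * v j) = ?l / sqrt (S i i)"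
        by (simp add: b_def sum_divide_distrib)
      finally have eq: "(\<Sum>j\<in>UNIV. \<Sum>k\<in>UNIV. v j * S' j k * v k) = ?q - ?l\<^sup>2 / S i i"
        using Sii by (simp add: power_divide)
      show ?thesis
      proof (cases "S i i = 0")
        case True
        then show ?thesis using eq psd[of v] by simp
      next
        case False
        \<comment> \<open>The perturbation - ?l / S i i minimizes the quadratic form along axis i,
          and the minimum is the form of the Schur complement at \<open>v\<close>.\<close>
        then have "0 \<le> ?q + 2 * (- ?l / S i i) * ?l + (- ?l / S i i)\<^sup>2 * S i i"
          using psd[of "\<lambda>j. v j + (if j = i then - ?l / S i i else 0)"] unfolding pert by simp
        also have "\<dots> = ?q - ?l\<^sup>2 / S i i" using False by (simp add: power2_eq_square field_simps)
        finally show ?thesis using eq by simp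
      qed
    qed
  qed
  then obtain a where a: "\<And>i j. S' i j = (\<Sum>k\<in>I. a k i * a k j)" by blast
  have "S j k = (\<Sum>l\<in>insert i I. (a(i := b)) l j * (a(i := b)) l k)" for j k
  proof -
    have "(\<Sum>l\<in>I. (a(i := b)) l j * (a(i := b)) l k) = (\<Sum>l\<in>I. a l j * a l k)"
      using insert.hyps(2) by (intro sum.cong) auto
    then show ?thesis using insert.hyps a[of j k] by (simp add: S'_def)
  qed
  then show ?case by blast
qed

section \<open>Characteristic functions in several dimensions\<close>

lemma char_std_gauss:
  "(\<integral>x. iexp (t \<bullet> x) \<partial>std_gauss) = complex_of_real (exp (- (norm t)\<^sup>2 / 2))"
  for t :: "real ^ 'n"
proof -
  have iexp_sum: "iexp (\<Sum>i\<in>A. f i) = (\<Prod>i\<in>A. iexp (f i))" if "finite A" for A :: "'n set" and f :: "'n \<Rightarrow> real"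
    using that by (induction A rule: finite_induct) (auto simp: exp_add distrib_left)
  have [measurable]: "(\<lambda>x. iexp (c * x)) \<in> borel_measurable borel" for c :: real by measurable
  have ind: "std_gauss.indep_vars (\<lambda>_. borel) (\<lambda>i (x :: real ^ 'n). iexp (t $ i * x $ i)) UNIV"
    by (rule std_gauss.indep_vars_compose2[OF indep_vars_std_gauss_coordinates]) measurable
  have "(\<integral>x. iexp (t \<bullet> x) \<partial>std_gauss) = (\<integral>x. (\<Prod>i\<in>UNIV. iexp (t $ i * x $ i)) \<partial>std_gauss)"
    by (simp add: inner_vec_def iexp_sum del: of_real_sum)
  also have "\<dots> = (\<Prod>i\<in>UNIV. \<integral>x. iexp (t $ i * x $ i) \<partial>(std_gauss :: (real ^ 'n) measure))"
    by (rule std_gauss.indep_vars_lebesgue_integral[OF finite ind])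
       (auto intro!: std_gauss.integrable_const_bound[of _ 1])
  also have "\<dots> = (\<Prod>i\<in>UNIV. complex_of_real (exp (- (t $ i)\<^sup>2 / 2)))"
  proof (rule prod.cong[OF refl])
    fix i
    have "(\<integral>x. iexp (t $ i * x $ i) \<partial>(std_gauss :: (real ^ 'n) measure)) =
        (\<integral>y. iexp (t $ i * y) \<partial>distr (std_gauss :: (real ^ 'n) measure) borel (\<lambda>x. x $ i))"
      by (subst integral_distr) auto
    also have "\<dots> = char std_normal_distribution (t $ i)"
      by (simp add: distr_std_gauss_nth std_gauss_real_eq char_def)
    also have "\<dots> = complex_of_real (exp (- (t $ i)\<^sup>2 / 2))"
      by (simp add: char_std_normal_distribution)
    finally show "(\<integral>x. iexp (t $ i * x $ i) \<partial>(std_gauss :: (real ^ 'n) measure)) = complex_of_real (exp (- (t $ i)\<^sup>2 / 2))" .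
  qed
  also have "\<dots> = complex_of_real (exp (\<Sum>i\<in>UNIV. - (t $ i)\<^sup>2 / 2))"
    by (simp add: exp_sum)
  also have "(\<Sum>i\<in>UNIV. - (t $ i)\<^sup>2 / 2) = - (norm t)\<^sup>2 / 2"
  proof -
    have n: "(norm t)\<^sup>2 = (\<Sum>i\<in>UNIV. (t $ i)\<^sup>2)"
      unfolding power2_norm_eq_inner by (simp add: inner_vec_def power2_eq_square)
    show ?thesis unfolding n by (simp add: sum_negf sum_divide_distrib)
  qed
  finally show ?thesis .
qed

lemma nn_integral_lborel_affine:
  fixes f :: "'a::euclidean_space \<Rightarrow> ennreal"
  assumes [measurable]: "f \<in> borel_measurable borel" and c: "0 < c"
  shows "(\<integral>\<^sup>+y. f y \<partial>lborel) = ennreal (c ^ DIM('a)) * (\<integral>\<^sup>+z. f (x + c *\<^sub>R z) \<partial>lborel)"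
  using c by (subst lborel_affine[of c x])
    (simp_all add: nn_integral_density nn_integral_distr nn_integral_cmult)

text \<open>Up to a constant the Gaussian density is its own Fourier transform. Writing it so and
  exchanging the integrals by Fubini expresses the smoothed density through the characteristic
  function of \<open>\<mu>\<close> alone.\<close>

lemma integral_smoothed_density:
  fixes \<mu> :: "(real ^ 'n) measure"
  assumes "prob_space \<mu>" and s: "sets \<mu> = sets borel"
  shows "complex_of_real (\<integral>x. gauss_density (e *\<^sub>R (x - y)) \<partial>\<mu>) =
    complex_of_real ((1 / sqrt (2 * pi)) ^ DIM(real ^ 'n)) *
      (\<integral>z. iexp (- (e * (y \<bullet> z))) * (\<integral>x. iexp ((e *\<^sub>R z) \<bullet> x) \<partial>\<mu>) \<partial>std_gauss)"
proof -
  interpret \<mu>: prob_space \<mu> by fact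
  note [measurable_cong] = s
  interpret pair_prob_space \<mu> "std_gauss :: (real ^ 'n) measure" ..
  let ?c = "complex_of_real ((1 / sqrt (2 * pi)) ^ DIM(real ^ 'n))"
  have "complex_of_real (\<integral>x. gauss_density (e *\<^sub>R (x - y)) \<partial>\<mu>) = (\<integral>x. complex_of_real (gauss_density (e *\<^sub>R (x - y))) \<partial>\<mu>)"
    by simp
  also have "\<dots> = (\<integral>x. ?c * (\<integral>z. iexp ((e *\<^sub>R (x - y)) \<bullet> z) \<partial>std_gauss) \<partial>\<mu>)"
    unfolding char_std_gauss gauss_density_def by (simp only: of_real_mult)
  also have "\<dots> = ?c * (\<integral>x. \<integral>z. iexp ((e *\<^sub>R (x - y)) \<bullet> z) \<partial>std_gauss \<partial>\<mu>)"
    by simp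
  also have "(\<integral>x. \<integral>z. iexp ((e *\<^sub>R (x - y)) \<bullet> z) \<partial>std_gauss \<partial>\<mu>) =
      (\<integral>z. \<integral>x. iexp ((e *\<^sub>R (x - y)) \<bullet> z) \<partial>\<mu> \<partial>std_gauss)"
    by (rule Fubini_integral[symmetric]) (auto intro!: integrable_const_bound[of _ 1] simp: split_beta')
  also have "\<dots> = (\<integral>z. iexp (- (e * (y \<bullet> z))) * (\<integral>x. iexp ((e *\<^sub>R z) \<bullet> x) \<partial>\<mu>) \<partial>std_gauss)"
  proof (rule Bochner_Integration.integral_cong[OF refl])
    fix z
    have "iexp ((e *\<^sub>R (x - y)) \<bullet> z) = iexp (- (e * (y \<bullet> z))) * iexp ((e *\<^sub>R z) \<bullet> x)" for x
    proof -
      have "(e *\<^sub>R (x - y)) \<bullet> z = - (e * (y \<bullet> z)) + (e *\<^sub>R z) \<bullet> x"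
        by (simp add: inner_diff_left inner_diff_right inner_commute right_diff_distrib)
      then show ?thesis by (simp only: of_real_add distrib_left exp_add)
    qed
    then show "(\<integral>x. iexp ((e *\<^sub>R (x - y)) \<bullet> z) \<partial>\<mu>) = iexp (- (e * (y \<bullet> z))) * (\<integral>x. iexp ((e *\<^sub>R z) \<bullet> x) \<partial>\<mu>)"
      by simp
  qed
  finally show ?thesis .
qed

text \<open>Two readings of adding Gaussian noise of scale \<open>e\<close> to \<open>\<mu>\<close>:
  integrate against the smoothed density, or average over the noise. The substitution y = x + e z
  links them and produces the power of \<open>e\<close>.\<close>

lemma nn_integral_smoothed:
  fixes \<mu> :: "(real ^ 'n) measure" and \<psi> :: "real ^ 'n \<Rightarrow> real"
  assumes "prob_space \<mu>" and s: "sets \<mu> = sets borel" and e: "0 < e"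
    and [measurable]: "\<psi> \<in> borel_measurable borel"
  shows "(\<integral>\<^sup>+y. ennreal (\<psi> y) * ennreal (\<integral>x. gauss_density ((1 / e) *\<^sub>R (x - y)) \<partial>\<mu>) \<partial>lborel) =
    ennreal (e ^ DIM(real ^ 'n)) * (\<integral>\<^sup>+x. \<integral>\<^sup>+z. ennreal (\<psi> (x + e *\<^sub>R z)) \<partial>std_gauss \<partial>\<mu>)"
proof -
  interpret \<mu>: prob_space \<mu> by fact
  note [measurable_cong] = s
  interpret pair_sigma_finite \<mu> "lborel :: (real ^ 'n) measure" ..
  have gb: "gauss_density z \<le> (1 / sqrt (2 * pi)) ^ DIM(real ^ 'n)" for z :: "real ^ 'n"
    unfolding gauss_density_def by (intro mult_left_le) auto
  have i: "integrable \<mu> (\<lambda>x. gauss_density ((1 / e) *\<^sub>R (x - y)))" for y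
    using gb by (intro \<mu>.integrable_const_bound[of _ "(1 / sqrt (2 * pi)) ^ DIM(real ^ 'n)"]) auto
  have "(\<integral>\<^sup>+y. ennreal (\<psi> y) * ennreal (\<integral>x. gauss_density ((1 / e) *\<^sub>R (x - y)) \<partial>\<mu>) \<partial>lborel) =
     (\<integral>\<^sup>+y. \<integral>\<^sup>+x. ennreal (\<psi> y) * ennreal (gauss_density ((1 / e) *\<^sub>R (x - y))) \<partial>\<mu> \<partial>lborel)"
    using i by (intro nn_integral_cong) (simp add: nn_integral_cmult nn_integral_eq_integral)
  also have "\<dots> = (\<integral>\<^sup>+x. \<integral>\<^sup>+y. ennreal (\<psi> y) * ennreal (gauss_density ((1 / e) *\<^sub>R (x - y))) \<partial>lborel \<partial>\<mu>)"
    by (rule Fubini') (simp add: split_beta')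
  also have "\<dots> = (\<integral>\<^sup>+x. ennreal (e ^ DIM(real ^ 'n)) * (\<integral>\<^sup>+z. ennreal (\<psi> (x + e *\<^sub>R z)) \<partial>std_gauss) \<partial>\<mu>)"
  proof (rule nn_integral_cong)
    fix x
    have "(\<integral>\<^sup>+y. ennreal (\<psi> y) * ennreal (gauss_density ((1 / e) *\<^sub>R (x - y))) \<partial>lborel) = ennreal (e ^ DIM(real ^ 'n)) *
        (\<integral>\<^sup>+z. ennreal (\<psi> (x + e *\<^sub>R z)) * ennreal (gauss_density ((1 / e) *\<^sub>R (x - (x + e *\<^sub>R z)))) \<partial>lborel)"
      using e by (intro nn_integral_lborel_affine) auto
    also have "(\<integral>\<^sup>+z. ennreal (\<psi> (x + e *\<^sub>R z)) * ennreal (gauss_density ((1 / e) *\<^sub>R (x - (x + e *\<^sub>R z)))) \<partial>lborel)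
       = (\<integral>\<^sup>+z. ennreal (\<psi> (x + e *\<^sub>R z)) \<partial>std_gauss)"
      using e unfolding std_gauss_def
      by (subst nn_integral_density) (auto simp: gauss_density_def mult.commute intro!: nn_integral_cong)
    finally show "(\<integral>\<^sup>+y. ennreal (\<psi> y) * ennreal (gauss_density ((1 / e) *\<^sub>R (x - y))) \<partial>lborel) = ennreal (e ^ DIM(real ^ 'n)) *
        (\<integral>\<^sup>+z. ennreal (\<psi> (x + e *\<^sub>R z)) \<partial>std_gauss)" .
  qed
  also have "\<dots> = ennreal (e ^ DIM(real ^ 'n)) * (\<integral>\<^sup>+x. \<integral>\<^sup>+z. ennreal (\<psi> (x + e *\<^sub>R z)) \<partial>std_gauss \<partial>\<mu>)"
    by (rule nn_integral_cmult) measurable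
  finally show ?thesis .
qed

text \<open>The characteristic function determines the density of \<^term>\<open>\<mu>\<close> convolved with a small Gaussian;
  letting the scale tend to 0 recovers \<^term>\<open>\<mu>\<close>.\<close>

lemma char_vec_uniqueness:
  fixes \<mu> \<nu> :: "(real ^ 'n) measure"
  assumes \<mu>: "prob_space \<mu>" "sets \<mu> = sets borel" and \<nu>: "prob_space \<nu>" "sets \<nu> = sets borel"
    and char: "\<And>t. (\<integral>x. iexp (t \<bullet> x) \<partial>\<mu>) = (\<integral>x. iexp (t \<bullet> x) \<partial>\<nu>)"
  shows "\<mu> = \<nu>"
proof -
  interpret \<mu>: prob_space \<mu> by fact
  interpret \<nu>: prob_space \<nu> by fact
  have dens: "(\<integral>x. gauss_density (e *\<^sub>R (x - y)) \<partial>\<mu>) = (\<integral>x. gauss_density (e *\<^sub>R (x - y)) \<partial>\<nu>)" for e y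
    using integral_smoothed_density[OF \<mu>, of e y] integral_smoothed_density[OF \<nu>, of e y]
    unfolding char of_real_eq_iff[symmetric, where 'a=complex] by simp
  have tests: "(\<integral>x. \<psi> x \<partial>\<mu>) = (\<integral>x. \<psi> x \<partial>\<nu>)"
    if \<psi>: "continuous_on UNIV \<psi>" "\<And>x. 0 \<le> \<psi> x" "\<And>x. \<psi> x \<le> 1" for \<psi> :: "real ^ 'n \<Rightarrow> real"
  proof -
    have [measurable]: "\<psi> \<in> borel_measurable borel" using \<psi>(1) by (rule borel_measurable_continuous_onI)
    define \<epsilon> where "\<epsilon> k = inverse (real (Suc k))" for k
    have \<epsilon>: "0 < \<epsilon> k" "\<epsilon> \<longlonglongrightarrow> 0" for k
      unfolding \<epsilon>_def using LIMSEQ_inverse_real_of_nat by simp_all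
    define I where "I m k = (\<integral>\<^sup>+x. \<integral>\<^sup>+z. ennreal (\<psi> (x + \<epsilon> k *\<^sub>R z)) \<partial>std_gauss \<partial>m)" for m k
    have eq: "I \<mu> k = I \<nu> k" for k
    proof -
      \<comment> \<open>By \<open>dens\<close> the smoothed densities of the two measures coincide;
        the positive power of the scale then cancels.\<close>
      have "ennreal (\<epsilon> k ^ DIM(real ^ 'n)) * I \<mu> k = ennreal (\<epsilon> k ^ DIM(real ^ 'n)) * I \<nu> k"
        unfolding I_def nn_integral_smoothed[OF \<mu> \<epsilon>(1) \<open>\<psi> \<in> borel_measurable borel\<close>, symmetric]
          nn_integral_smoothed[OF \<nu> \<epsilon>(1) \<open>\<psi> \<in> borel_measurable borel\<close>, symmetric] dens ..
      then show ?thesis using \<epsilon>(1)[of k] by (simp add: ennreal_mult_cancel_left)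
    qed
    have lim: "(\<lambda>k. enn2real (I m k)) \<longlonglongrightarrow> (\<integral>x. \<psi> x \<partial>m)" if m: "prob_space m" "sets m = sets borel" for m
    proof -
      interpret m: prob_space m by fact
      note [measurable_cong] = m(2)
      have i: "integrable std_gauss (\<lambda>z. \<psi> (x + \<epsilon> k *\<^sub>R z))" for x k
        using \<psi>(2,3) by (intro integrable_bounded_std_gauss[of _ 1]) auto
      \<comment> \<open>\<open>\<psi>\<close> averaged over Gaussian noise of scale
        \<open>\<epsilon> k\<close>. It tends to \<open>\<psi>\<close> pointwise by continuity, and
        the constant 1 dominates both this limit and the one under \<open>m\<close>.\<close>
      define J where "J k x = (\<integral>z. \<psi> (x + \<epsilon> k *\<^sub>R z) \<partial>std_gauss)" for k x
      have J: "0 \<le> J k x" "J k x \<le> 1" for k x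
        unfolding J_def using \<psi>(2,3) i by (auto intro!: Bochner_Integration.integral_nonneg std_gauss.integral_le_const)
      have [measurable]: "J k \<in> borel_measurable borel" for k
        unfolding J_def by measurable
      have iJ: "integrable m (J k)" for k
        using J by (intro m.integrable_const_bound[of _ 1]) auto
      have "I m k = ennreal (\<integral>x. J k x \<partial>m)" for k
        unfolding I_def using i iJ \<psi>(2) J(1) by (simp add: nn_integral_eq_integral J_def[symmetric])
      then have IJ: "enn2real (I m k) = (\<integral>x. J k x \<partial>m)" for k
        using J(1) by (simp add: Bochner_Integration.integral_nonneg)
      have "(\<lambda>k. \<integral>x. J k x \<partial>m) \<longlonglongrightarrow> (\<integral>x. \<psi> x \<partial>m)"
      proof (rule integral_dominated_convergence[where w="\<lambda>_. 1"])
        show "AE x in m. (\<lambda>k. J k x) \<longlonglongrightarrow> \<psi> x"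
        proof (rule AE_I2)
          fix x
          have "(\<lambda>k. J k x) \<longlonglongrightarrow> (\<integral>z. \<psi> x \<partial>(std_gauss :: (real ^ 'n) measure))"
            unfolding J_def
          proof (rule integral_dominated_convergence[where w="\<lambda>_. 1"])
            show "AE z in std_gauss. (\<lambda>k. \<psi> (x + \<epsilon> k *\<^sub>R z)) \<longlonglongrightarrow> \<psi> x"
            proof (rule AE_I2)
              fix z
              have "(\<lambda>k. x + \<epsilon> k *\<^sub>R z) \<longlonglongrightarrow> x + 0 *\<^sub>R z" by (intro tendsto_intros \<epsilon>)
              then have "(\<lambda>k. x + \<epsilon> k *\<^sub>R z) \<longlonglongrightarrow> x" by simp
              then show "(\<lambda>k. \<psi> (x + \<epsilon> k *\<^sub>R z)) \<longlonglongrightarrow> \<psi> x"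
                using \<psi>(1) by (intro isCont_tendsto_compose[of x \<psi>]) (auto simp: continuous_on_eq_continuous_at)
            qed
          qed (use \<psi>(2,3) in auto)
          then show "(\<lambda>k. J k x) \<longlonglongrightarrow> \<psi> x"
            using std_gauss.prob_space[where 'a="real ^ 'n"] by simp
        qed
      qed (use J in auto)
      then show ?thesis by (simp add: IJ)
    qed
    show ?thesis
      using LIMSEQ_unique[OF lim[OF \<mu>] lim[OF \<nu>, folded eq]] .
  qed
  show ?thesis
  proof (rule measure_eqI)
    show "sets \<mu> = sets \<nu>" by (simp add: \<mu> \<nu>)
    fix A assume "A \<in> sets \<mu>"
    then have "\<bar>measure \<mu> A - measure \<nu> A\<bar> \<le> 0"
      by (intro measure_diff_le_of_continuous_tests \<mu> \<nu>) (auto simp: \<mu> tests)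
    then show "emeasure \<mu> A = emeasure \<nu> A" by (simp add: \<mu>.emeasure_eq_measure \<nu>.emeasure_eq_measure)
  qed
qed

section \<open>Gaussian vectors as linear images of standard ones\<close>

lemma inner_matrix_eq_sum:
  fixes S :: "real ^ 'n ^ 'n"
  shows "t \<bullet> (S *v t) = (\<Sum>j\<in>UNIV. \<Sum>k\<in>UNIV. t $ j * S $ j $ k * t $ k)"
  by (simp add: inner_vec_def matrix_vector_mult_def sum_distrib_left mult.assoc)

lemma gaussian_vector_second_moments:
  fixes X :: "'a \<Rightarrow> real ^ 'n"
  assumes M: "prob_space M" and X: "gaussian_vector M X 0 S"
  shows "mean M (\<lambda>\<omega>. t \<bullet> X \<omega>) = 0" "mean M (\<lambda>\<omega>. (t \<bullet> X \<omega>)\<^sup>2) = t \<bullet> (S *v t)" "S $ i $ j = S $ j $ i"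
proof -
  interpret M: prob_space M by fact
  have [measurable]: "X \<in> borel_measurable M" using X by (simp add: gaussian_vector_def)
  have i2: "integrable M (\<lambda>\<omega>. (X \<omega> $ i)\<^sup>2)" for i
  proof -
    \<comment> \<open>Integrals of non-integrable functions default to 0, so the mean and covariance
      equations say something only once moments exist; normality of each coordinate provides
      them.\<close>
    have "normal_rv M (\<lambda>\<omega>. axis i 1 \<bullet> X \<omega>)" using X by (simp add: gaussian_vector_def)
    then obtain m s where "(\<lambda>\<omega>. X \<omega> $ i) \<in> borel_measurable M" "0 \<le> s" "distr M borel (\<lambda>\<omega>. X \<omega> $ i) = normal_law m s"
      by (auto simp: normal_rv_def inner_commute[of "axis i 1"] inner_axis)
    then show ?thesis using normal_law_moments(3)[OF M] by blast
  qed
  have i1: "integrable M (\<lambda>\<omega>. X \<omega> $ i)" for i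
    by (rule M.square_integrable_imp_integrable[OF _ i2]) measurable
  have i11: "integrable M (\<lambda>\<omega>. X \<omega> $ i * X \<omega> $ j)" for i j
    by (rule Cauchy_Schwarz_integral(1)) (use i2 in auto)
  have m0: "mean M (\<lambda>\<omega>. X \<omega> $ i) = 0" for i using X by (simp add: gaussian_vector_def)
  have S: "mean M (\<lambda>\<omega>. X \<omega> $ i * X \<omega> $ j) = S $ i $ j" for i j
    using X by (simp add: gaussian_vector_def)
  show "mean M (\<lambda>\<omega>. t \<bullet> X \<omega>) = 0"
    using i1 m0 by (simp add: inner_vec_def Bochner_Integration.integral_sum)
  have "(t \<bullet> X \<omega>)\<^sup>2 = (\<Sum>j\<in>UNIV. \<Sum>k\<in>UNIV. t $ j * t $ k * (X \<omega> $ j * X \<omega> $ k))" for \<omega>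
    by (simp add: inner_vec_def power2_eq_square sum_product mult_ac)
  then have "mean M (\<lambda>\<omega>. (t \<bullet> X \<omega>)\<^sup>2) = (\<Sum>j\<in>UNIV. \<Sum>k\<in>UNIV. t $ j * t $ k * S $ j $ k)"
    using i11 S by (simp add: Bochner_Integration.integral_sum)
  then show "mean M (\<lambda>\<omega>. (t \<bullet> X \<omega>)\<^sup>2) = t \<bullet> (S *v t)"
    by (simp add: inner_matrix_eq_sum mult_ac)
  show "S $ i $ j = S $ j $ i"
    using S[of i j] S[of j i] by (simp add: mult.commute)
qed

text \<open>The functional \<open>t \<bullet> X\<close> is normal with mean 0 and variance
  \<open>t \<bullet> (S *v t)\<close>, so its one-dimensional characteristic function at 1
  decides.\<close>

lemma char_gaussian_vector:
  fixes X :: "'a \<Rightarrow> real ^ 'n"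
  assumes M: "prob_space M" and X: "gaussian_vector M X 0 S"
  shows "(\<integral>x. iexp (t \<bullet> x) \<partial>distr M borel X) = complex_of_real (exp (- (t \<bullet> (S *v t)) / 2))"
proof -
  interpret M: prob_space M by fact
  have Xm [measurable]: "X \<in> borel_measurable M" using X by (simp add: gaussian_vector_def)
  have "normal_rv M (\<lambda>\<omega>. t \<bullet> X \<omega>)" using X by (simp add: gaussian_vector_def)
  then obtain m s where ms: "0 \<le> s" "distr M borel (\<lambda>\<omega>. t \<bullet> X \<omega>) = normal_law m s"
    unfolding normal_rv_def by blast
  have tX: "(\<lambda>\<omega>. t \<bullet> X \<omega>) \<in> borel_measurable M" by measurable
  note mom = normal_law_moments[OF M tX ms(2,1)]
  have m: "m = 0" using mom(1) gaussian_vector_second_moments(1)[OF M X] by simp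
  then have s: "s\<^sup>2 = t \<bullet> (S *v t)"
    using mom(1,2) gaussian_vector_second_moments(2)[OF M X] by simp
  have "(\<integral>x. iexp (t \<bullet> x) \<partial>distr M borel X) = (\<integral>\<omega>. iexp (t \<bullet> X \<omega>) \<partial>M)"
    by (rule integral_distr) auto
  also have "\<dots> = (\<integral>y. iexp y \<partial>distr M borel (\<lambda>\<omega>. t \<bullet> X \<omega>))"
    by (rule integral_distr[symmetric]) auto
  also have "\<dots> = (\<integral>y. iexp (s * y) \<partial>(std_gauss :: real measure))"
    unfolding ms(2) normal_law_eq_distr[OF ms(1)] by (subst integral_distr) (auto simp: m)
  also have "\<dots> = char std_normal_distribution s"
    by (simp add: char_def std_gauss_real_eq)
  also have "\<dots> = complex_of_real (exp (- (t \<bullet> (S *v t)) / 2))"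
    by (simp add: char_std_normal_distribution s)
  finally show ?thesis .
qed

text \<open>With S = A ** transpose A the characteristic functions of X and of A applied to a
  standard vector agree. The squared norm of the transpose applied to v is
  \<open>v \<bullet> (S *v v)\<close>, which gives the square root of the norm of S, first for the
  transpose and then for A.\<close>

lemma gaussian_vector_representation:
  fixes X :: "'a \<Rightarrow> real ^ 'n"
  assumes M: "prob_space M" and X: "gaussian_vector M X 0 S"
  obtains A :: "real ^ 'n ^ 'n"
  where "distr M borel X = distr std_gauss borel (\<lambda>x. A *v x)"
    "\<And>v. norm (A *v v) \<le> sqrt (mat_norm S) * norm v"
    "\<And>v. norm (transpose A *v v) \<le> sqrt (mat_norm S) * norm v"
proof -
  interpret M: prob_space M by fact
  have Xm [measurable]: "X \<in> borel_measurable M" using X by (simp add: gaussian_vector_def)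
  note mom = gaussian_vector_second_moments[OF M X]
  have psd: "0 \<le> (\<Sum>j\<in>UNIV. \<Sum>k\<in>UNIV. v j * S $ j $ k * v k)" for v
  proof -
    have "0 \<le> mean M (\<lambda>\<omega>. ((\<chi> i. v i) \<bullet> X \<omega>)\<^sup>2)" by (rule Bochner_Integration.integral_nonneg) simp
    then show ?thesis unfolding mom(2) inner_matrix_eq_sum by simp
  qed
  have "\<exists>a :: 'n \<Rightarrow> 'n \<Rightarrow> real. \<forall>i j. S $ i $ j = (\<Sum>k\<in>UNIV. a k i * a k j)"
    by (rule Cholesky_decomposition[OF finite mom(3) psd]) simp
  then obtain a :: "'n \<Rightarrow> 'n \<Rightarrow> real" where a: "\<And>i j. S $ i $ j = (\<Sum>k\<in>UNIV. a k i * a k j)" by blast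
  \<comment> \<open>The factorization sums over the first index of \<open>a\<close>, so that index
    becomes the column of \<open>A\<close>.\<close>
  define A :: "real ^ 'n ^ 'n" where "A = (\<chi> i k. a k i)"
  have "S = A ** transpose A"
    by (simp add: vec_eq_iff a A_def matrix_matrix_mult_def transpose_def)
  then have q: "(norm (transpose A *v v))\<^sup>2 = v \<bullet> (S *v v)" for v
    unfolding power2_norm_eq_inner
    by (metis inner_commute inner_matrix_vector_transpose matrix_vector_mul_assoc)
  have At: "norm (transpose A *v v) \<le> sqrt (mat_norm S) * norm v" for v
  proof -
    have "(norm (transpose A *v v))\<^sup>2 \<le> norm v * norm (S *v v)"
      unfolding q by (rule norm_cauchy_schwarz)
    also have "\<dots> \<le> norm v * (mat_norm S * norm v)"
      by (intro mult_left_mono norm_matrix_vector_mult_le) auto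
    also have "\<dots> = (sqrt (mat_norm S) * norm v)\<^sup>2"
      by (simp add: power_mult_distrib mat_norm_nonneg power2_eq_square)
    finally show ?thesis
      by (rule power2_le_imp_le) (simp add: mat_norm_nonneg)
  qed
  have "mat_norm (transpose A) \<le> sqrt (mat_norm S)"
    unfolding mat_norm_def[of "transpose A"]
    by (rule onorm_bound) (rule At | simp add: mat_norm_nonneg)+
  then have An: "norm (A *v v) \<le> sqrt (mat_norm S) * norm v" for v
    using norm_transpose_mult_le[of "transpose A" v] mult_right_mono[of "mat_norm (transpose A)" "sqrt (mat_norm S)" "norm v"]
    by (simp add: transpose_transpose)
  have Am: "(\<lambda>x. A *v x) \<in> borel_measurable std_gauss"
    unfolding measurable_cong_sets[OF sets_std_gauss refl]
    by (intro borel_measurable_continuous_onI linear_continuous_on matrix_vector_mul_bounded_linear)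
  have "distr M borel X = distr std_gauss borel (\<lambda>x. A *v x)"
  proof (rule char_vec_uniqueness)
    show "prob_space (distr M borel X)" by (rule M.prob_space_distr) simp
    show "prob_space (distr std_gauss borel (\<lambda>x. A *v x))" by (rule std_gauss.prob_space_distr[OF Am])
    fix t :: "real ^ 'n"
    have "(\<integral>x. iexp (t \<bullet> x) \<partial>distr std_gauss borel (\<lambda>x. A *v x)) = (\<integral>x. iexp (t \<bullet> (A *v x)) \<partial>std_gauss)"
      using Am by (intro integral_distr) auto
    also have "\<dots> = (\<integral>x. iexp ((transpose A *v t) \<bullet> x) \<partial>std_gauss)"
    proof -
      have "t \<bullet> (A *v x) = (transpose A *v t) \<bullet> x" for x
        by (metis inner_commute inner_matrix_vector_transpose)
      then show ?thesis by (simp only:)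
    qed
    also have "\<dots> = complex_of_real (exp (- (t \<bullet> (S *v t)) / 2))"
      unfolding char_std_gauss q ..
    finally show "(\<integral>x. iexp (t \<bullet> x) \<partial>distr M borel X) = (\<integral>x. iexp (t \<bullet> x) \<partial>distr std_gauss borel (\<lambda>x. A *v x))"
      unfolding char_gaussian_vector[OF M X] ..
  qed simp_all
  then show ?thesis using At An by (intro that[of A])
qed

text \<open>U is linear, so \<open>\<alpha>\<close> is 0. The Hessian of h is that of g between the
  transpose of A and A, and Dh brings a third factor; each costs the square root of the norm of S,
  whence the exponent 3/2.\<close>

lemma tv_dist_gaussian_vector_le:
  fixes M :: "'a measure" and N :: "'b measure"
    and X :: "'a \<Rightarrow> real ^ 'n" and g :: "real ^ 'n \<Rightarrow> real" and Z :: "'b \<Rightarrow> real"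
  assumes M: "prob_space M" and N: "prob_space N" and g: "C2 g"
    and W4: "integrable M (\<lambda>\<omega>. g (X \<omega>) ^ 4)"
    and Z: "normal_rv N Z" "mean N Z = mean M (\<lambda>\<omega>. g (X \<omega>))" "var N Z = var M (\<lambda>\<omega>. g (X \<omega>))"
    and XS: "gaussian_vector M X 0 S"
    and fin: "kappa1 M X g < \<top>" "kappa2 M X g < \<top>"
  shows "ennreal (tv_dist M (\<lambda>\<omega>. g (X \<omega>)) N Z) \<le>
    ennreal (2 * sqrt 5) * (ennreal (mat_norm S powr (3 / 2)) * kappa1 M X g * kappa2 M X g)
    / ennreal (var M (\<lambda>\<omega>. g (X \<omega>)))"
proof -
  have Xm [measurable]: "X \<in> borel_measurable M" using XS by (simp add: gaussian_vector_def)
  obtain A :: "real ^ 'n ^ 'n" where dX: "distr M borel X = distr std_gauss borel (\<lambda>x. A *v x)"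
    and A1: "\<And>v. norm (A *v v) \<le> sqrt (mat_norm S) * norm v"
    and A2: "\<And>v. norm (transpose A *v v) \<le> sqrt (mat_norm S) * norm v"
    using gaussian_vector_representation[OF M XS] by blast
  define s where "s = sqrt (mat_norm S)"
  have s0: "0 \<le> s" by (simp add: s_def mat_norm_nonneg)
  note A1 = A1[folded s_def] and A2 = A2[folded s_def]
  define U where "U x = A *v x" for x
  note dX = dX[folded U_def[abs_def]]
  note gD = C2D[OF g]
  let ?G = "gradient g" and ?H = "hessian g"
  have U_cont: "continuous_on UNIV U"
    unfolding U_def by (intro linear_continuous_on matrix_vector_mul_bounded_linear)
  define Dh where "Dh x = transpose A *v ?G (U x)" for x
  define L where "L x v = transpose A *v (?H (U x) *v (A *v v))" for x v
  have dU: "(U has_derivative (\<lambda>v. A *v v)) (at x)" for x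
    unfolding U_def[abs_def] by (rule bounded_linear_imp_has_derivative) (rule matrix_vector_mul_bounded_linear)
  have dh: "((\<lambda>x. g (U x)) has_derivative (\<lambda>v. Dh x \<bullet> v)) (at x)" for x
  proof -
    have eq: "?G (U x) \<bullet> (A *v v) = Dh x \<bullet> v" for v
      unfolding Dh_def by (metis inner_commute inner_matrix_vector_transpose)
    have "((\<lambda>x. g (U x)) has_derivative (\<lambda>v. ?G (U x) \<bullet> (A *v v))) (at x)"
      by (rule has_derivative_compose[OF dU gD(1)])
    then show ?thesis
      by (simp only: eq)
  qed
  have dDh: "(Dh has_derivative L x) (at x)" for x
    unfolding Dh_def[abs_def] L_def[abs_def]
    by (rule bounded_linear.has_derivative[OF matrix_vector_mul_bounded_linear has_derivative_compose[OF dU gD(2)]])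
  have cL: "continuous_on UNIV (\<lambda>x. L x v)" for v
    unfolding L_def matrix_vector_mult_def
    by (intro continuous_intros continuous_on_compose2[OF gD(5) U_cont]) auto
  have nDh: "norm (Dh x) \<le> s * norm (?G (U x))" for x
    unfolding Dh_def by (rule A2)
  have bd: "norm (adjoint (L x) (Dh y)) \<le> 0 + s ^ 3 * (mat_norm (?H (U x)) * norm (?G (U y)))" for x y
  proof -
    have "adjoint (L x) = (\<lambda>w. transpose A *v (transpose (?H (U x)) *v (A *v w)))"
    proof (rule adjoint_unique, intro allI)
      fix v w
      show "L x v \<bullet> w = v \<bullet> (transpose A *v (transpose (?H (U x)) *v (A *v w)))"
        unfolding L_def by (simp only: inner_matrix_vector_transpose transpose_transpose)
    qed
    then have "norm (adjoint (L x) (Dh y)) \<le> s * norm (transpose (?H (U x)) *v (A *v Dh y))"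
      by (simp only: A2)
    also have "\<dots> \<le> s * (mat_norm (?H (U x)) * norm (A *v Dh y))"
      using s0 by (intro mult_left_mono norm_transpose_mult_le)
    also have "\<dots> \<le> s * (mat_norm (?H (U x)) * (s * (s * norm (?G (U y)))))"
      using s0 by (intro mult_left_mono order_trans[OF A1] nDh mat_norm_nonneg)
    also have "\<dots> = 0 + s ^ 3 * (mat_norm (?H (U x)) * norm (?G (U y)))" by (simp add: power3_eq_cube)
    finally show ?thesis .
  qed
  have "s ^ 3 = mat_norm S powr (3 / 2)"
  \<comment> \<open>\<open>powr\<close> with base 0 is 0 by convention, which agrees with
    \<open>s ^ 3\<close> for S = 0.\<close>
  proof (cases "mat_norm S = 0")
    case False
    then have "0 < mat_norm S" using mat_norm_nonneg[of S] by simp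
    then show ?thesis
      by (simp add: s_def powr_half_sqrt[symmetric] powr_power)
  qed (simp add: s_def)
  moreover have "ennreal (tv_dist M (\<lambda>\<omega>. g (X \<omega>)) N Z) \<le> ennreal (2 * sqrt 5) *
      (ennreal 0 + ennreal (s ^ 3) * kappa1 M X g * kappa2 M X g) / ennreal (var M (\<lambda>\<omega>. g (X \<omega>)))"
    by (rule tv_dist_transported_functional_le[OF M N g W4 Z Xm dX U_cont dh dDh cL s0 nDh bd _ _ _ _ fin]) auto
  ultimately show ?thesis by simp
qed

theorem theorem2p2:
  fixes M :: "'a measure" and N :: "'b measure"
    and X :: "'a \<Rightarrow> real ^ 'n" and g :: "real ^ 'n \<Rightarrow> real" and Z :: "'b \<Rightarrow> real"
  assumes "prob_space M" and "prob_space N"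
    and "C2 g"
    and "integrable M (\<lambda>\<omega>. g (X \<omega>) ^ 4)"
    and "normal_rv N Z"
    and "mean N Z = mean M (\<lambda>\<omega>. g (X \<omega>))"
    and "var N Z = var M (\<lambda>\<omega>. g (X \<omega>))"
  shows "(\<forall>c1 c2. 0 < c1 \<longrightarrow> 0 < c2 \<longrightarrow>
            prob_space.indep_vars M (\<lambda>_. borel) (\<lambda>i \<omega>. X \<omega> $ i) UNIV \<longrightarrow>
            (\<forall>i. distr M borel (\<lambda>\<omega>. X \<omega> $ i) \<in> lip_gauss_laws c1 c2) \<longrightarrow>
            kappa0 M X g < \<top> \<longrightarrow> kappa1 M X g < \<top> \<longrightarrow> kappa2 M X g < \<top> \<longrightarrow>
            ennreal (tv_dist M (\<lambda>\<omega>. g (X \<omega>)) N Z) \<le>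
              ennreal (2 * sqrt 5) *
                (ennreal (c1 * c2) * kappa0 M X g + ennreal (c1 ^ 3) * kappa1 M X g * kappa2 M X g)
              / ennreal (var M (\<lambda>\<omega>. g (X \<omega>))))
       \<and> (\<forall>S. gaussian_vector M X 0 S \<longrightarrow>
            kappa1 M X g < \<top> \<longrightarrow> kappa2 M X g < \<top> \<longrightarrow>
            ennreal (tv_dist M (\<lambda>\<omega>. g (X \<omega>)) N Z) \<le>
              ennreal (2 * sqrt 5) *
                (ennreal (mat_norm S powr (3 / 2)) * kappa1 M X g * kappa2 M X g)
              / ennreal (var M (\<lambda>\<omega>. g (X \<omega>))))"
  using tv_dist_independent_le[OF assms] tv_dist_gaussian_vector_le[OF assms] by blast

end
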